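(* Let $(X,\varphi,\mathbb{Z}^d)$ and $(Y,\psi,\mathbb{Z}^d)$ be two free minimal Cantor systems which are bounded orbit injection equivalent, with bounded orbit injections $\theta_1$ (from $(X,\varphi,\mathbb{Z}^d)$) and $\theta_2$ (from $(Y,\psi,\mathbb{Z}^d)$) into a common free minimal Cantor system $(Z,\alpha,\mathbb{Z}^d)$. Let $h_{\theta_1}:(G(\varphi),G(\varphi)_+)\to(G(\alpha),G(\alpha)_+)$ and $h_{\theta_2}:(G(\psi),G(\psi)_+)\to(G(\alpha),G(\alpha)_+)$ be the induced isomorphisms. Suppose $h_{\theta_1}[1_X]=h_{\theta_2}[1_Y]$ in $G(\alpha)$. Then there is a bounded orbit equivalence $\theta$ from $(X,\varphi,\mathbb{Z}^d)$ to $(Y,\psi,\mathbb{Z}^d)$. Further, $h_\theta=h_{\theta_2}^{-1}h_{\theta_1}$ is an isomorphism from $(G(\varphi),G(\varphi)_+)$ to $(G(\psi),G(\psi)_+)$.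
   Context: $d$ is a positive integer. A dynamical system $(X,\varphi,\mathbb{Z}^d)$ is a compact space $X$ with an action $\varphi$ of $\mathbb{Z}^d$ by homeomorphisms $\varphi^z$. It is a Cantor system if $X$ is a Cantor set, free if the action is free, and minimal if every orbit is dense. Orbit injection: for free dynamical systems $(X,\varphi,\mathbb{Z}^d)$ and $(Y,\psi,\mathbb{Z}^d)$, a map $\theta:X\to Y$ is an orbit injection if it is a continuous open injection such that for all $x,y\in X$: there is $w\in\mathbb{Z}^d$ with $\varphi^w(x)=y$ if and only if there is $v\in\mathbb{Z}^d$ with $\psi^v(\theta(x))=\theta(y)$. Its cocycle is the (unique) function $\eta:X\times\mathbb{Z}^d\to\mathbb{Z}^d$ with $\psi^{\eta(x,w)}(\theta(x))=\theta(\varphi^w(x))$. The orbit injection is bounded if $\eta$ is continuous. Two free minimal Cantor systems are bounded orbit injection equivalent if there are bounded orbit injections from both of them into a common free minimal Cantor system. A bounded orbit equivalence from $(X,\varphi,\mathbb{Z}^d)$ to $(Y,\psi,\mathbb{Z}^d)$ is a homeomorphism $\theta:X\to Y$ mapping $\varphi$-orbits onto $\psi$-orbits such that the function $\eta:X\times\mathbb{Z}^d\to\mathbb{Z}^d$ with $\theta(\varphi^v(x))=\psi^{\eta(x,v)}(\theta(x))$ is continuous. Ordered group: $G(\varphi)=C(X,\mathbb{Z})/B(\varphi)$, where $B(\varphi)$ is the subgroup of $C(X,\mathbb{Z})$ generated by the functions $1_A-1_{\varphi^vA}$ with $A\subseteq X$ clopen and $v\in\mathbb{Z}^d$; and $G(\varphi)_+=\{[f]: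 f\in C(X,\mathbb{Z}),\ f\ge 0\}$. Isomorphisms of ordered groups are group isomorphisms mapping positive cone onto positive cone. For a bounded orbit injection $\theta$ (in particular a bounded orbit equivalence) from one free minimal Cantor system $(X,\varphi,\mathbb{Z}^d)$ to another $(Y,\psi,\mathbb{Z}^d)$, $h_\theta:G(\varphi)\to G(\psi)$ denotes the (well-defined) ordered group isomorphism determined by $h_\theta[1_A]=[1_{\theta(A)}]$ for clopen $A\subseteq X$. *)

theory Defs
  imports "HOL-Analysis.Analysis" "HOL-Algebra.Generated_Groups"
begin

text \<open>
  The acting group $\mathbb{Z}^d$ is the type \<^typ>\<open>int ^ 'd\<close>, where \<open>d = CARD('d) \<ge> 1\<close>; it is
  always given the discrete topology. An action is a family of maps that matters only on
  \<open>topspace X\<close>.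
\<close>

definition dynamical_system :: "'a topology \<Rightarrow> (int ^ 'd \<Rightarrow> 'a \<Rightarrow> 'a) \<Rightarrow> bool" where
  "dynamical_system X \<phi> \<longleftrightarrow>
     compact_space X \<and>
     (\<forall>v. homeomorphic_map X X (\<phi> v)) \<and>
     (\<forall>x\<in>topspace X. \<phi> 0 x = x) \<and>
     (\<forall>v w. \<forall>x\<in>topspace X. \<phi> (v + w) x = \<phi> v (\<phi> w x))"

definition orbit :: "(int ^ 'd \<Rightarrow> 'a \<Rightarrow> 'a) \<Rightarrow> 'a \<Rightarrow> 'a set" where
  "orbit \<phi> x = range (\<lambda>v. \<phi> v x)"

definition free_action :: "'a topology \<Rightarrow> (int ^ 'd \<Rightarrow> 'a \<Rightarrow> 'a) \<Rightarrow> bool" where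
  "free_action X \<phi> \<longleftrightarrow> (\<forall>x\<in>topspace X. \<forall>v. \<phi> v x = x \<longrightarrow> v = 0)"

definition minimal_action :: "'a topology \<Rightarrow> (int ^ 'd \<Rightarrow> 'a \<Rightarrow> 'a) \<Rightarrow> bool" where
  "minimal_action X \<phi> \<longleftrightarrow> (\<forall>x\<in>topspace X. X closure_of (orbit \<phi> x) = topspace X)"

definition Cantor_set :: "'a topology \<Rightarrow> bool" where
  "Cantor_set X \<longleftrightarrow>
     X homeomorphic_space product_topology (\<lambda>_::nat. discrete_topology (UNIV :: bool set)) UNIV"

definition free_minimal_Cantor_system :: "'a topology \<Rightarrow> (int ^ 'd \<Rightarrow> 'a \<Rightarrow> 'a) \<Rightarrow> bool" where
  "free_minimal_Cantor_system X \<phi> \<longleftrightarrow>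
     dynamical_system X \<phi> \<and> Cantor_set X \<and> free_action X \<phi> \<and> minimal_action X \<phi>"

definition orbit_injection ::
    "'a topology \<Rightarrow> (int ^ 'd \<Rightarrow> 'a \<Rightarrow> 'a) \<Rightarrow> 'b topology \<Rightarrow> (int ^ 'd \<Rightarrow> 'b \<Rightarrow> 'b) \<Rightarrow> ('a \<Rightarrow> 'b) \<Rightarrow> bool"
  where
  "orbit_injection X \<phi> Y \<psi> \<theta> \<longleftrightarrow>
     continuous_map X Y \<theta> \<and> open_map X Y \<theta> \<and> inj_on \<theta> (topspace X) \<and>
     (\<forall>x\<in>topspace X. \<forall>y\<in>topspace X. (\<exists>w. \<phi> w x = y) \<longleftrightarrow> (\<exists>v. \<psi> v (\<theta> x) = \<theta> y))"

definition cocycle ::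
    "(int ^ 'd \<Rightarrow> 'a \<Rightarrow> 'a) \<Rightarrow> (int ^ 'd \<Rightarrow> 'b \<Rightarrow> 'b) \<Rightarrow> ('a \<Rightarrow> 'b) \<Rightarrow> 'a \<Rightarrow> int ^ 'd \<Rightarrow> int ^ 'd" where
  "cocycle \<phi> \<psi> \<theta> x w = (THE u. \<psi> u (\<theta> x) = \<theta> (\<phi> w x))"

definition continuous_cocycle ::
    "'a topology \<Rightarrow> (int ^ 'd \<Rightarrow> 'a \<Rightarrow> 'a) \<Rightarrow> (int ^ 'd \<Rightarrow> 'b \<Rightarrow> 'b) \<Rightarrow> ('a \<Rightarrow> 'b) \<Rightarrow> bool" where
  "continuous_cocycle X \<phi> \<psi> \<theta> \<longleftrightarrow>
     continuous_map (prod_topology X (discrete_topology UNIV)) (discrete_topology UNIV)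
       (\<lambda>(x, w). cocycle \<phi> \<psi> \<theta> x w)"

definition bounded_orbit_injection ::
    "'a topology \<Rightarrow> (int ^ 'd \<Rightarrow> 'a \<Rightarrow> 'a) \<Rightarrow> 'b topology \<Rightarrow> (int ^ 'd \<Rightarrow> 'b \<Rightarrow> 'b) \<Rightarrow> ('a \<Rightarrow> 'b) \<Rightarrow> bool"
  where
  "bounded_orbit_injection X \<phi> Y \<psi> \<theta> \<longleftrightarrow>
     orbit_injection X \<phi> Y \<psi> \<theta> \<and> continuous_cocycle X \<phi> \<psi> \<theta>"

definition bounded_orbit_equivalence ::
    "'a topology \<Rightarrow> (int ^ 'd \<Rightarrow> 'a \<Rightarrow> 'a) \<Rightarrow> 'b topology \<Rightarrow> (int ^ 'd \<Rightarrow> 'b \<Rightarrow> 'b) \<Rightarrow> ('a \<Rightarrow> 'b) \<Rightarrow> bool"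
  where
  "bounded_orbit_equivalence X \<phi> Y \<psi> \<theta> \<longleftrightarrow>
     homeomorphic_map X Y \<theta> \<and>
     (\<forall>x\<in>topspace X. \<theta> ` orbit \<phi> x = orbit \<psi> (\<theta> x)) \<and>
     continuous_cocycle X \<phi> \<psi> \<theta>"

text \<open>
  A function $X \to \mathbb{Z}$ is represented by its extension by zero to the whole type, so that
  the group operation is plain pointwise addition and $1_A$ is \<^const>\<open>indicator\<close>. The group is
  written multiplicatively, as a record of \<open>HOL-Algebra\<close>.
\<close>

definition int_functions :: "'a topology \<Rightarrow> ('a \<Rightarrow> int) monoid" where
  "int_functions X =
     \<lparr>carrier = {f. continuous_map X (discrete_topology UNIV) f \<and> (\<forall>x. x \<notin> topspace X \<longrightarrow> f x = 0)},
      mult = (\<lambda>f g x. f x + g x),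
      one = (\<lambda>_. 0)\<rparr>"

definition clopen_in :: "'a topology \<Rightarrow> 'a set \<Rightarrow> bool" where
  "clopen_in X A \<longleftrightarrow> openin X A \<and> closedin X A"

definition coboundaries :: "'a topology \<Rightarrow> (int ^ 'd \<Rightarrow> 'a \<Rightarrow> 'a) \<Rightarrow> ('a \<Rightarrow> int) set" where
  "coboundaries X \<phi> =
     generate (int_functions X)
       {(\<lambda>x. indicator A x - indicator (\<phi> v ` A) x) | A v. clopen_in X A}"

definition G_group :: "'a topology \<Rightarrow> (int ^ 'd \<Rightarrow> 'a \<Rightarrow> 'a) \<Rightarrow> ('a \<Rightarrow> int) set monoid" where
  "G_group X \<phi> = int_functions X Mod coboundaries X \<phi>"

definition G_class :: "'a topology \<Rightarrow> (int ^ 'd \<Rightarrow> 'a \<Rightarrow> 'a) \<Rightarrow> ('a \<Rightarrow> int) \<Rightarrow> ('a \<Rightarrow> int) set" where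
  "G_class X \<phi> f = coboundaries X \<phi> #>\<^bsub>int_functions X\<^esub> f"

definition G_pos :: "'a topology \<Rightarrow> (int ^ 'd \<Rightarrow> 'a \<Rightarrow> 'a) \<Rightarrow> ('a \<Rightarrow> int) set set" where
  "G_pos X \<phi> =
     {G_class X \<phi> f | f. f \<in> carrier (int_functions X) \<and> (\<forall>x\<in>topspace X. 0 \<le> f x)}"

definition ordered_group_iso ::
    "'a topology \<Rightarrow> (int ^ 'd \<Rightarrow> 'a \<Rightarrow> 'a) \<Rightarrow> 'b topology \<Rightarrow> (int ^ 'd \<Rightarrow> 'b \<Rightarrow> 'b) \<Rightarrow>
      (('a \<Rightarrow> int) set \<Rightarrow> ('b \<Rightarrow> int) set) \<Rightarrow> bool" where
  "ordered_group_iso X \<phi> Y \<psi> h \<longleftrightarrow>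
     h \<in> iso (G_group X \<phi>) (G_group Y \<psi>) \<and> h ` G_pos X \<phi> = G_pos Y \<psi>"

text \<open>
  The map $h_\theta$: the classes of the $1_A$ generate $G(\varphi)$, so the description is unique
  once the irrelevant values outside the carrier are fixed by \<^const>\<open>extensional\<close>.
\<close>

definition induced_map ::
    "'a topology \<Rightarrow> (int ^ 'd \<Rightarrow> 'a \<Rightarrow> 'a) \<Rightarrow> 'b topology \<Rightarrow> (int ^ 'd \<Rightarrow> 'b \<Rightarrow> 'b) \<Rightarrow>
      ('a \<Rightarrow> 'b) \<Rightarrow> ('a \<Rightarrow> int) set \<Rightarrow> ('b \<Rightarrow> int) set" where
  "induced_map X \<phi> Y \<psi> \<theta> =
     (THE h. h \<in> hom (G_group X \<phi>) (G_group Y \<psi>) \<and>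
             h \<in> extensional (carrier (G_group X \<phi>)) \<and>
             (\<forall>A. clopen_in X A \<longrightarrow>
                h (G_class X \<phi> (indicator A)) = G_class Y \<psi> (indicator (\<theta> ` A))))"

end

theory Submission
  imports Defs
begin

text \<open>
  Let \<open>A\<close> and \<open>B\<close> be the ranges of \<open>\<theta>\<^sub>1\<close> and \<open>\<theta>\<^sub>2\<close> in \<open>Z\<close>. The hypothesis says that \<open>1\<^sub>A - 1\<^sub>B\<close> is a finite sum
  of functions \<open>1\<^sub>C - 1\<^sub>D\<close> with \<open>D\<close> the translate of \<open>C\<close> by a vector \<open>v\<close>, that is, a flow of points carried
  along finitely many vectors turns \<open>A\<close> into \<open>B\<close>. Partition \<open>Z\<close> into the Voronoi tiles of a sparse clopen
  set. For a sparse enough set the flow across the boundary of a tile is smaller than the number of points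
  of \<open>A\<close>, and of \<open>B\<close>, in that tile. Each unit of flow between two tiles can therefore be realised by moving
  a point of \<open>A\<close> in the first tile to a point of \<open>B\<close> in the second, and the points left over in each tile are
  equinumerous. All choices depend on a bounded part of the orbit only, so this yields a homeomorphism from
  \<open>A\<close> to \<open>B\<close> with locally constant displacement. Conjugated by \<open>\<theta>\<^sub>1\<close> and \<open>\<theta>\<^sub>2\<close> it is the required \<open>\<theta>\<close>, and it
  does not change classes in \<open>G(\<alpha>)\<close> because a locally constant displacement changes an indicator function
  by a coboundary.
\<close>

section \<open>Locally constant functions and clopen sets\<close>

text \<open>Equal classes in \<open>G(\<alpha>)\<close> do not make \<open>A\<close> and
  \<open>B\<close> equinumerous in a tile: the two counts differ by the net flow across its
  boundary. Points of the sets must absorb this flow, and a boundary point can carry up to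
  \<open>k\<close> units of it, so the number of points of \<open>A\<close> in a tile has to be at
  least \<open>k\<close> times the number of its boundary points. Voronoi cells satisfy this
  whatever their shape, because they are convex up to ties: contracting towards the centre stays
  inside the cell, so one boundary yields as many layers of interior points as desired once the
  centres are far apart. Continuity of the result follows from one principle: a choice that depends
  only on a locally constant finite pattern is locally constant, even if it is made by Hilbert
  choice. The formula for \<open>h_\<theta>\<close> needs in addition that
  \<open>h_{\<theta>2}\<close> is injective. Here minimality is used again: every point of
  \<open>Z\<close> can be moved into the range of an orbit injection by one of finitely many
  vectors, which gives a way to carry functions on \<open>Z\<close> back to the smaller
  system.\<close>

definition loc_const :: "'a topology \<Rightarrow> ('a \<Rightarrow> 'k) \<Rightarrow> bool" where
  "loc_const X f \<longleftrightarrow> continuous_map X (discrete_topology UNIV) f"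

lemma loc_const_iff: "loc_const X f \<longleftrightarrow> (\<forall>k. openin X {x \<in> topspace X. f x = k})"
proof
  assume L: "loc_const X f"
  have "openin X {x \<in> topspace X. f x \<in> {k}}" for k
    by (rule openin_continuous_map_preimage[OF L[unfolded loc_const_def]]) auto
  then show "\<forall>k. openin X {x \<in> topspace X. f x = k}" by simp
next
  assume R: "\<forall>k. openin X {x \<in> topspace X. f x = k}"
  have "openin X {x \<in> topspace X. f x \<in> U}" for U
  proof -
    have "{x \<in> topspace X. f x \<in> U} = (\<Union>k\<in>U. {x \<in> topspace X. f x = k})" by auto
    then show ?thesis using R by auto
  qed
  then show "loc_const X f" by (simp add: loc_const_def continuous_map_def)
qed

lemma loc_const_openin: "loc_const X f \<Longrightarrow> openin X {x \<in> topspace X. P (f x)}"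
proof -
  assume L: "loc_const X f"
  have "openin X {x \<in> topspace X. f x \<in> Collect P}"
    by (rule openin_continuous_map_preimage[OF L[unfolded loc_const_def]]) auto
  then show ?thesis by simp
qed

lemma loc_const_const [simp]: "loc_const X (\<lambda>_. c)"
  by (simp add: loc_const_def)

text \<open>The codomain is discrete, so \<open>g\<close> may be any function at all. Later it
  contains \<open>SOME\<close> or \<open>arg_min_on\<close> applied to a finite set of
  vectors.\<close>

lemma loc_const_compose: "loc_const X f \<Longrightarrow> loc_const X (\<lambda>x. g (f x))"
  unfolding loc_const_iff[of X "\<lambda>x. g (f x)"] by (auto intro: loc_const_openin)

lemma loc_const_Pair:
  assumes "loc_const X f" "loc_const X g"
  shows "loc_const X (\<lambda>x. (f x, g x))"
  unfolding loc_const_iff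
proof
  fix k
  have "{x \<in> topspace X. (f x, g x) = k} =
      {x \<in> topspace X. f x = fst k} \<inter> {x \<in> topspace X. g x = snd k}" by auto
  then show "openin X {x \<in> topspace X. (f x, g x) = k}"
    using assms[unfolded loc_const_iff] by (simp add: openin_Int)
qed

lemma loc_const_combine:
  assumes "loc_const X f" "loc_const X g"
  shows "loc_const X (\<lambda>x. h (f x) (g x))"
  using loc_const_compose[OF loc_const_Pair[OF assms], of "\<lambda>p. h (fst p) (snd p)"] by simp

lemma loc_const_If:
  assumes "loc_const X P" "loc_const X f" "loc_const X g"
  shows "loc_const X (\<lambda>x. if P x then f x else g x)"
  using loc_const_combine[OF assms(1) loc_const_Pair[OF assms(2,3)],
      of "\<lambda>b p. if b then fst p else snd p"]
  unfolding fst_conv snd_conv .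

lemma loc_const_cong:
  assumes "\<And>x. x \<in> topspace X \<Longrightarrow> f x = g x"
  shows "loc_const X f \<longleftrightarrow> loc_const X g"
  proof -
  have "{x \<in> topspace X. f x = k} = {x \<in> topspace X. g x = k}" for k using assms by auto
  then show ?thesis by (simp add: loc_const_iff)
qed

text \<open>Packs what is visible through a finite window of an orbit into one set-valued function.
  Finiteness of \<open>I\<close> makes each of its level sets a finite intersection of open
  sets.\<close>

lemma loc_const_Collect:
  assumes "finite I" "\<And>i. i \<in> I \<Longrightarrow> loc_const X (P i)"
  shows "loc_const X (\<lambda>x. {i \<in> I. P i x})"
  using assms
proof (induction I rule: finite_induct)
  case empty
  then show ?case by simp
next
  case (insert j I)
  then have IH: "loc_const X (\<lambda>x. {i \<in> I. P i x})" and P: "loc_const X (P j)" by auto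
  have "loc_const X (\<lambda>x. (if P j x then {j} else {}) \<union> {i \<in> I. P i x})"
    using loc_const_combine[OF P IH, of "\<lambda>b S. (if b then {j} else {}) \<union> S"] .
  moreover have "(if P j x then {j} else {}) \<union> {i \<in> I. P i x} = {i \<in> insert j I. P i x}" for x
    by auto
  ultimately show ?case by simp
qed

lemma loc_const_finite_range:
  assumes "compact_space X" "loc_const X f"
  shows "finite (f ` topspace X)"
  using image_compactin[of X "topspace X" "discrete_topology UNIV" f] assms
  by (simp add: loc_const_def compact_space_def compactin_discrete_topology)

lemma clopen_in_subset: "clopen_in X A \<Longrightarrow> A \<subseteq> topspace X"
  by (simp add: clopen_in_def openin_subset)

lemma clopen_in_iff: "clopen_in X A \<longleftrightarrow> A \<subseteq> topspace X \<and> loc_const X (\<lambda>x. x \<in> A)"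
proof
  assume A: "clopen_in X A"
  then have sub: "A \<subseteq> topspace X" by (rule clopen_in_subset)
  have "openin X {x \<in> topspace X. (x \<in> A) = k}" for k
  proof -
    have "{x \<in> topspace X. (x \<in> A) = k} = (if k then A else topspace X - A)" using sub by auto
    then show ?thesis using A by (auto simp: clopen_in_def)
  qed
  then show "A \<subseteq> topspace X \<and> loc_const X (\<lambda>x. x \<in> A)" using sub by (simp add: loc_const_iff)
next
  assume A: "A \<subseteq> topspace X \<and> loc_const X (\<lambda>x. x \<in> A)"
  have "openin X {x \<in> topspace X. x \<in> A}" "openin X {x \<in> topspace X. x \<notin> A}"
    using A by (auto intro: loc_const_openin[of X "\<lambda>x. x \<in> A"])
  moreover have "{x \<in> topspace X. x \<in> A} = A" "{x \<in> topspace X. x \<notin> A} = topspace X - A"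
    using A by auto
  ultimately show "clopen_in X A" using A by (simp add: clopen_in_def closedin_def)
qed

lemma loc_const_mem: "clopen_in X A \<Longrightarrow> loc_const X (\<lambda>x. x \<in> A)"
  by (simp add: clopen_in_iff)

lemma loc_const_clopen: "loc_const X P \<Longrightarrow> clopen_in X {x \<in> topspace X. P x}"
  unfolding clopen_in_iff
  using loc_const_cong[of X "\<lambda>x. x \<in> {x \<in> topspace X. P x}" P] by auto

lemma clopen_in_Int: "clopen_in X A \<Longrightarrow> clopen_in X B \<Longrightarrow> clopen_in X (A \<inter> B)"
  by (auto simp: clopen_in_def)

lemma clopen_in_Diff: "clopen_in X A \<Longrightarrow> clopen_in X B \<Longrightarrow> clopen_in X (A - B)"
  by (auto simp: clopen_in_def)

lemma clopen_in_topspace: "clopen_in X (topspace X)"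
  by (simp add: clopen_in_def)

lemma clopen_in_restrict:
  assumes "clopen_in X C" "loc_const X P"
  shows "clopen_in X {x \<in> C. P x}"
proof -
  have "{x \<in> C. P x} = C \<inter> {x \<in> topspace X. P x}"
    using clopen_in_subset[OF assms(1)] by auto
  then show ?thesis by (simp add: assms clopen_in_Int loc_const_clopen)
qed

lemma loc_const_indicator: "clopen_in X A \<Longrightarrow> loc_const X (indicator A :: 'a \<Rightarrow> 'k::zero_neq_one)"
  unfolding indicator_def
  by (rule loc_const_compose[OF loc_const_mem, of X A of_bool])

text \<open>For functions defined through an inverse or a \<open>THE\<close>, whose level sets are
  accessible although no expression in locally constant functions is at hand.\<close>

lemma loc_const_on_clopen:
  assumes C: "clopen_in X C"
    and op: "\<And>k. openin X {x \<in> C. f x = k}"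
    and out: "\<And>x. x \<in> topspace X \<Longrightarrow> x \<notin> C \<Longrightarrow> f x = c"
  shows "loc_const X f"
  unfolding loc_const_iff
proof
  fix k
  have "{x \<in> topspace X. f x = k} = {x \<in> C. f x = k} \<union> (if c = k then topspace X - C else {})"
    using out clopen_in_subset[OF C] by auto
  moreover have "openin X (topspace X - C)" using C by (auto simp: clopen_in_def)
  ultimately show "openin X {x \<in> topspace X. f x = k}" using op[of k] by auto
qed

text \<open>Cylinders constrain finitely many coordinates of a product of two-point spaces, so they
  are clopen; the homeomorphism pulls them back.\<close>

lemma Cantor_set_clopen_base:
  assumes "Cantor_set X" "openin X S" "x \<in> S"
  shows "\<exists>C. clopen_in X C \<and> x \<in> C \<and> C \<subseteq> S"
proof -
  let ?K = "product_topology (\<lambda>_::nat. discrete_topology (UNIV :: bool set)) UNIV"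
  obtain f g where fg: "homeomorphic_maps X ?K f g"
    using assms(1) by (auto simp: Cantor_set_def homeomorphic_space_def)
  then have cf: "continuous_map X ?K f" and cg: "continuous_map ?K X g"
    and gf: "\<And>x. x \<in> topspace X \<Longrightarrow> g (f x) = x"
    by (auto simp: homeomorphic_maps_def)
  have xX: "x \<in> topspace X" using assms openin_subset by blast
  have "openin ?K {y \<in> topspace ?K. g y \<in> S}" (is "openin _ ?T")
    using cg assms(2) by (rule openin_continuous_map_preimage)
  moreover have "f x \<in> ?T" using xX cf gf assms(3) by (auto simp: continuous_map_def)
  ultimately obtain U where U: "f x \<in> Pi\<^sub>E UNIV U" "Pi\<^sub>E UNIV U \<subseteq> ?T"
      "finite {i. U i \<noteq> UNIV}"
    unfolding openin_product_topology_alt by force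
  have op: "openin ?K (Pi\<^sub>E UNIV U)"
    using U(3) by (subst openin_PiE_gen) auto
  have cl: "closedin ?K (Pi\<^sub>E UNIV U)"
    by (subst closedin_product_topology) auto
  have "openin X {y \<in> topspace X. f y \<in> Pi\<^sub>E UNIV U}"
      "closedin X {y \<in> topspace X. f y \<in> Pi\<^sub>E UNIV U}" (is "closedin X ?C")
    using openin_continuous_map_preimage[OF cf op] closedin_continuous_map_preimage[OF cf cl] .
  then have "clopen_in X ?C" by (simp add: clopen_in_def)
  moreover have "x \<in> ?C" using xX U by auto
  moreover have "?C \<subseteq> S"
  proof
    fix y assume y: "y \<in> ?C"
    then have "f y \<in> ?T" using U(2) by blast
    then show "y \<in> S" using gf[of y] y by simp
  qed
  ultimately show ?thesis by blast
qed

section \<open>Orbits, return vectors and sparse sets in a free minimal Cantor system\<close>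

locale Cantor_Zd_system =
  fixes X :: "'a topology" and \<phi> :: "int ^ 'd \<Rightarrow> 'a \<Rightarrow> 'a"
  assumes fmC: "free_minimal_Cantor_system X \<phi>"
begin

lemma compact: "compact_space X"
  using fmC by (simp add: free_minimal_Cantor_system_def dynamical_system_def)

lemma Cantor: "Cantor_set X"
  using fmC by (simp add: free_minimal_Cantor_system_def)

lemma Hausdorff: "Hausdorff_space X"
  using Cantor homeomorphic_Hausdorff_space
  unfolding Cantor_set_def
  by (metis Hausdorff_space_discrete_topology Hausdorff_space_product_topology)

lemma nonempty: "topspace X \<noteq> {}"
proof -
  let ?K = "product_topology (\<lambda>_::nat. discrete_topology (UNIV :: bool set)) UNIV"
  obtain f g where "homeomorphic_maps X ?K f g"
    using Cantor by (auto simp: Cantor_set_def homeomorphic_space_def)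
  then have "g \<in> topspace ?K \<rightarrow> topspace X"
    by (auto simp: homeomorphic_maps_def continuous_map_def)
  then have "g (\<lambda>_. True) \<in> topspace X" by auto
  then show ?thesis by auto
qed

lemma act_homeo: "homeomorphic_map X X (\<phi> v)"
  using fmC by (simp add: free_minimal_Cantor_system_def dynamical_system_def)

lemma act_continuous: "continuous_map X X (\<phi> v)"
  using act_homeo homeomorphic_imp_continuous_map by blast

lemma act_in [simp]: "x \<in> topspace X \<Longrightarrow> \<phi> v x \<in> topspace X"
  using act_continuous[of v] by (auto simp: continuous_map_def)

lemma act_0 [simp]: "x \<in> topspace X \<Longrightarrow> \<phi> 0 x = x"
  using fmC by (simp add: free_minimal_Cantor_system_def dynamical_system_def)

lemma act_act [simp]: "x \<in> topspace X \<Longrightarrow> \<phi> v (\<phi> w x) = \<phi> (v + w) x"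
  using fmC by (simp add: free_minimal_Cantor_system_def dynamical_system_def)

text \<open>Freeness enters here. It turns equations between points of an orbit into equations
  between vectors, so that tiles can be treated as sets of vectors.\<close>

lemma act_eq_iff [simp]:
  assumes "x \<in> topspace X"
  shows "\<phi> v x = \<phi> w x \<longleftrightarrow> v = w"
proof
  assume "\<phi> v x = \<phi> w x"
  then have "\<phi> (- w) (\<phi> v x) = \<phi> (- w) (\<phi> w x)" by simp
  then have "\<phi> (v - w) x = x" using assms by simp
  then show "v = w"
    using fmC assms unfolding free_minimal_Cantor_system_def free_action_def
    by (metis right_minus_eq)
qed simp

lemma act_inj:
  assumes "x \<in> topspace X" "y \<in> topspace X"
  shows "\<phi> v x = \<phi> v y \<longleftrightarrow> x = y"
proof
  assume "\<phi> v x = \<phi> v y"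
  then have "\<phi> (- v) (\<phi> v x) = \<phi> (- v) (\<phi> v y)" by simp
  then show "x = y" using assms by simp
qed simp

lemma act_image_iff:
  assumes "C \<subseteq> topspace X" "x \<in> topspace X"
  shows "x \<in> \<phi> v ` C \<longleftrightarrow> \<phi> (- v) x \<in> C"
proof
  assume "\<phi> (- v) x \<in> C"
  moreover have "\<phi> v (\<phi> (- v) x) = x" using assms by simp
  ultimately show "x \<in> \<phi> v ` C" by (metis image_eqI)
qed (use assms in auto)

lemma loc_const_act: "loc_const X f \<Longrightarrow> loc_const X (\<lambda>x. f (\<phi> v x))"
  using continuous_map_compose[OF act_continuous, of "discrete_topology UNIV" f v]
  by (simp add: loc_const_def o_def)

text \<open>The space is the union of the open sets on which the displacement is a fixed vector, and
  on each of them only a translate of \<open>f\<close> is seen.\<close>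

lemma loc_const_move:
  assumes "loc_const X n" "loc_const X f"
  shows "loc_const X (\<lambda>x. f (\<phi> (n x) x))"
  unfolding loc_const_iff
proof
  fix k
  have "{x \<in> topspace X. f (\<phi> (n x) x) = k} =
     (\<Union>v. {x \<in> topspace X. n x = v} \<inter> {x \<in> topspace X. f (\<phi> v x) = k})" by auto
  moreover have "openin X \<dots>"
    using assms(1)[unfolded loc_const_iff] loc_const_act[OF assms(2), unfolded loc_const_iff]
    by (intro openin_Union) (auto intro: openin_Int)
  ultimately show "openin X {x \<in> topspace X. f (\<phi> (n x) x) = k}" by simp
qed

lemma clopen_act_image:
  assumes "clopen_in X C"
  shows "clopen_in X (\<phi> v ` C)"
proof -
  have "\<phi> v ` C = {x \<in> topspace X. \<phi> (- v) x \<in> C}"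
    using act_image_iff[OF clopen_in_subset[OF assms]] clopen_in_subset[OF assms] by auto
  then show ?thesis
    using loc_const_clopen[OF loc_const_act[OF loc_const_mem[OF assms], of "- v"]] by simp
qed

text \<open>By minimality the translates of \<open>U\<close> cover the space, and compactness
  selects finitely many of them: every orbit meets \<open>U\<close> with bounded gaps.\<close>

lemma syndetic:
  assumes "openin X U" "U \<noteq> {}"
  shows "\<exists>F. finite F \<and> (\<forall>x\<in>topspace X. \<exists>v\<in>F. \<phi> v x \<in> U)"
proof -
  let ?V = "\<lambda>v. {x \<in> topspace X. \<phi> v x \<in> U}"
  have op: "openin X (?V v)" for v
    using act_continuous assms(1) by (rule openin_continuous_map_preimage)
  have "topspace X \<subseteq> (\<Union>v. ?V v)"
  proof
    fix x assume x: "x \<in> topspace X"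
    then have "X closure_of (orbit \<phi> x) = topspace X"
      using fmC by (simp add: free_minimal_Cantor_system_def minimal_action_def)
    moreover obtain y where "y \<in> U" using assms(2) by auto
    ultimately have "\<exists>z \<in> orbit \<phi> x. z \<in> U"
      using assms(1) openin_subset[OF assms(1)] in_closure_of[of y X "orbit \<phi> x"] by blast
    then show "x \<in> (\<Union>v. ?V v)" using x by (auto simp: orbit_def)
  qed
  moreover have "compactin X (topspace X)" using compact by (simp add: compact_space_def)
  ultimately obtain \<F> where F: "finite \<F>" "\<F> \<subseteq> range ?V" "topspace X \<subseteq> \<Union>\<F>"
    using op unfolding compactin_def by (metis (no_types, lifting) imageE)
  then obtain F where "finite F" "\<F> = ?V ` F"
    by (meson finite_subset_image)
  then show ?thesis using F(3) by (intro exI[of _ F]) blast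
qed

text \<open>By freeness each \<open>v\<close> in \<open>F\<close> moves a fixed point
  \<open>z\<close>, so \<open>z\<close> has a neighbourhood disjoint from its translate; finitely
  many of these are intersected and shrunk to a clopen set. With \<open>F\<close> a punctured ball
  this provides sparse centres.\<close>

lemma small_clopen:
  assumes "finite F" "0 \<notin> F"
  shows "\<exists>U. clopen_in X U \<and> U \<noteq> {} \<and> (\<forall>u\<in>U. \<forall>v\<in>F. \<phi> v u \<notin> U)"
proof -
  obtain z where z: "z \<in> topspace X" using nonempty by blast
  have "\<exists>N. openin X N \<and> z \<in> N \<and> (\<forall>x\<in>N. \<phi> v x \<notin> N)" if "v \<in> F" for v
  proof -
    have "\<phi> v z \<noteq> z" using act_eq_iff[OF z, of v 0] that assms z by auto
    then obtain S T where ST: "openin X S" "openin X T" "z \<in> S" "\<phi> v z \<in> T" "disjnt S T"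
      using Hausdorff z act_in[OF z] unfolding Hausdorff_space_def by metis
    let ?N = "S \<inter> {x \<in> topspace X. \<phi> v x \<in> T}"
    have "openin X ?N" using ST act_continuous openin_continuous_map_preimage by blast
    moreover have "z \<in> ?N" using ST z by auto
    moreover have "\<forall>x\<in>?N. \<phi> v x \<notin> ?N" using ST(5) by (auto simp: disjnt_def)
    ultimately show ?thesis by blast
  qed
  then obtain N where N: "\<And>v. v \<in> F \<Longrightarrow> openin X (N v) \<and> z \<in> N v \<and> (\<forall>x\<in>N v. \<phi> v x \<notin> N v)"
    by metis
  let ?S = "topspace X \<inter> \<Inter>(N ` F)"
  have "openin X ?S"
    using assms(1) N by (cases "F = {}") (auto intro!: openin_Int openin_Inter)
  moreover have "z \<in> ?S" using z N by auto
  ultimately have "\<exists>C. clopen_in X C \<and> z \<in> C \<and> C \<subseteq> ?S"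
    by (rule Cantor_set_clopen_base[OF Cantor])
  then obtain C where "clopen_in X C" "z \<in> C" "C \<subseteq> ?S"
    by (elim exE conjE)
  moreover have "\<phi> v u \<notin> C" if "u \<in> C" "v \<in> F" for u v
    using N[OF that(2)] that \<open>C \<subseteq> ?S\<close> by blast
  ultimately show ?thesis by blast
qed

end

section \<open>Boundaries of Voronoi cells\<close>

text \<open>The contraction argument uses the inner product and real multiples of lattice points, so
  distances are taken in Euclidean space.\<close>

definition real_vec :: "int ^ 'd \<Rightarrow> real ^ 'd" where
  "real_vec v = (\<chi> i. real_of_int (v $ i))"

lemma real_vec_add [simp]: "real_vec (v + w) = real_vec v + real_vec w"
  and real_vec_minus [simp]: "real_vec (- v) = - real_vec v"
  and real_vec_diff [simp]: "real_vec (v - w) = real_vec v - real_vec w"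
  and real_vec_0 [simp]: "real_vec 0 = 0"
  by (simp_all add: real_vec_def vec_eq_iff)

lemma finite_int_ball: "finite {v :: int ^ 'd. norm (real_vec v) \<le> r}"
proof -
  let ?S = "{- \<lceil>r\<rceil>..\<lceil>r\<rceil>}"
  have "{v :: int ^ 'd. norm (real_vec v) \<le> r} \<subseteq> vec_lambda ` (Pi\<^sub>E UNIV (\<lambda>_. ?S))"
  proof
    fix v :: "int ^ 'd" assume v: "v \<in> {v. norm (real_vec v) \<le> r}"
    have "v $ i \<in> ?S" for i
    proof -
      have "\<bar>real_vec v $ i\<bar> \<le> r" using v component_le_norm_cart[of "real_vec v" i] by simp
      then have "real_of_int \<bar>v $ i\<bar> \<le> r" by (simp add: real_vec_def)
      then have "\<bar>v $ i\<bar> \<le> \<lceil>r\<rceil>" by linarith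
      then show ?thesis by auto
    qed
    then have "vec_nth v \<in> Pi\<^sub>E UNIV (\<lambda>_. ?S)" by auto
    then show "v \<in> vec_lambda ` (Pi\<^sub>E UNIV (\<lambda>_. ?S))"
      using vec_nth_inverse[of v] by (metis image_eqI)
  qed
  then show ?thesis by (rule finite_subset) (auto intro!: finite_imageI finite_PiE)
qed

text \<open>Rounding down costs at most 1 in each coordinate, and the Euclidean norm is at most the
  sum of the absolute values of the coordinates.\<close>

lemma real_vec_near: "\<exists>q. norm (real_vec q - (x :: real ^ 'd)) \<le> CARD('d)"
proof -
  let ?q = "(\<chi> i. \<lfloor>x $ i\<rfloor>) :: int ^ 'd"
  have "norm (real_vec ?q - x) \<le> (\<Sum>i\<in>UNIV. \<bar>(real_vec ?q - x) $ i\<bar>)"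
    by (rule norm_le_l1_cart)
  also have "\<dots> \<le> (\<Sum>i\<in>(UNIV :: 'd set). 1)"
    by (rule sum_mono) (simp add: real_vec_def, linarith)
  finally show ?thesis by auto
qed

lemma card_le_fibres:
  assumes "finite S" "\<And>x. x \<in> S \<Longrightarrow> card {y \<in> S. f y = f x} \<le> m"
  shows "card S \<le> m * card (f ` S)"
proof -
  have "card S = (\<Sum>y\<in>f ` S. card {x \<in> S. f x = y})"
    using sum.image_gen[OF assms(1), of "\<lambda>_. 1 :: nat" f] by simp
  also have "\<dots> \<le> (\<Sum>y\<in>f ` S. m)"
    by (rule sum_mono) (use assms(2) in auto)
  finally show ?thesis by (simp add: mult.commute)
qed

text \<open>Expanding the square shows that the points nearer to 0 than to \<open>v\<close> form the
  open half-space bounded by the perpendicular bisector. The linear form behaves well under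
  contraction and small errors.\<close>

lemma norm_less_diff_iff:
  fixes a v :: "'v :: real_inner"
  shows "norm a < norm (a - v) \<longleftrightarrow> 2 * inner v a < norm v ^ 2"
proof -
  have "norm (a - v) ^ 2 = norm a ^ 2 - 2 * inner v a + norm v ^ 2"
    by (simp add: power2_norm_eq_inner inner_diff_left inner_diff_right inner_commute)
  moreover have "norm a < norm (a - v) \<longleftrightarrow> norm a ^ 2 < norm (a - v) ^ 2"
    by (meson norm_ge_zero power2_less_imp_less power_strict_mono zero_less_numeral)
  ultimately show ?thesis by linarith
qed

lemma inner_le_norm_mult:
  assumes "norm e \<le> c"
  shows "inner v e \<le> c * norm v"
proof -
  have "inner v e \<le> norm v * norm e" using norm_cauchy_schwarz by blast
  also have "\<dots> \<le> norm v * c" using assms by (simp add: mult_left_mono)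
  finally show ?thesis by (simp add: mult.commute)
qed

text \<open>\<open>T\<close> is the Voronoi cell of \<open>0\<close> with respect to the sparse set \<open>V\<close>. Contracting its boundary
  by the factors \<open>1 - j/(2J)\<close> for \<open>1 \<le> j \<le> J\<close> produces \<open>J\<close> layers of points of \<open>T\<close> that are disjoint
  even after each point has been moved to a nearby point of \<open>A\<close>.\<close>

lemma Voronoi_boundary_card:
  fixes T V A bd :: "(int ^ 'd) set" and J :: nat and R c L :: real
  assumes "finite T"
    and sep: "\<And>v. v \<in> V \<Longrightarrow> v \<noteq> 0 \<Longrightarrow> R < norm (real_vec v)"
    and near: "\<And>p v. p \<in> T \<Longrightarrow> v \<in> V \<Longrightarrow> norm (real_vec p) \<le> norm (real_vec p - real_vec v)"
    and inT: "\<And>p. (\<And>v. v \<in> V \<Longrightarrow> v \<noteq> 0 \<Longrightarrow> norm (real_vec p) < norm (real_vec p - real_vec v))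
                 \<Longrightarrow> p \<in> T"
    and dense: "\<And>x. \<exists>q\<in>A. norm (real_vec q - x) \<le> c"
    and bd: "bd \<subseteq> T" "\<And>p. p \<in> bd \<Longrightarrow> \<exists>w. norm (real_vec w) \<le> L \<and> p + w \<notin> T"
    and "0 < J" "0 \<le> c" "0 \<le> L" and R: "2 * J * (8 * c + 2 * L) \<le> R"
  shows "J * card bd \<le> card {w :: int ^ 'd. norm (real_vec w) \<le> 4 * c} * card (A \<inter> T)"
proof -
  \<comment> \<open>All factors lie between 1/2 and \<open>1 - 1 / (2 * J)\<close>: the upper bound
    leaves room for rounding inside the cell, the lower bound limits collisions within a
    layer.\<close>
  define lam where "lam j = 1 - real j / (2 * real J)" for j
  obtain f where f: "\<And>x. f x \<in> A" "\<And>x. norm (real_vec (f x) - x) \<le> c"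
    using dense by metis
  define g where "g = (\<lambda>(p, j). f (lam j *\<^sub>R real_vec p))"
  define S where "S = bd \<times> {1..J}"
  \<comment> \<open>The constant serves two estimates: \<open>gT\<close> consumes
    \<open>2 * c\<close> and \<open>layers\<close> consumes \<open>4 * c + 2 * L\<close>.\<close>
  have bigV: "8 * c + 2 * L < norm (real_vec v) / (2 * J)" if "v \<in> V" "v \<noteq> 0" for v
    using sep[OF that] R \<open>0 < J\<close> by (simp add: field_simps)
  \<comment> \<open>\<open>near\<close> places \<open>T\<close> inside the closed Voronoi cell and
    \<open>inT\<close> places the open cell inside \<open>T\<close>; ties may go either way. Hence
    the weak inequality here and the strict one in \<open>gT\<close>.\<close>
  have half: "2 * inner (real_vec v) (real_vec p) \<le> norm (real_vec v) ^ 2" if "p \<in> T" "v \<in> V" for p v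
  proof (cases "v = 0")
    case False
    have "norm (real_vec p - real_vec v) ^ 2
        = norm (real_vec p) ^ 2 - 2 * inner (real_vec v) (real_vec p) + norm (real_vec v) ^ 2"
      by (simp add: power2_norm_eq_inner inner_diff_left inner_diff_right inner_commute)
    moreover have "norm (real_vec p) ^ 2 \<le> norm (real_vec p - real_vec v) ^ 2"
      using near[OF that] by (simp add: power_mono)
    ultimately show ?thesis by linarith
  qed simp
  \<comment> \<open>Contraction gains \<open>?n ^ 2 / (2 * J)\<close> at the bisector of
    \<open>v\<close>, and rounding to a point of \<open>A\<close> loses at most
    \<open>2 * c * ?n\<close>.\<close>
  have gT: "g (p, j) \<in> T" if "p \<in> bd" "1 \<le> j" "j \<le> J" for p j
  proof (rule inT)
    fix v assume v: "v \<in> V" "v \<noteq> 0"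
    define e where "e = real_vec (g (p, j)) - lam j *\<^sub>R real_vec p"
    let ?n = "norm (real_vec v)"
    have e: "norm e \<le> c" using f(2) by (simp add: e_def g_def)
    have lam: "0 \<le> lam j" "lam j \<le> 1 - 1 / (2 * J)"
      using that \<open>0 < J\<close> by (simp_all add: lam_def field_simps)
    have "inner (real_vec v) (real_vec (g (p, j))) =
        lam j * inner (real_vec v) (real_vec p) + inner (real_vec v) e"
      by (simp add: e_def inner_diff_right)
    then have "2 * inner (real_vec v) (real_vec (g (p, j))) \<le>
        lam j * (2 * inner (real_vec v) (real_vec p)) + 2 * (c * ?n)"
      using inner_le_norm_mult[OF e, of "real_vec v"] by simp
    also have "\<dots> \<le> lam j * ?n ^ 2 + 2 * (c * ?n)"
      using half[OF _ v(1), of p] that bd(1) lam(1) by (auto intro: mult_left_mono)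
    also have "\<dots> \<le> (1 - 1 / (2 * J)) * ?n ^ 2 + 2 * (c * ?n)"
      using lam(2) by (simp add: mult_right_mono)
    also have "\<dots> = ?n ^ 2 - ?n * (?n / (2 * J) - 2 * c)"
      by (simp add: algebra_simps power2_eq_square)
    also have "\<dots> < ?n ^ 2"
    proof -
      have "0 < ?n / (2 * J) - 2 * c" using bigV[OF v] \<open>0 \<le> c\<close> \<open>0 \<le> L\<close> by linarith
      moreover have "0 < ?n"
        using bigV[OF v] \<open>0 \<le> c\<close> \<open>0 \<le> L\<close> by (cases "?n = 0") auto
      ultimately show ?thesis by simp
    qed
    finally show "norm (real_vec (g (p, j))) < norm (real_vec (g (p, j)) - real_vec v)"
      by (simp add: norm_less_diff_iff)
  qed
  \<comment> \<open>Since \<open>p + w\<close> is outside \<open>T\<close>, some \<open>v\<close>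
    satisfies \<open>?n ^ 2 - 2 * L * ?n \<le> 2 * inner v p\<close>, whereas
    \<open>2 * inner v p' \<le> ?n ^ 2\<close>. If the rounded points coincided, the gap between the
    two factors would be at most \<open>(4 * c + 2 * L) / ?n\<close>; but it is at least
    \<open>1 / (2 * J)\<close>.\<close>
  have layers: "\<not> j < j'"
    if p: "p \<in> bd" "p' \<in> bd" "1 \<le> j" "j' \<le> J" "g (p, j) = g (p', j')" for p p' j j'
  proof
    assume "j < j'"
    obtain w where w: "norm (real_vec w) \<le> L" "p + w \<notin> T" using bd(2)[OF p(1)] by auto
    then obtain v where v: "v \<in> V" "v \<noteq> 0"
      "\<not> norm (real_vec (p + w)) < norm (real_vec (p + w) - real_vec v)"
      using inT[of "p + w"] by auto
    let ?n = "norm (real_vec v)"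
    let ?i = "inner (real_vec v)"
    have pw: "?n ^ 2 \<le> 2 * ?i (real_vec p) + 2 * (L * ?n)"
      using v(3) inner_le_norm_mult[OF w(1), of "real_vec v"]
      by (simp add: norm_less_diff_iff inner_add_right)
    define e where "e = real_vec (g (p, j)) - lam j *\<^sub>R real_vec p"
    define e' where "e' = real_vec (g (p', j')) - lam j' *\<^sub>R real_vec p'"
    have "norm e \<le> c" "norm e' \<le> c" using f(2) by (simp_all add: e_def e'_def g_def)
    then have ee: "norm (e' - e) \<le> 2 * c" using norm_triangle_ineq4[of e' e] by linarith
    have lam: "0 \<le> lam j" "lam j \<le> 1" "0 \<le> lam j'"
      using p \<open>j < j'\<close> \<open>0 < J\<close> by (simp_all add: lam_def field_simps)
    have "lam j - lam j' = (real j' - real j) / (2 * J)"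
      by (simp add: lam_def diff_divide_distrib)
    moreover have "1 / (2 * real J) \<le> (real j' - real j) / (2 * real J)"
      using \<open>j < j'\<close> by (intro divide_right_mono) auto
    ultimately have gap: "1 / (2 * J) \<le> lam j - lam j'" by simp
    have "lam j *\<^sub>R real_vec p = lam j' *\<^sub>R real_vec p' + (e' - e)"
      using p(5) by (simp add: e_def e'_def)
    then have "lam j * ?i (real_vec p) = lam j' * ?i (real_vec p') + ?i (e' - e)"
      by (metis inner_add_right inner_scaleR_right)
    moreover have "?i (e' - e) \<le> 2 * c * ?n" by (rule inner_le_norm_mult[OF ee])
    moreover have "lam j' * (2 * ?i (real_vec p')) \<le> lam j' * ?n ^ 2"
      using half[OF _ v(1), of p'] p(2) bd(1) lam(3) by (auto intro: mult_left_mono)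
    moreover have "lam j * ?n ^ 2 \<le> lam j * (2 * ?i (real_vec p) + 2 * (L * ?n))"
      using pw lam(1) by (rule mult_left_mono)
    moreover have "lam j * (2 * (L * ?n)) \<le> 1 * (2 * (L * ?n))"
      using lam(2) \<open>0 \<le> L\<close> by (intro mult_right_mono) auto
    ultimately have "(lam j - lam j') * ?n ^ 2 \<le> (4 * c + 2 * L) * ?n"
      by (simp add: algebra_simps)
    moreover have "1 / (2 * J) * ?n ^ 2 \<le> (lam j - lam j') * ?n ^ 2"
      using gap by (rule mult_right_mono) auto
    ultimately have "(?n / (2 * J)) * ?n \<le> (4 * c + 2 * L) * ?n"
      by (simp add: power2_eq_square)
    moreover have "0 < ?n"
      using bigV[OF v(1,2)] \<open>0 \<le> c\<close> \<open>0 \<le> L\<close> by (cases "?n = 0") auto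
    ultimately have "?n / (2 * J) \<le> 4 * c + 2 * L" by (meson mult_le_cancel_right_pos)
    then show False using bigV[OF v(1,2)] \<open>0 \<le> c\<close> by linarith
  qed
  \<comment> \<open>Two rounding errors \<open>c\<close>, divided by a factor of at least 1/2, give
    the radius \<open>4 * c\<close>. By \<open>layers\<close> and \<open>close\<close> a fibre of
    \<open>g\<close> stays in one layer and in one ball of this radius.\<close>
  have close: "norm (real_vec (p' - p)) \<le> 4 * c"
    if p: "j \<le> J" "g (p, j) = g (p', j)" for p p' j
  proof -
    have lam: "1 / 2 \<le> lam j" using p \<open>0 < J\<close> by (simp add: lam_def field_simps)
    have "lam j * norm (real_vec (p' - p)) = norm (lam j *\<^sub>R real_vec p' - lam j *\<^sub>R real_vec p)"
      using lam by (simp add: scaleR_right_diff_distrib[symmetric])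
    also have "\<dots> = norm ((real_vec (g (p, j)) - lam j *\<^sub>R real_vec p) -
        (real_vec (g (p', j)) - lam j *\<^sub>R real_vec p'))"
      using p(2) by simp
    also have "\<dots> \<le> c + c"
      unfolding g_def prod.case
      by (rule order_trans[OF norm_triangle_ineq4 add_mono[OF f(2) f(2)]])
    finally have "lam j * norm (real_vec (p' - p)) \<le> 2 * c" by simp
    moreover have "1 / 2 * norm (real_vec (p' - p)) \<le> lam j * norm (real_vec (p' - p))"
      using lam by (rule mult_right_mono) auto
    ultimately show ?thesis by linarith
  qed
  have finS: "finite S" using \<open>finite T\<close> bd(1) finite_subset by (auto simp: S_def)
  let ?B = "{w :: int ^ 'd. norm (real_vec w) \<le> 4 * c}"
  have "card S \<le> card ?B * card (g ` S)"
  proof (rule card_le_fibres[OF finS])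
    fix x assume "x \<in> S"
    then obtain p j where x: "x = (p, j)" "p \<in> bd" "1 \<le> j" "j \<le> J" by (auto simp: S_def)
    have "{y \<in> S. g y = g x} \<subseteq> (\<lambda>w. (p + w, j)) ` ?B"
    proof
      fix y assume y: "y \<in> {y \<in> S. g y = g x}"
      then obtain p' j' where y': "y = (p', j')" "p' \<in> bd" "1 \<le> j'" "j' \<le> J"
        "g (p, j) = g (p', j')" by (auto simp: S_def x)
      have "j' = j" using layers[of p p' j j'] layers[of p' p j' j] x y' by force
      then have "p' - p \<in> ?B" using close[of j p p'] x y' by simp
      moreover have "y = (p + (p' - p), j)" using y' \<open>j' = j\<close> by simp
      ultimately show "y \<in> (\<lambda>w. (p + w, j)) ` ?B" by blast
    qed
    then have "card {y \<in> S. g y = g x} \<le> card ((\<lambda>w. (p + w, j)) ` ?B)"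
      by (rule card_mono[OF finite_imageI[OF finite_int_ball]])
    also have "\<dots> \<le> card ?B" by (rule card_image_le[OF finite_int_ball])
    finally show "card {y \<in> S. g y = g x} \<le> card ?B" .
  qed
  also have "card (g ` S) \<le> card (A \<inter> T)"
  proof (rule card_mono)
    show "finite (A \<inter> T)" using \<open>finite T\<close> by simp
    show "g ` S \<subseteq> A \<inter> T" using gT f(1) by (auto simp: S_def g_def)
  qed
  finally show ?thesis by (simp add: S_def card_cartesian_product mult.commute)
qed

section \<open>Tilings\<close>

lemma card_fibres_nat:
  fixes S :: "('b \<times> nat) set"
  assumes "finite S" "snd ` S \<subseteq> {..<k}"
  shows "card S = (\<Sum>i<k. card {p. (p, i) \<in> S})"
proof -
  have fin: "finite {p. (p, i) \<in> S}" for i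
    by (rule finite_subset[OF _ finite_imageI[OF assms(1), of fst]]) force
  have "S = (\<lambda>(i, p). (p, i)) ` (SIGMA i:{..<k}. {p. (p, i) \<in> S})"
    using assms(2) by force
  then have "card S = card ((\<lambda>(i, p). (p, i)) ` (SIGMA i:{..<k}. {p. (p, i) \<in> S}))"
    by (rule arg_cong)
  also have "\<dots> = card (SIGMA i:{..<k}. {p. (p, i) \<in> S})"
    by (rule card_image) (auto simp: inj_on_def)
  also have "\<dots> = (\<Sum>i<k. card {p. (p, i) \<in> S})"
    using card_SigmaI[of "{..<k}" "\<lambda>i. {p. (p, i) \<in> S}"] fin by blast
  finally show ?thesis .
qed

context Cantor_Zd_system
begin

text \<open>\<open>n z\<close> is the displacement from \<open>z\<close> to its centre, so the
  equation says that the centre of \<open>\<phi> v u\<close> is \<open>u\<close>. Recording offsets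
  instead of points makes the tile a finite pattern that can be locally constant in
  \<open>u\<close>.\<close>

definition tile :: "'a set \<Rightarrow> ('a \<Rightarrow> int ^ 'd) \<Rightarrow> 'a \<Rightarrow> (int ^ 'd) set" where
  "tile T n u = {v. \<phi> v u \<in> T \<and> n (\<phi> v u) = - v}"

text \<open>The index lets several units sit at one point. \<open>N\<close> assigns each unit to a
  centre; assigning the same units once to the centre of the source and once to that of the target
  yields the outgoing and the incoming units of a tile.\<close>

definition tile_src :: "('a \<times> nat) set \<Rightarrow> ('a \<times> nat \<Rightarrow> int ^ 'd) \<Rightarrow> 'a \<Rightarrow> ((int ^ 'd) \<times> nat) set" where
  "tile_src S N u = {(v, i). (\<phi> v u, i) \<in> S \<and> N (\<phi> v u, i) = - v}"

lemma finite_tile: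
  assumes "loc_const X n" "T \<subseteq> topspace X"
  shows "finite (tile T n u)"
proof (rule finite_subset)
  show "tile T n u \<subseteq> uminus ` n ` topspace X"
  proof
    fix v assume "v \<in> tile T n u"
    then have "\<phi> v u \<in> topspace X" "v = - n (\<phi> v u)" using assms(2) by (auto simp: tile_def)
    then show "v \<in> uminus ` n ` topspace X" by blast
  qed
  show "finite (uminus ` n ` topspace X)"
    using loc_const_finite_range[OF compact assms(1)] by simp
qed

text \<open>In every tile, the units attached to its centre are injected into the points of
  \<open>T\<close> in that tile. Different tiles are disjoint, so these injections fit together, and
  finite patterns at the centres determine both the displacement and the image.\<close>

lemma tile_matching:
  fixes S :: "('a \<times> nat) set" and N :: "'a \<times> nat \<Rightarrow> int ^ 'd"
  assumes S: "S \<subseteq> topspace X \<times> {..<k}" "\<And>i. loc_const X (\<lambda>z. (z, i) \<in> S)"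
    and N: "\<And>i. loc_const X (\<lambda>z. N (z, i))" "\<forall>p\<in>S. \<phi> (N p) (fst p) \<in> U"
    and T: "clopen_in X T" and n: "loc_const X n"
    and U: "U \<subseteq> topspace X"
    and le: "\<forall>u\<in>U. card (tile_src S N u) \<le> card (tile T n u)"
  obtains s where
    "\<And>i. loc_const X (\<lambda>z. s (z, i))"
    "inj_on (\<lambda>p. \<phi> (s p) (fst p)) S"
    "(\<lambda>p. \<phi> (s p) (fst p)) ` S \<subseteq> T"
    "clopen_in X ((\<lambda>p. \<phi> (s p) (fst p)) ` S)"
    "\<And>u. u \<in> U \<Longrightarrow>
       card (tile ((\<lambda>p. \<phi> (s p) (fst p)) ` S) n u) = card (tile_src S N u)"
proof -
  \<comment> \<open>The possible offsets of a unit from its centre. Compactness makes each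
    \<open>N (\<cdot>, i)\<close> finite-valued, so \<open>V\<close> is a finite window for
    \<open>loc_const_Collect\<close>.\<close>
  define V where "V = (\<Union>i<k. uminus ` (\<lambda>z. N (z, i)) ` topspace X)"
  have finV: "finite V"
    unfolding V_def
    using loc_const_finite_range[OF compact N(1)] by auto
  define V' where "V' = uminus ` n ` topspace X"
  have finV': "finite V'" unfolding V'_def using loc_const_finite_range[OF compact n] by auto
  have S_eq: "tile_src S N u =
      {q \<in> V \<times> {..<k}. (\<phi> (fst q) u, snd q) \<in> S \<and> N (\<phi> (fst q) u, snd q) = - fst q}" for u
  proof -
    have "v \<in> V \<and> i < k" if "(\<phi> v u, i) \<in> S" "N (\<phi> v u, i) = - v" for v i
    proof -
      have "\<phi> v u \<in> topspace X" "i < k" using that(1) S(1) by auto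
      moreover have "v = - N (\<phi> v u, i)" using that(2) by simp
      ultimately show ?thesis unfolding V_def by blast
    qed
    then show ?thesis by (auto simp: tile_src_def)
  qed
  have finS: "finite (tile_src S N u)" for u
    unfolding S_eq using finV by simp
  have T_eq: "tile T n u = {v \<in> V'. \<phi> v u \<in> T \<and> n (\<phi> v u) = - v}" for u
  proof -
    have "v \<in> V'" if "\<phi> v u \<in> T" "n (\<phi> v u) = - v" for v
    proof -
      have "\<phi> v u \<in> topspace X" using that(1) clopen_in_subset[OF T] by auto
      moreover have "v = - n (\<phi> v u)" using that(2) by simp
      ultimately show ?thesis unfolding V'_def by blast
    qed
    then show ?thesis by (auto simp: tile_def)
  qed
  have finT: "finite (tile T n u)" for u
    unfolding T_eq using finV' by simp
  have lS: "loc_const X (tile_src S N)"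
    unfolding S_eq[abs_def]
  proof (rule loc_const_Collect)
    fix q :: "(int ^ 'd) \<times> nat"
    show "loc_const X (\<lambda>u. (\<phi> (fst q) u, snd q) \<in> S \<and> N (\<phi> (fst q) u, snd q) = - fst q)"
      using loc_const_act[OF loc_const_combine[OF S(2)[of "snd q"] N(1)[of "snd q"],
            of "\<lambda>b w. b \<and> w = - fst q"], of "fst q"] .
  qed (use finV in simp)
  have lT: "loc_const X (tile T n)"
    unfolding T_eq[abs_def]
  proof (rule loc_const_Collect)
    fix v :: "int ^ 'd"
    show "loc_const X (\<lambda>u. \<phi> v u \<in> T \<and> n (\<phi> v u) = - v)"
      using loc_const_act[OF loc_const_combine[OF loc_const_mem[OF T] n,
            of "\<lambda>b w. b \<and> w = - v"], of v] .
  qed (use finV' in simp)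
  \<comment> \<open>The injection is chosen for a pair of patterns, not for a centre: centres with
    equal patterns receive the same injection, which is what makes \<open>lj\<close> true.\<close>
  define J :: "((int ^ 'd) \<times> nat) set \<Rightarrow> (int ^ 'd) set \<Rightarrow> (int ^ 'd) \<times> nat \<Rightarrow> int ^ 'd"
    where "J A B = (SOME f. inj_on f A \<and> f ` A \<subseteq> B)" for A B
  have J: "inj_on (J (tile_src S N u) (tile T n u)) (tile_src S N u)"
      "J (tile_src S N u) (tile T n u) ` tile_src S N u \<subseteq> tile T n u" if "u \<in> U" for u
  proof -
    have "\<exists>f. inj_on f (tile_src S N u) \<and> f ` tile_src S N u \<subseteq> tile T n u"
      using card_le_inj[OF finS finT bspec[OF le that]] by blast
    from someI_ex[OF this]
    show "inj_on (J (tile_src S N u) (tile T n u)) (tile_src S N u)"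
      "J (tile_src S N u) (tile T n u) ` tile_src S N u \<subseteq> tile T n u"
      unfolding J_def by blast+
  qed
  define j where "j u = J (tile_src S N u) (tile T n u)" for u
  \<comment> \<open>The displacement \<open>N p\<close> leads to the centre, and the offset chosen
    there leads on to the assigned point.\<close>
  define s where "s p = (let u = \<phi> (N p) (fst p) in j u (- N p, snd p) + N p)" for p
  have lj: "loc_const X (\<lambda>u. (tile_src S N u, j u))"
    unfolding j_def using loc_const_combine[OF lS lT, of "\<lambda>A B. (A, J A B)"] .
  have ls: "loc_const X (\<lambda>z. s (z, i))" for i
    using loc_const_combine[OF loc_const_move[OF N(1)[of i] lj] N(1)[of i],
        of "\<lambda>h w. snd h (- w, i) + w"]
    by (simp add: s_def Let_def)
  have main: "(- N (z, i), i) \<in> tile_src S N u" "j u (- N (z, i), i) \<in> tile T n u"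
      "\<phi> (s (z, i)) z = \<phi> (j u (- N (z, i), i)) u" "u \<in> U"
    if "(z, i) \<in> S" "u = \<phi> (N (z, i)) z" for z i u
  proof -
    have z: "z \<in> topspace X" using that(1) S(1) by auto
    show u: "u \<in> U" using bspec[OF N(2) that(1)] that(2) by simp
    show *: "(- N (z, i), i) \<in> tile_src S N u"
      using that z by (simp add: tile_src_def)
    show "j u (- N (z, i), i) \<in> tile T n u" using J(2)[OF u] * unfolding j_def by blast
    show "\<phi> (s (z, i)) z = \<phi> (j u (- N (z, i), i)) u"
      using z by (simp add: that(2) s_def Let_def)
  qed
  let ?f = "\<lambda>p. \<phi> (s p) (fst p)"
  have src: "\<exists>p\<in>S. ?f p = \<phi> (j u (v, i)) u"
    if "(v, i) \<in> tile_src S N u" "u \<in> topspace X" for u v i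
  proof -
    let ?p = "(\<phi> v u, i)"
    have p: "?p \<in> S" "N ?p = - v" using that by (auto simp: tile_src_def)
    then have "u = \<phi> (N ?p) (\<phi> v u)" using that by simp
    from main(3)[OF p(1) this] p show ?thesis by (intro bexI[of _ ?p]) auto
  qed
  \<comment> \<open>Whether \<open>y\<close> is hit can be read off at its own centre
    \<open>u\<close>, where the question concerns the offset \<open>- n y\<close> and a finite
    pattern. Clopenness of the image follows.\<close>
  have image_iff: "y \<in> ?f ` S \<longleftrightarrow> - n y \<in> j u ` tile_src S N u"
    if "y \<in> topspace X" "u = \<phi> (n y) y" for y u
  proof
    assume "y \<in> ?f ` S"
    then obtain z i where p: "(z, i) \<in> S" "y = \<phi> (s (z, i)) z" by auto
    define u' where "u' = \<phi> (N (z, i)) z"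
    note m = main[OF p(1) u'_def]
    have u': "u' \<in> topspace X" using m(4) U by auto
    have y: "y = \<phi> (j u' (- N (z, i), i)) u'" using p(2) m(3) by simp
    then have ny: "n y = - j u' (- N (z, i), i)" using m(2) by (simp add: tile_def)
    then have "u = u'" unfolding that(2) by (subst y) (use u' ny y in simp)
    then show "- n y \<in> j u ` tile_src S N u" using ny m(1) by auto
  next
    assume "- n y \<in> j u ` tile_src S N u"
    then obtain v i where vi: "(v, i) \<in> tile_src S N u" "- n y = j u (v, i)" by auto
    have "u \<in> topspace X" using that by simp
    from src[OF vi(1) this] obtain p where "p \<in> S" "?f p = \<phi> (- n y) u" using vi(2) by auto
    then show "y \<in> ?f ` S" using that by force
  qed
  have clop: "clopen_in X (?f ` S)"
  proof -
    have sub: "?f ` S \<subseteq> topspace X" using S(1) by auto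
    have "loc_const X (\<lambda>y. - n y \<in> j (\<phi> (n y) y) ` tile_src S N (\<phi> (n y) y))"
      using loc_const_combine[OF loc_const_move[OF n lj] n, of "\<lambda>h w. - w \<in> snd h ` fst h"] by simp
    then have "loc_const X (\<lambda>y. y \<in> ?f ` S)"
      using loc_const_cong[of X "\<lambda>y. y \<in> ?f ` S"] image_iff by simp
    then show ?thesis using sub by (simp add: clopen_in_iff)
  qed
  have tile_image: "tile (?f ` S) n u = j u ` tile_src S N u" if "u \<in> U" for u
  proof -
    have u: "u \<in> topspace X" using that U by auto
    show ?thesis
    proof (intro equalityI subsetI)
      fix v assume "v \<in> tile (?f ` S) n u"
      then have v: "\<phi> v u \<in> ?f ` S" "n (\<phi> v u) = - v" by (auto simp: tile_def)
      have "u = \<phi> (n (\<phi> v u)) (\<phi> v u)" using v(2) u by simp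
      then show "v \<in> j u ` tile_src S N u" using image_iff[of "\<phi> v u" u] v u by simp
    next
      fix v assume v: "v \<in> j u ` tile_src S N u"
      then have "v \<in> tile T n u" using J(2)[OF that] by (auto simp: j_def)
      then have nv: "n (\<phi> v u) = - v" by (simp add: tile_def)
      have "u = \<phi> (n (\<phi> v u)) (\<phi> v u)" using nv u by simp
      then have "\<phi> v u \<in> ?f ` S" using image_iff[of "\<phi> v u" u] nv v u by simp
      then show "v \<in> tile (?f ` S) n u" using nv by (simp add: tile_def)
    qed
  qed
  have cards: "card (tile (?f ` S) n u) = card (tile_src S N u)" if "u \<in> U" for u
    unfolding tile_image[OF that] using J(1)[OF that] by (simp add: j_def card_image)
  have inj: "inj_on ?f S"
  proof (rule inj_onI)
    fix p p' assume p: "p \<in> S" "p' \<in> S" and eq: "?f p = ?f p'"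
    obtain z i z' i' where pp: "p = (z, i)" "p' = (z', i')" by (cases p; cases p')
    define u where "u = \<phi> (N (z, i)) z"
    define u' where "u' = \<phi> (N (z', i')) z'"
    define w where "w = j u (- N (z, i), i)"
    define w' where "w' = j u' (- N (z', i'), i')"
    note m = main[OF p(1)[unfolded pp] u_def, folded w_def]
    note m' = main[OF p(2)[unfolded pp] u'_def, folded w'_def]
    have U: "u \<in> topspace X" "u' \<in> topspace X" using m(4) m'(4) U by auto
    have "\<phi> w u = \<phi> w' u'" using eq m(3) m'(3) pp by simp
    moreover have "n (\<phi> w u) = - w" "n (\<phi> w' u') = - w'" using m(2) m'(2) by (auto simp: tile_def)
    ultimately have w: "w = w'" by simp
    then have "u = u'" using \<open>\<phi> w u = \<phi> w' u'\<close> act_inj U by metis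
    then have "(- N (z, i), i) = (- N (z', i'), i')"
      using w m(1) m'(1) J(1)[OF m(4)] unfolding w_def w'_def j_def inj_on_def by metis
    then have "N (z, i) = N (z', i')" "i = i'" by auto
    moreover have "z \<in> topspace X" "z' \<in> topspace X" using p pp S(1) by auto
    ultimately show "p = p'" using \<open>u = u'\<close> act_inj unfolding u_def u'_def pp by simp
  qed
  have subT: "?f ` S \<subseteq> T"
  proof
    fix y assume "y \<in> ?f ` S"
    then obtain z i where p: "(z, i) \<in> S" "y = \<phi> (s (z, i)) z" by auto
    then show "y \<in> T" using main(2,3)[OF p(1) refl] by (simp add: tile_def)
  qed
  show ?thesis using that[OF ls inj subT clop cards] .
qed

text \<open>The centres are a clopen set without short return vectors, and each point is sent to a
  nearest centre on its orbit.\<close>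

lemma Voronoi_tiling:
  obtains U n where "clopen_in X U" "U \<noteq> {}" "loc_const X n"
    "\<And>z. z \<in> topspace X \<Longrightarrow> \<phi> (n z) z \<in> U"
    "\<And>z v. z \<in> topspace X \<Longrightarrow> \<phi> v z \<in> U \<Longrightarrow> norm (real_vec (n z)) \<le> norm (real_vec v)"
    "\<And>u v. u \<in> U \<Longrightarrow> \<phi> v u \<in> U \<Longrightarrow> v \<noteq> 0 \<Longrightarrow> R < norm (real_vec v)"
proof -
  let ?B = "\<lambda>r. {v :: int ^ 'd. norm (real_vec v) \<le> r}"
  obtain U where U: "clopen_in X U" "U \<noteq> {}" "\<And>u v. u \<in> U \<Longrightarrow> v \<in> ?B R - {0} \<Longrightarrow> \<phi> v u \<notin> U"
    using small_clopen[of "?B R - {0}"] finite_Diff[OF finite_int_ball[of R]] by blast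
  obtain F where F: "finite F" "\<And>x. x \<in> topspace X \<Longrightarrow> \<exists>v\<in>F. \<phi> v x \<in> U"
    using syndetic[of U] U(1,2) unfolding clopen_in_def by blast
  \<comment> \<open>The sum bounds every norm in \<open>F\<close>, so each point has a centre within
    \<open>M\<close> and the search for a nearest one is finite.\<close>
  define M where "M = (\<Sum>v\<in>F. norm (real_vec v))"
  have M: "norm (real_vec v) \<le> M" if "v \<in> F" for v
    unfolding M_def using F(1) that by (intro member_le_sum) auto
  define S where "S z = {v \<in> ?B M. \<phi> v z \<in> U}" for z
  \<comment> \<open>Ties are broken by a choice that depends on the finite set \<open>S z\<close>
    only, so \<open>n\<close> inherits local constancy from \<open>S\<close>.\<close>
  define n where "n z = arg_min_on (\<lambda>v. norm (real_vec v)) (S z)" for z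
  have finS: "finite (S z)" for z unfolding S_def
    by (rule finite_subset[OF _ finite_int_ball[of M]]) auto
  have neS: "S z \<noteq> {}" if "z \<in> topspace X" for z
    using F(2)[OF that] M by (auto simp: S_def)
  have nS: "n z \<in> S z" if "z \<in> topspace X" for z
    unfolding n_def by (rule arg_min_if_finite(1)[OF finS neS[OF that]])
  have nmin: "norm (real_vec (n z)) \<le> norm (real_vec v)" if "z \<in> topspace X" "\<phi> v z \<in> U" for z v
  proof (cases "v \<in> ?B M")
    case True
    then have "v \<in> S z" using that by (simp add: S_def)
    then show ?thesis unfolding n_def by (rule arg_min_least[OF finS neS[OF that(1)]])
  next
    case False
    then show ?thesis using nS[OF that(1)] by (simp add: S_def)
  qed
  have "loc_const X S"
    unfolding S_def[abs_def]
    by (rule loc_const_Collect[OF finite_int_ball]) (rule loc_const_act[OF loc_const_mem[OF U(1)]])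
  then have "loc_const X n"
    unfolding n_def[abs_def] by (rule loc_const_compose)
  moreover have "\<phi> (n z) z \<in> U" if "z \<in> topspace X" for z
    using nS[OF that] by (simp add: S_def)
  moreover have "R < norm (real_vec v)" if "u \<in> U" "\<phi> v u \<in> U" "v \<noteq> 0" for u v
    using U(3)[OF that(1), of v] that(2,3) by (metis Diff_iff mem_Collect_eq not_le singletonD)
  ultimately show ?thesis using that[of U n] U nmin by blast
qed

text \<open>Round \<open>x\<close> to a lattice point, then apply a return vector to
  \<open>A\<close> of bounded length. Real \<open>x\<close> are allowed because contracted lattice
  points need not be lattice points.\<close>

lemma relatively_dense:
  assumes "openin X A" "A \<noteq> {}"
  obtains c where "0 \<le> c" "\<And>z x. z \<in> topspace X \<Longrightarrow> \<exists>q. \<phi> q z \<in> A \<and> norm (real_vec q - x) \<le> c"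
proof -
  obtain F where F: "finite F" "\<And>x. x \<in> topspace X \<Longrightarrow> \<exists>v\<in>F. \<phi> v x \<in> A"
    using syndetic[OF assms] by blast
  define M where "M = (\<Sum>v\<in>F. norm (real_vec v))"
  have M: "norm (real_vec v) \<le> M" if "v \<in> F" for v
    unfolding M_def using F(1) that by (intro member_le_sum) auto
  have "\<exists>q. \<phi> q z \<in> A \<and> norm (real_vec q - x) \<le> M + CARD('d)" if z: "z \<in> topspace X" for z x
  proof -
    obtain q where q: "norm (real_vec q - x) \<le> real CARD('d)" using real_vec_near by blast
    obtain v where v: "v \<in> F" "\<phi> v (\<phi> q z) \<in> A" using F(2)[OF act_in[OF z]] by blast
    have "real_vec (v + q) - x = real_vec v + (real_vec q - x)" by simp
    have "norm (real_vec (v + q) - x) \<le> norm (real_vec v) + norm (real_vec q - x)"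
      unfolding \<open>real_vec (v + q) - x = _\<close> by (rule norm_triangle_ineq)
    then have "norm (real_vec (v + q) - x) \<le> M + CARD('d)"
      using M[OF v(1)] q by linarith
    then show ?thesis using v(2) z by (intro exI[of _ "v + q"]) simp
  qed
  moreover have "0 \<le> M + CARD('d)" unfolding M_def by (simp add: sum_nonneg)
  ultimately show ?thesis using that by blast
qed

text \<open>\<open>R\<close> is fixed before the tiling, so that one tiling that is sparse enough
  can serve two sets at once.\<close>

lemma boundary_card:
  assumes A: "clopen_in X A" "A \<noteq> {}" and L: "0 \<le> L"
  obtains R where
    "\<And>U n u bd. clopen_in X U \<Longrightarrow> loc_const X n \<Longrightarrow>
      (\<And>z. z \<in> topspace X \<Longrightarrow> \<phi> (n z) z \<in> U) \<Longrightarrow>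
      (\<And>z v. z \<in> topspace X \<Longrightarrow> \<phi> v z \<in> U \<Longrightarrow> norm (real_vec (n z)) \<le> norm (real_vec v)) \<Longrightarrow>
      (\<And>u v. u \<in> U \<Longrightarrow> \<phi> v u \<in> U \<Longrightarrow> v \<noteq> 0 \<Longrightarrow> R < norm (real_vec v)) \<Longrightarrow>
      u \<in> U \<Longrightarrow> bd \<subseteq> tile (topspace X) n u \<Longrightarrow>
      (\<And>p. p \<in> bd \<Longrightarrow> \<exists>w. norm (real_vec w) \<le> L \<and> p + w \<notin> tile (topspace X) n u) \<Longrightarrow>
      k * card bd \<le> card (tile A n u)"
proof -
  obtain c where c: "0 \<le> c"
    "\<And>z x. z \<in> topspace X \<Longrightarrow> \<exists>q. \<phi> q z \<in> A \<and> norm (real_vec q - x) \<le> c"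
    using relatively_dense[of A] A by (auto simp: clopen_in_def)
  define m where "m = card {w :: int ^ 'd. norm (real_vec w) \<le> 4 * c}"
  \<comment> \<open>More than \<open>k * m\<close> layers allow \<open>m\<close>, the bound on the
    fibres, to be cancelled at the end; \<open>Suc\<close> keeps \<open>J\<close> positive when
    \<open>k = 0\<close>.\<close>
  define J where "J = Suc (k * m)"
  have "(0 :: int ^ 'd) \<in> {w. norm (real_vec w) \<le> 4 * c}" using c(1) by simp
  then have m: "0 < m" unfolding m_def using finite_int_ball[of "4 * c"] card_gt_0_iff by blast
  show ?thesis
  proof (rule that[of "2 * J * (8 * c + 2 * L)"])
    fix U n u bd
    assume U: "clopen_in X U" and n: "loc_const X n"
      and cen: "\<And>z. z \<in> topspace X \<Longrightarrow> \<phi> (n z) z \<in> U"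
      and nmin: "\<And>z v. z \<in> topspace X \<Longrightarrow> \<phi> v z \<in> U \<Longrightarrow> norm (real_vec (n z)) \<le> norm (real_vec v)"
      and sep: "\<And>u v. u \<in> U \<Longrightarrow> \<phi> v u \<in> U \<Longrightarrow> v \<noteq> 0 \<Longrightarrow>
        real (2 * J) * (8 * c + 2 * L) < norm (real_vec v)"
      and u: "u \<in> U" and bd: "bd \<subseteq> tile (topspace X) n u"
        "\<And>p. p \<in> bd \<Longrightarrow> \<exists>w. norm (real_vec w) \<le> L \<and> p + w \<notin> tile (topspace X) n u"
    have uX: "u \<in> topspace X" using u clopen_in_subset[OF U] by auto
    have "J * card bd \<le> m * card ({q. \<phi> q u \<in> A} \<inter> tile (topspace X) n u)"
      unfolding m_def
    proof (rule Voronoi_boundary_card[where V = "{v. \<phi> v u \<in> U}" and L = L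
            and R = "real (2 * J) * (8 * c + 2 * L)"])
      show "finite (tile (topspace X) n u)" by (rule finite_tile[OF n order_refl])
      show "real (2 * J) * (8 * c + 2 * L) < norm (real_vec v)" if "v \<in> {v. \<phi> v u \<in> U}" "v \<noteq> 0" for v
        using sep[OF u] that by simp
      show "norm (real_vec p) \<le> norm (real_vec p - real_vec v)"
        if "p \<in> tile (topspace X) n u" "v \<in> {v. \<phi> v u \<in> U}" for p v
      proof -
        have "\<phi> (v - p) (\<phi> p u) \<in> U" using that uX by simp
        from nmin[OF act_in[OF uX] this]
        have "norm (real_vec (n (\<phi> p u))) \<le> norm (real_vec v - real_vec p)" by simp
        then show ?thesis using that(1) by (simp add: tile_def norm_minus_commute)
      qed
      show "p \<in> tile (topspace X) n u"
        if near: "\<And>v. v \<in> {v. \<phi> v u \<in> U} \<Longrightarrow> v \<noteq> 0 \<Longrightarrow>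
          norm (real_vec p) < norm (real_vec p - real_vec v)" for p
      proof -
        \<comment> \<open>The offset from \<open>u\<close> of the centre assigned to the point at
          \<open>p\<close>. If it were nonzero, \<open>p\<close> would be strictly closer to
          \<open>u\<close> than to this centre, against minimality of \<open>n\<close>.\<close>
        let ?v = "n (\<phi> p u) + p"
        have v: "\<phi> ?v u \<in> U" using cen[OF act_in[OF uX, of p]] uX by simp
        have "\<phi> (- p) (\<phi> p u) \<in> U" using u uX by simp
        from nmin[OF act_in[OF uX] this]
        have "norm (real_vec (n (\<phi> p u))) \<le> norm (real_vec p)" by simp
        moreover have "real_vec (n (\<phi> p u)) = - (real_vec p - real_vec ?v)" by simp
        ultimately have "norm (real_vec p - real_vec ?v) \<le> norm (real_vec p)"
          by (metis norm_minus_cancel)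
        then have "?v = 0" using near[of ?v] v by force
        then show ?thesis using uX by (simp add: tile_def eq_neg_iff_add_eq_0)
      qed
      show "\<exists>q\<in>{q. \<phi> q u \<in> A}. norm (real_vec q - x) \<le> c" for x
        using c(2)[OF uX] by auto
    qed (use bd c L in \<open>auto simp: J_def\<close>)
    also have "{q. \<phi> q u \<in> A} \<inter> tile (topspace X) n u = tile A n u"
      using clopen_in_subset[OF A(1)] by (auto simp: tile_def)
    finally have "m * (k * card bd) \<le> m * card (tile A n u)"
      by (simp add: J_def algebra_simps add_leD2)
    then show "k * card bd \<le> card (tile A n u)" using m mult_le_cancel1 by blast
  qed
qed

text \<open>The unit \<open>(z, i)\<close> of the set \<open>W\<close> below carries \<open>z \<in> C\<^sub>i\<close> to \<open>\<phi>\<^bsup>v\<^sub>i\<^esup> z\<close> in another tile; \<open>\<sigma>\<close> represents it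
  by a point of \<open>A\<close> in the tile of its source, and \<open>\<tau>\<close> by a point of \<open>B\<close> in the tile of its target.\<close>

lemma equidecomposable:
  fixes C :: "nat \<Rightarrow> 'a set" and v :: "nat \<Rightarrow> int ^ 'd"
  assumes A: "clopen_in X A" "A \<noteq> {}" and B: "clopen_in X B" "B \<noteq> {}"
    and C: "\<And>i. i < k \<Longrightarrow> clopen_in X (C i)"
    and AB: "\<And>z. z \<in> topspace X \<Longrightarrow> indicator A z - indicator B z =
      (\<Sum>i<k. indicator (C i) z - indicator (\<phi> (v i) ` C i) z :: int)"
  obtains D where "loc_const X D" "bij_betw (\<lambda>z. \<phi> (D z) z) A B"
proof -
  \<comment> \<open>A bound for all the vectors of the flow: a unit that crosses a tile boundary has
    both ends within \<open>L\<close> of it.\<close>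
  define L where "L = (\<Sum>i<k. norm (real_vec (v i)))"
  have L: "norm (real_vec (v i)) \<le> L" if "i < k" for i
    unfolding L_def using that by (intro member_le_sum) auto
  have L0: "0 \<le> L" unfolding L_def by (simp add: sum_nonneg)
  obtain RA where RA: "\<And>U n u bd. clopen_in X U \<Longrightarrow> loc_const X n \<Longrightarrow>
      (\<And>z. z \<in> topspace X \<Longrightarrow> \<phi> (n z) z \<in> U) \<Longrightarrow>
      (\<And>z v. z \<in> topspace X \<Longrightarrow> \<phi> v z \<in> U \<Longrightarrow> norm (real_vec (n z)) \<le> norm (real_vec v)) \<Longrightarrow>
      (\<And>u v. u \<in> U \<Longrightarrow> \<phi> v u \<in> U \<Longrightarrow> v \<noteq> 0 \<Longrightarrow> RA < norm (real_vec v)) \<Longrightarrow>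
      u \<in> U \<Longrightarrow> bd \<subseteq> tile (topspace X) n u \<Longrightarrow>
      (\<And>p. p \<in> bd \<Longrightarrow> \<exists>w. norm (real_vec w) \<le> L \<and> p + w \<notin> tile (topspace X) n u) \<Longrightarrow>
      k * card bd \<le> card (tile A n u)"
    using boundary_card[OF A L0] by metis
  obtain RB where RB: "\<And>U n u bd. clopen_in X U \<Longrightarrow> loc_const X n \<Longrightarrow>
      (\<And>z. z \<in> topspace X \<Longrightarrow> \<phi> (n z) z \<in> U) \<Longrightarrow>
      (\<And>z v. z \<in> topspace X \<Longrightarrow> \<phi> v z \<in> U \<Longrightarrow> norm (real_vec (n z)) \<le> norm (real_vec v)) \<Longrightarrow>
      (\<And>u v. u \<in> U \<Longrightarrow> \<phi> v u \<in> U \<Longrightarrow> v \<noteq> 0 \<Longrightarrow> RB < norm (real_vec v)) \<Longrightarrow>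
      u \<in> U \<Longrightarrow> bd \<subseteq> tile (topspace X) n u \<Longrightarrow>
      (\<And>p. p \<in> bd \<Longrightarrow> \<exists>w. norm (real_vec w) \<le> L \<and> p + w \<notin> tile (topspace X) n u) \<Longrightarrow>
      k * card bd \<le> card (tile B n u)"
    using boundary_card[OF B L0] by metis
  obtain U n where U: "clopen_in X U" "U \<noteq> {}" and n: "loc_const X n"
    and cen: "\<And>z. z \<in> topspace X \<Longrightarrow> \<phi> (n z) z \<in> U"
    and nmin: "\<And>z v. z \<in> topspace X \<Longrightarrow> \<phi> v z \<in> U \<Longrightarrow> norm (real_vec (n z)) \<le> norm (real_vec v)"
    and sep: "\<And>u v. u \<in> U \<Longrightarrow> \<phi> v u \<in> U \<Longrightarrow> v \<noteq> 0 \<Longrightarrow> max RA RB < norm (real_vec v)"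
    using Voronoi_tiling[of "max RA RB"] by metis
  have UX: "U \<subseteq> topspace X" using clopen_in_subset[OF U(1)] .
  have CX: "C i \<subseteq> topspace X" if "i < k" for i using clopen_in_subset[OF C[OF that]] .
  define T where "T = tile (topspace X) n"
  have finT: "finite (T u)" for u unfolding T_def by (rule finite_tile[OF n order_refl])
  have T_iff: "p \<in> T u \<longleftrightarrow> n (\<phi> p u) = - p" if "u \<in> U" for p u
    using that UX by (auto simp: T_def tile_def)
  have bdA: "k * card bd \<le> card (tile A n u)"
    if "u \<in> U" "bd \<subseteq> T u" "\<And>p. p \<in> bd \<Longrightarrow> \<exists>w. norm (real_vec w) \<le> L \<and> p + w \<notin> T u" for u bd
    by (rule RA[OF U(1) n cen nmin _ that(1)]) (use sep that in \<open>auto simp: T_def\<close>)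
  have bdB: "k * card bd \<le> card (tile B n u)"
    if "u \<in> U" "bd \<subseteq> T u" "\<And>p. p \<in> bd \<Longrightarrow> \<exists>w. norm (real_vec w) \<le> L \<and> p + w \<notin> T u" for u bd
    by (rule RB[OF U(1) n cen nmin _ that(1)]) (use sep that in \<open>auto simp: T_def\<close>)
  \<comment> \<open>Both sides of the inequality are displacements from \<open>z\<close>, one to its
    own centre and one to the centre of \<open>\<phi> (v i) z\<close>. By freeness they differ
    exactly when the centres differ, so these are the units that change tile.\<close>
  define W where "W = {(z, i). i < k \<and> z \<in> C i \<and> n z \<noteq> n (\<phi> (v i) z) + v i}"
  have W: "W \<subseteq> topspace X \<times> {..<k}" using CX by (auto simp: W_def)
  have lW: "loc_const X (\<lambda>z. (z, i) \<in> W)" for i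
  proof (cases "i < k")
    case True
    have "loc_const X (\<lambda>z. z \<in> C i \<and> (n z, n (\<phi> (v i) z)) \<in> {(a, b). a \<noteq> b + v i})"
      using loc_const_combine[OF loc_const_mem[OF C[OF True]]
          loc_const_Pair[OF n loc_const_act[OF n, of "v i"]],
          of "\<lambda>b p. b \<and> p \<in> {(a, b). a \<noteq> b + v i}"] .
    then show ?thesis using True by (simp add: W_def)
  qed (simp add: W_def)
  define Ns where "Ns p = n (fst p)" for p :: "'a \<times> nat"
  define Nt where "Nt p = n (\<phi> (v (snd p)) (fst p)) + v (snd p)" for p
  have lNs: "loc_const X (\<lambda>z. Ns (z, i))" for i using n by (simp add: Ns_def)
  have lNt: "loc_const X (\<lambda>z. Nt (z, i))" for i
    using loc_const_compose[OF loc_const_act[OF n, of "v i"], of "\<lambda>w. w + v i"] by (simp add: Nt_def)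
  have cs: "\<forall>p\<in>W. \<phi> (Ns p) (fst p) \<in> U"
    using W cen by (auto simp: Ns_def)
  have ct: "\<forall>p\<in>W. \<phi> (Nt p) (fst p) \<in> U"
  proof
    fix p assume "p \<in> W"
    then have z: "fst p \<in> topspace X" using W by auto
    let ?z = "\<phi> (v (snd p)) (fst p)"
    have "\<phi> (n ?z) ?z \<in> U" using cen[OF act_in[OF z]] .
    then show "\<phi> (Nt p) (fst p) \<in> U" using z by (simp add: Nt_def)
  qed
  have alg: "a + b = - p \<longleftrightarrow> a = - (p + b)" for a b p :: "int ^ 'd"
    by (simp add: eq_diff_eq)
  have alg': "- p = a + b \<longleftrightarrow> a = - (p + b)" for a b p :: "int ^ 'd"
    using alg[of a b p] by metis
  have Out_iff: "(p, i) \<in> tile_src W Ns u \<longleftrightarrow> i < k \<and> \<phi> p u \<in> C i \<and> p \<in> T u \<and> p + v i \<notin> T u"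
    if "u \<in> U" for u p i
  proof -
    have "\<phi> (v i) (\<phi> p u) = \<phi> (p + v i) u" using that UX by (auto simp: add.commute)
    moreover have "n (\<phi> p u) = - p \<Longrightarrow>
        n (\<phi> p u) = n (\<phi> (p + v i) u) + v i \<longleftrightarrow> n (\<phi> (p + v i) u) = - (p + v i)"
      using alg' by metis
    ultimately show ?thesis
      unfolding tile_src_def W_def Ns_def T_iff[OF that] by auto
  qed
  have In_iff: "(p, i) \<in> tile_src W Nt u \<longleftrightarrow> i < k \<and> \<phi> p u \<in> C i \<and> p \<notin> T u \<and> p + v i \<in> T u"
    if "u \<in> U" for u p i
  proof -
    have "\<phi> (v i) (\<phi> p u) = \<phi> (p + v i) u" using that UX by (auto simp: add.commute)
    moreover have "n (\<phi> (p + v i) u) + v i = - p \<longleftrightarrow> n (\<phi> (p + v i) u) = - (p + v i)"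
      by (rule alg)
    ultimately show ?thesis
      unfolding tile_src_def W_def Nt_def T_iff[OF that] by auto
  qed
  \<comment> \<open>Every outgoing unit starts at a boundary point, and at most \<open>k\<close>
    units start at the same point.\<close>
  have leA: "\<forall>u\<in>U. card (tile_src W Ns u) \<le> card (tile A n u)"
  proof
    fix u assume u: "u \<in> U"
    let ?bd = "fst ` tile_src W Ns u"
    have bdT: "?bd \<subseteq> T u" using Out_iff[OF u] by fastforce
    have "tile_src W Ns u \<subseteq> ?bd \<times> {..<k}"
    proof
      fix x assume x: "x \<in> tile_src W Ns u"
      obtain p i where "x = (p, i)" by (cases x)
      then show "x \<in> ?bd \<times> {..<k}" using x Out_iff[OF u, of p i] by force
    qed
    then have "card (tile_src W Ns u) \<le> card (?bd \<times> {..<k})"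
      using finite_subset[OF bdT finT] by (intro card_mono) auto
    also have "\<dots> = k * card ?bd" by (simp add: card_cartesian_product mult.commute)
    also have "\<dots> \<le> card (tile A n u)"
    proof (rule bdA[OF u bdT])
      fix p assume "p \<in> ?bd"
      then obtain i where "(p, i) \<in> tile_src W Ns u" by auto
      then have "i < k" "p + v i \<notin> T u" using Out_iff[OF u] by blast+
      then show "\<exists>w. norm (real_vec w) \<le> L \<and> p + w \<notin> T u" using L by blast
    qed
    finally show "card (tile_src W Ns u) \<le> card (tile A n u)" .
  qed
  have leB: "\<forall>u\<in>U. card (tile_src W Nt u) \<le> card (tile B n u)"
  proof
    fix u assume u: "u \<in> U"
    \<comment> \<open>Incoming units start outside the tile. They are counted at their targets,
      which are boundary points since \<open>- v i\<close> leads back out.\<close>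
    let ?g = "\<lambda>(p, i). (p + v i, i)"
    let ?bd = "fst ` ?g ` tile_src W Nt u"
    have bdT: "?bd \<subseteq> T u" using In_iff[OF u] by fastforce
    have "?g ` tile_src W Nt u \<subseteq> ?bd \<times> {..<k}"
    proof
      fix x assume x: "x \<in> ?g ` tile_src W Nt u"
      then obtain p i where "(p, i) \<in> tile_src W Nt u" "x = (p + v i, i)" by auto
      then show "x \<in> ?bd \<times> {..<k}" using x In_iff[OF u, of p i] by force
    qed
    then have "card (?g ` tile_src W Nt u) \<le> card (?bd \<times> {..<k})"
      using finite_subset[OF bdT finT] by (intro card_mono) auto
    moreover have "card (?g ` tile_src W Nt u) = card (tile_src W Nt u)"
      by (rule card_image) (auto simp: inj_on_def)
    ultimately have "card (tile_src W Nt u) \<le> card (?bd \<times> {..<k})" by simp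
    also have "\<dots> = k * card ?bd" by (simp add: card_cartesian_product mult.commute)
    also have "\<dots> \<le> card (tile B n u)"
    proof (rule bdB[OF u bdT])
      fix q assume "q \<in> ?bd"
      then obtain p i where "(p, i) \<in> tile_src W Nt u" "q = p + v i" by auto
      then have "i < k" "q + - v i \<notin> T u" using In_iff[OF u, of p i] by auto
      then show "\<exists>w. norm (real_vec w) \<le> L \<and> q + w \<notin> T u"
        using L[of i] by (intro exI[of _ "- v i"]) simp
    qed
    finally show "card (tile_src W Nt u) \<le> card (tile B n u)" .
  qed
  obtain s where s: "\<And>i. loc_const X (\<lambda>z. s (z, i))"
    "inj_on (\<lambda>p. \<phi> (s p) (fst p)) W"
    "(\<lambda>p. \<phi> (s p) (fst p)) ` W \<subseteq> A" "clopen_in X ((\<lambda>p. \<phi> (s p) (fst p)) ` W)"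
    "\<And>u. u \<in> U \<Longrightarrow>
       card (tile ((\<lambda>p. \<phi> (s p) (fst p)) ` W) n u) = card (tile_src W Ns u)"
    by (rule tile_matching[OF W lW lNs cs A(1) n UX leA]) (rule that)
  obtain t where t: "\<And>i. loc_const X (\<lambda>z. t (z, i))"
    "inj_on (\<lambda>p. \<phi> (t p) (fst p)) W"
    "(\<lambda>p. \<phi> (t p) (fst p)) ` W \<subseteq> B" "clopen_in X ((\<lambda>p. \<phi> (t p) (fst p)) ` W)"
    "\<And>u. u \<in> U \<Longrightarrow>
       card (tile ((\<lambda>p. \<phi> (t p) (fst p)) ` W) n u) = card (tile_src W Nt u)"
    by (rule tile_matching[OF W lW lNt ct B(1) n UX leB]) (rule that)
  define \<sigma> where "\<sigma> p = \<phi> (s p) (fst p)" for p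
  define \<tau> where "\<tau> p = \<phi> (t p) (fst p)" for p
  note s = s[folded \<sigma>_def] and t = t[folded \<tau>_def]
  define A' where "A' = A - \<sigma> ` W"
  define B' where "B' = B - \<tau> ` W"
  have A': "clopen_in X A'" and B': "clopen_in X B'"
    unfolding A'_def B'_def using A B s(4) t(4) clopen_in_Diff by blast+
  have tile_card_Diff: "card (tile (E - M) n u) + card (tile M n u) = card (tile E n u)"
    if "M \<subseteq> E" "E \<subseteq> topspace X" for E M u
  proof -
    have "tile E n u = tile (E - M) n u \<union> tile M n u" "tile (E - M) n u \<inter> tile M n u = {}"
      using that by (auto simp: tile_def)
    moreover have "finite (tile (E - M) n u)" "finite (tile M n u)"
      using that by (auto intro!: finite_tile[OF n])
    ultimately show ?thesis by (simp add: card_Un_disjoint)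
  qed
  have fin_src: "finite (tile_src W N u)" if "\<And>p i. (p, i) \<in> tile_src W N u \<Longrightarrow> i < k \<and> (p \<in> T u \<or> p + v i \<in> T u)"
    for N u
  proof (rule finite_subset)
    show "tile_src W N u \<subseteq> (T u \<union> (\<Union>i<k. (\<lambda>q. q - v i) ` T u)) \<times> {..<k}"
    proof
      fix x assume x: "x \<in> tile_src W N u"
      obtain p i where pi: "x = (p, i)" by (cases x)
      have "p = (p + v i) - v i" by simp
      then show "x \<in> (T u \<union> (\<Union>i<k. (\<lambda>q. q - v i) ` T u)) \<times> {..<k}"
        using that[of p i] x unfolding pi by blast
    qed
    show "finite ((T u \<union> (\<Union>i<k. (\<lambda>q. q - v i) ` T u)) \<times> {..<k})" using finT by auto
  qed
  \<comment> \<open>The identity \<open>AB\<close> summed over one tile: units that stay inside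
    cancel, which leaves outflow minus inflow.\<close>
  have balance: "int (card (tile A n u)) - int (card (tile B n u)) =
      int (card (tile_src W Ns u)) - int (card (tile_src W Nt u))" if u: "u \<in> U" for u
  proof -
    have uX: "u \<in> topspace X" using u UX by auto
    have cnt: "(\<Sum>p\<in>T u. indicator E (\<phi> p u) :: int) = int (card {p \<in> T u. \<phi> p u \<in> E})" for E
      using finT by (simp add: indicator_def sum.If_cases Int_def)
    have tl: "tile E n u = {p \<in> T u. \<phi> p u \<in> E}" if "E \<subseteq> topspace X" for E
      using that by (auto simp: T_def tile_def)
    have step: "(\<Sum>p\<in>T u. indicator (C i) (\<phi> p u) - indicator (\<phi> (v i) ` C i) (\<phi> p u) :: int) =
        int (card {p. (p, i) \<in> tile_src W Ns u}) - int (card {p. (p, i) \<in> tile_src W Nt u})"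
      if i: "i < k" for i
    proof -
      \<comment> \<open>\<open>P\<close> holds the sources in the tile and \<open>Q\<close> the
        sources whose targets are in the tile. Their intersection is the internal flow, and the two
        differences are the outgoing and the incoming units.\<close>
      define P where "P = {p \<in> T u. \<phi> p u \<in> C i}"
      define Q where "Q = {p. p + v i \<in> T u \<and> \<phi> p u \<in> C i}"
      have Qim: "(\<lambda>p. p + v i) ` Q = {q \<in> T u. \<phi> q u \<in> \<phi> (v i) ` C i}"
      proof (intro equalityI subsetI)
        fix q assume "q \<in> {q \<in> T u. \<phi> q u \<in> \<phi> (v i) ` C i}"
        then have "q - v i \<in> Q"
          using act_image_iff[OF CX[OF i] act_in[OF uX], of q "v i"] uX by (simp add: Q_def)
        then show "q \<in> (\<lambda>p. p + v i) ` Q" by (metis diff_add_cancel image_eqI)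
      next
        fix q assume "q \<in> (\<lambda>p. p + v i) ` Q"
        then obtain p where "p \<in> Q" "q = p + v i" by auto
        then show "q \<in> {q \<in> T u. \<phi> q u \<in> \<phi> (v i) ` C i}"
          using act_image_iff[OF CX[OF i] act_in[OF uX], of q "v i"] uX by (simp add: Q_def)
      qed
      have fin: "finite P" "finite Q"
      proof -
        show "finite P" using finT by (simp add: P_def)
        have "Q \<subseteq> (\<lambda>q. q - v i) ` T u"
        proof
          fix p assume "p \<in> Q"
          then have "p = (p + v i) - v i" "p + v i \<in> T u" by (auto simp: Q_def)
          then show "p \<in> (\<lambda>q. q - v i) ` T u" by blast
        qed
        then show "finite Q" using finT finite_subset by blast
      qed
      have "card Q = card {q \<in> T u. \<phi> q u \<in> \<phi> (v i) ` C i}"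
        unfolding Qim[symmetric] by (simp add: card_image inj_on_def)
      then have "(\<Sum>p\<in>T u. indicator (C i) (\<phi> p u) - indicator (\<phi> (v i) ` C i) (\<phi> p u) :: int) =
          int (card P) - int (card Q)"
        by (simp add: sum_subtractf cnt P_def)
      also have "\<dots> = int (card (P - Q)) - int (card (Q - P))"
        using card_Int_Diff[OF fin(1), of Q] card_Int_Diff[OF fin(2), of P] by (simp add: Int_commute)
      also have "P - Q = {p. (p, i) \<in> tile_src W Ns u}"
        using Out_iff[OF u] i by (auto simp: P_def Q_def)
      also have "Q - P = {p. (p, i) \<in> tile_src W Nt u}"
        using In_iff[OF u] i by (auto simp: P_def Q_def)
      finally show ?thesis .
    qed
    have "int (card (tile A n u)) - int (card (tile B n u)) =
        (\<Sum>p\<in>T u. indicator A (\<phi> p u) - indicator B (\<phi> p u))"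
      using clopen_in_subset[OF A(1)] clopen_in_subset[OF B(1)]
      by (simp add: tl cnt sum_subtractf)
    also have "\<dots> = (\<Sum>p\<in>T u. \<Sum>i<k. indicator (C i) (\<phi> p u) - indicator (\<phi> (v i) ` C i) (\<phi> p u))"
      using AB uX by (intro sum.cong) auto
    also have "\<dots> = (\<Sum>i<k. \<Sum>p\<in>T u. indicator (C i) (\<phi> p u) - indicator (\<phi> (v i) ` C i) (\<phi> p u))"
      by (rule sum.swap)
    also have "\<dots> = (\<Sum>i<k. int (card {p. (p, i) \<in> tile_src W Ns u}) -
        int (card {p. (p, i) \<in> tile_src W Nt u}))"
      by (rule sum.cong) (use step in auto)
    also have "\<dots> = int (\<Sum>i<k. card {p. (p, i) \<in> tile_src W Ns u}) -
        int (\<Sum>i<k. card {p. (p, i) \<in> tile_src W Nt u})"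
      by (simp add: sum_subtractf)
    also have "(\<Sum>i<k. card {p. (p, i) \<in> tile_src W Ns u}) = card (tile_src W Ns u)"
      by (rule card_fibres_nat[symmetric]) (use fin_src[of Ns u] Out_iff[OF u] in auto)
    also have "(\<Sum>i<k. card {p. (p, i) \<in> tile_src W Nt u}) = card (tile_src W Nt u)"
      by (rule card_fibres_nat[symmetric]) (use fin_src[of Nt u] In_iff[OF u] in auto)
    finally show ?thesis .
  qed
  \<comment> \<open>\<open>A\<close> has lost as many points in the tile as units leave it, and
    \<open>B\<close> as many as units enter it, so \<open>balance\<close> equates the
    remainders.\<close>
  have eq': "card (tile A' n u) = card (tile B' n u)" if u: "u \<in> U" for u
    using balance[OF u] s(5)[OF u] t(5)[OF u]
      tile_card_Diff[OF s(3) clopen_in_subset[OF A(1)], of u]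
      tile_card_Diff[OF t(3) clopen_in_subset[OF B(1)], of u]
    by (simp add: A'_def B'_def)
  \<comment> \<open>One unit per leftover point, all with index 0, so that
    \<open>tile_matching\<close> applies once more.\<close>
  define S where "S = A' \<times> {0 :: nat}"
  have tS: "tile_src S Ns u = tile A' n u \<times> {0}" for u
    by (auto simp: tile_src_def tile_def S_def Ns_def)
  have SX: "S \<subseteq> topspace X \<times> {..<1}" using clopen_in_subset[OF A'] by (auto simp: S_def)
  have lS: "loc_const X (\<lambda>z. (z, i) \<in> S)" for i
    by (cases "i = 0") (simp_all add: S_def loc_const_mem[OF A'])
  have cS: "\<forall>p\<in>S. \<phi> (Ns p) (fst p) \<in> U"
    using cen clopen_in_subset[OF A'] by (auto simp: S_def Ns_def)
  have leS: "\<forall>u\<in>U. card (tile_src S Ns u) \<le> card (tile B' n u)"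
    using eq' by (simp add: tS card_cartesian_product)
  obtain r where r: "\<And>i. loc_const X (\<lambda>z. r (z, i))"
    "inj_on (\<lambda>p. \<phi> (r p) (fst p)) S"
    "(\<lambda>p. \<phi> (r p) (fst p)) ` S \<subseteq> B'" "clopen_in X ((\<lambda>p. \<phi> (r p) (fst p)) ` S)"
    "\<And>u. u \<in> U \<Longrightarrow>
       card (tile ((\<lambda>p. \<phi> (r p) (fst p)) ` S) n u) = card (tile_src S Ns u)"
    by (rule tile_matching[OF SX lS lNs cS B' n UX leS]) (rule that)
  define \<rho> where "\<rho> z = \<phi> (r (z, 0)) z" for z
  have imS: "(\<lambda>p. \<phi> (r p) (fst p)) ` S = \<rho> ` A'" by (force simp: S_def \<rho>_def)
  \<comment> \<open>In each tile the image is a subset of \<open>B'\<close> of the same finite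
    cardinality, hence all of it.\<close>
  have "B' \<subseteq> \<rho> ` A'"
  proof
    fix y assume y: "y \<in> B'"
    then have yX: "y \<in> topspace X" using clopen_in_subset[OF B'] by auto
    define u where "u = \<phi> (n y) y"
    have u: "u \<in> U" using cen[OF yX] by (simp add: u_def)
    have "tile (\<rho> ` A') n u \<subseteq> tile B' n u" using r(3) imS by (auto simp: tile_def)
    moreover have "card (tile (\<rho> ` A') n u) = card (tile B' n u)"
      using r(5)[OF u] eq'[OF u] by (simp add: tS imS card_cartesian_product)
    ultimately have "tile (\<rho> ` A') n u = tile B' n u"
      using finite_tile[OF n clopen_in_subset[OF B']] by (intro card_subset_eq) auto
    moreover have "- n y \<in> tile B' n u" using y yX by (simp add: tile_def u_def)
    ultimately have "- n y \<in> tile (\<rho> ` A') n u" by simp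
    then show "y \<in> \<rho> ` A'" using yX by (simp add: tile_def u_def)
  qed
  moreover have "inj_on \<rho> A'" using r(2) by (auto simp: inj_on_def S_def \<rho>_def)
  ultimately have bij\<rho>: "bij_betw \<rho> A' B'" using r(3) imS by (auto simp: bij_betw_def)
  define iv where "iv = inv_into W \<sigma>"
  have biv: "bij_betw iv (\<sigma> ` W) W"
    unfolding iv_def using s(2) by (rule inj_on_imp_bij_betw [THEN bij_betw_inv_into])
  have bt: "bij_betw \<tau> W (\<tau> ` W)" using t(2) by (simp add: bij_betw_def)
  \<comment> \<open>From the representative \<open>\<sigma> p\<close> of a unit go back by
    \<open>s p\<close> to its base point, then by \<open>t p\<close> to
    \<open>\<tau> p\<close>.\<close>
  define D where "D z = (if z \<in> \<sigma> ` W then t (iv z) - s (iv z) else if z \<in> A then r (z, 0) else 0)" for z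
  have D\<sigma>: "\<phi> (D z) z = \<tau> (iv z)" if "z \<in> \<sigma> ` W" for z
  proof -
    have p: "iv z \<in> W" "\<sigma> (iv z) = z"
      using that by (auto simp: iv_def inv_into_into f_inv_into_f)
    then have "fst (iv z) \<in> topspace X" using W by auto
    then have "\<phi> (t (iv z) - s (iv z)) (\<sigma> (iv z)) = \<tau> (iv z)" by (simp add: \<sigma>_def \<tau>_def)
    then show ?thesis using that p by (simp add: D_def)
  qed
  have D\<rho>: "\<phi> (D z) z = \<rho> z" if "z \<in> A'" for z
    using that by (simp add: D_def A'_def \<rho>_def)
  have "bij_betw (\<lambda>z. \<phi> (D z) z) (\<sigma> ` W) (\<tau> ` W)"
    using bij_betw_trans[OF biv bt] by (rule bij_betw_cong[THEN iffD1, rotated]) (simp add: D\<sigma>)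
  moreover have "bij_betw (\<lambda>z. \<phi> (D z) z) A' B'"
    using bij\<rho> by (rule bij_betw_cong[THEN iffD1, rotated]) (simp add: D\<rho>)
  ultimately have "bij_betw (\<lambda>z. \<phi> (D z) z) (\<sigma> ` W \<union> A') (\<tau> ` W \<union> B')"
    by (rule bij_betw_combine) (auto simp: B'_def)
  moreover have "\<sigma> ` W \<union> A' = A" "\<tau> ` W \<union> B' = B"
    using s(3) t(3) by (auto simp: A'_def B'_def)
  ultimately have bij: "bij_betw (\<lambda>z. \<phi> (D z) z) A B" by simp
  have "loc_const X D"
  proof (rule loc_const_on_clopen[OF A(1)])
    fix d
    \<comment> \<open>A description of the level set without the inverse \<open>iv\<close>:
      \<open>w\<close> stands for \<open>- s p\<close>, so the base point is
      \<open>\<phi> w z\<close>, and \<open>t p = d - w\<close> says that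
      \<open>t p - s p = d\<close>.\<close>
    let ?E = "\<lambda>i w. {z \<in> topspace X. (\<phi> w z, i) \<in> W \<and> s (\<phi> w z, i) = - w \<and> t (\<phi> w z, i) = d - w}"
    have opE: "openin X (?E i w)" for i w
    proof -
      have "loc_const X (\<lambda>z. (z, i) \<in> W \<and> (s (z, i), t (z, i)) = (- w, d - w))"
        using loc_const_combine[OF lW[of i] loc_const_Pair[OF s(1)[of i] t(1)[of i]],
            of "\<lambda>b p. b \<and> p = (- w, d - w)"] .
      from loc_const_openin[OF loc_const_act[OF this, of w], of "\<lambda>b. b"] show ?thesis by simp
    qed
    have opA: "openin X {z \<in> A'. r (z, 0) = d}"
      using clopen_in_restrict[OF A' loc_const_compose[OF r(1)[of 0], of "\<lambda>w. w = d"]]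
      by (simp add: clopen_in_def)
    have eqD: "{z \<in> A. D z = d} = {z \<in> A'. r (z, 0) = d} \<union> (\<Union>i. \<Union>w. ?E i w)"
    proof (intro equalityI subsetI)
      fix z assume z: "z \<in> {z \<in> A. D z = d}"
      show "z \<in> {z \<in> A'. r (z, 0) = d} \<union> (\<Union>i. \<Union>w. ?E i w)"
      proof (cases "z \<in> \<sigma> ` W")
        case True
        obtain y i where yi: "iv z = (y, i)" by (cases "iv z")
        have p: "(y, i) \<in> W" "\<sigma> (y, i) = z"
          using True yi[symmetric] by (auto simp: iv_def inv_into_into f_inv_into_f)
        have y: "y \<in> topspace X" using p(1) W by auto
        have zX: "z \<in> topspace X" using z clopen_in_subset[OF A(1)] by auto
        have "\<phi> (- s (y, i)) z = y" using p(2) y by (auto simp: \<sigma>_def)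
        moreover have "t (y, i) = d + s (y, i)" using z True yi by (auto simp: D_def)
        ultimately have "z \<in> ?E i (- s (y, i))" using p zX by simp
        then show ?thesis by blast
      next
        case False
        then show ?thesis using z by (auto simp: A'_def D_def)
      qed
    next
      fix z assume "z \<in> {z \<in> A'. r (z, 0) = d} \<union> (\<Union>i. \<Union>w. ?E i w)"
      then consider "z \<in> A'" "r (z, 0) = d" | i w where "z \<in> ?E i w" by blast
      then show "z \<in> {z \<in> A. D z = d}"
      proof cases
        case 1
        then show ?thesis by (auto simp: A'_def D_def)
      next
        case 2
        let ?p = "(\<phi> w z, i)"
        have p: "?p \<in> W" "\<sigma> ?p = z" using 2 by (auto simp: \<sigma>_def)
        then have "iv z = ?p" unfolding iv_def using s(2) by (metis inv_into_f_f)
        moreover have "z \<in> \<sigma> ` W" using p by (metis image_eqI)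
        ultimately show ?thesis using 2 s(3) by (auto simp: D_def)
      qed
    qed
    have "openin X (\<Union>i. \<Union>w. ?E i w)"
      by (intro openin_Union ballI) (use opE in \<open>auto intro!: openin_Union\<close>)
    then show "openin X {z \<in> A. D z = d}" unfolding eqD by (rule openin_Un[OF opA])
  next
    show "D z = 0" if "z \<in> topspace X" "z \<notin> A" for z
      using that s(3) by (auto simp: D_def)
  qed
  then show ?thesis using that bij by blast
qed

end

section \<open>Coboundaries\<close>

lemma int_functions_carrier:
  "f \<in> carrier (int_functions X) \<longleftrightarrow> loc_const X f \<and> (\<forall>x. x \<notin> topspace X \<longrightarrow> f x = 0)"
  by (simp add: int_functions_def loc_const_def)

lemma int_functions_mult [simp]: "f \<otimes>\<^bsub>int_functions X\<^esub> g = (\<lambda>x. f x + g x)"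
  and int_functions_one [simp]: "\<one>\<^bsub>int_functions X\<^esub> = (\<lambda>_. 0)"
  by (simp_all add: int_functions_def)

lemma int_functions_add:
  "f \<in> carrier (int_functions X) \<Longrightarrow> g \<in> carrier (int_functions X) \<Longrightarrow>
    (\<lambda>x. f x + g x) \<in> carrier (int_functions X)"
  unfolding int_functions_carrier using loc_const_combine[of X f g "(+)"] by auto

lemma int_functions_uminus:
  "f \<in> carrier (int_functions X) \<Longrightarrow> (\<lambda>x. - f x) \<in> carrier (int_functions X)"
  unfolding int_functions_carrier using loc_const_compose[of X f uminus] by auto

lemma int_functions_diff:
  "f \<in> carrier (int_functions X) \<Longrightarrow> g \<in> carrier (int_functions X) \<Longrightarrow>
    (\<lambda>x. f x - g x) \<in> carrier (int_functions X)"
  using int_functions_add[OF _ int_functions_uminus, of f X g] by simp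

lemma int_functions_zero: "(\<lambda>_. 0) \<in> carrier (int_functions X)"
  by (simp add: int_functions_carrier)

lemma comm_group_int_functions: "comm_group (int_functions X)"
proof (rule comm_groupI)
  fix f assume f: "f \<in> carrier (int_functions X)"
  show "\<exists>g\<in>carrier (int_functions X). g \<otimes>\<^bsub>int_functions X\<^esub> f = \<one>\<^bsub>int_functions X\<^esub>"
    using int_functions_uminus[OF f] by (intro bexI[of _ "\<lambda>x. - f x"]) simp_all
qed (simp_all add: int_functions_add int_functions_zero algebra_simps)

lemma int_functions_inv:
  assumes "f \<in> carrier (int_functions X)"
  shows "inv\<^bsub>int_functions X\<^esub> f = (\<lambda>x. - f x)"
proof -
  interpret comm_group "int_functions X" by (rule comm_group_int_functions)
  show ?thesis
    by (rule inv_equality) (simp_all add: assms int_functions_uminus)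
qed

lemma indicator_int_functions: "clopen_in X A \<Longrightarrow> indicator A \<in> carrier (int_functions X)"
  unfolding int_functions_carrier
  using loc_const_indicator[of X A] clopen_in_subset[of X A] by (auto simp: indicator_def)

text \<open>By compactness \<open>f\<close> takes finitely many values, so it is an integer
  combination of the indicators of its clopen level sets.\<close>

lemma int_functions_induct:
  assumes X: "compact_space X" and f: "f \<in> carrier (int_functions X)"
    and zero: "P (\<lambda>_. 0)"
    and add: "\<And>f g. f \<in> carrier (int_functions X) \<Longrightarrow> g \<in> carrier (int_functions X) \<Longrightarrow>
      P f \<Longrightarrow> P g \<Longrightarrow> P (\<lambda>x. f x + g x)"
    and minus: "\<And>f. f \<in> carrier (int_functions X) \<Longrightarrow> P f \<Longrightarrow> P (\<lambda>x. - f x)"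
    and ind: "\<And>A. clopen_in X A \<Longrightarrow> P (indicator A)"
  shows "P f"
proof -
  define Q where "Q g \<longleftrightarrow> g \<in> carrier (int_functions X) \<and> P g" for g
  have Qadd: "Q (\<lambda>x. g x + h x)" if "Q g" "Q h" for g h
    using that add int_functions_add unfolding Q_def by blast
  have Qnat: "Q (\<lambda>x. int n * indicator A x)" if "clopen_in X A" for n A
  proof (induction n)
    case 0
    then show ?case using zero by (simp add: Q_def int_functions_zero)
  next
    case (Suc n)
    have "Q (indicator A)" using ind indicator_int_functions that by (auto simp: Q_def)
    from Qadd[OF this Suc] show ?case by (simp add: algebra_simps)
  qed
  have Qint: "Q (\<lambda>x. k * indicator A x)" if "clopen_in X A" for k A
  proof (cases "0 \<le> k")
    case True
    then show ?thesis using Qnat[OF that, of "nat k"] by simp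
  next
    case False
    have "Q (\<lambda>x. - (int (nat (- k)) * indicator A x))"
      using Qnat[OF that, of "nat (- k)"] minus int_functions_uminus unfolding Q_def by blast
    then show ?thesis using False by simp
  qed
  let ?L = "\<lambda>k. {x \<in> topspace X. f x = k}"
  have cl: "clopen_in X (?L k)" for k
    using f loc_const_clopen[OF loc_const_compose[of X f "\<lambda>y. y = k"]]
    by (simp add: int_functions_carrier)
  have "Q (\<lambda>x. \<Sum>k\<in>K. k * indicator (?L k) x)" if "finite K" for K
    using that
  proof (induction K rule: finite_induct)
    case empty
    then show ?case using zero by (simp add: Q_def int_functions_zero)
  next
    case (insert k K)
    then show ?case
      unfolding sum.insert[OF insert.hyps] using Qadd[OF Qint[OF cl, of k k]] by blast
  qed
  from this[OF loc_const_finite_range[OF X, of f]]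
  have "Q (\<lambda>x. \<Sum>k\<in>f ` topspace X. k * indicator (?L k) x)"
    using f by (simp add: int_functions_carrier)
  moreover have "(\<lambda>x. \<Sum>k\<in>f ` topspace X. k * indicator (?L k) x) = f"
  proof
    fix x
    show "(\<Sum>k\<in>f ` topspace X. k * indicator (?L k) x) = f x"
    proof (cases "x \<in> topspace X")
      case True
      have "(\<Sum>k\<in>f ` topspace X. k * indicator (?L k) x) =
          (\<Sum>k\<in>f ` topspace X. if k = f x then k else 0)"
        using True by (intro sum.cong) (auto simp: indicator_def)
      also have "\<dots> = f x"
        using True loc_const_finite_range[OF X, of f] f by (simp add: int_functions_carrier)
      finally show ?thesis .
    next
      case False
      then show ?thesis using f by (simp add: int_functions_carrier)
    qed
  qed
  ultimately show ?thesis by (simp add: Q_def)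
qed

context Cantor_Zd_system
begin

lemma generator_int_functions:
  "clopen_in X C \<Longrightarrow> (\<lambda>x. indicator C x - indicator (\<phi> v ` C) x) \<in> carrier (int_functions X)"
  using int_functions_diff[OF indicator_int_functions indicator_int_functions[OF clopen_act_image]]
  by auto

lemma generators_int_functions:
  "{(\<lambda>x. indicator A x - indicator (\<phi> v ` A) x) | A v. clopen_in X A} \<subseteq> carrier (int_functions X)"
  using generator_int_functions by auto

lemma coboundaries_subgroup: "subgroup (coboundaries X \<phi>) (int_functions X)"
  unfolding coboundaries_def
  by (rule group.generate_is_subgroup[OF comm_group.axioms(2)[OF comm_group_int_functions]
        generators_int_functions])

lemma coboundaries_normal: "coboundaries X \<phi> \<lhd> int_functions X"
  by (rule comm_group.subgroup_imp_normal[OF comm_group_int_functions coboundaries_subgroup])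

lemma coboundaries_carrier: "f \<in> coboundaries X \<phi> \<Longrightarrow> f \<in> carrier (int_functions X)"
  using subgroup.mem_carrier[OF coboundaries_subgroup] .

lemma coboundaries_zero: "(\<lambda>_. 0) \<in> coboundaries X \<phi>"
  using subgroup.one_closed[OF coboundaries_subgroup] by simp

lemma coboundaries_add:
  "f \<in> coboundaries X \<phi> \<Longrightarrow> g \<in> coboundaries X \<phi> \<Longrightarrow> (\<lambda>x. f x + g x) \<in> coboundaries X \<phi>"
  using subgroup.m_closed[OF coboundaries_subgroup] by simp

lemma coboundaries_uminus:
  assumes "f \<in> coboundaries X \<phi>"
  shows "(\<lambda>x. - f x) \<in> coboundaries X \<phi>"
  using subgroup.m_inv_closed[OF coboundaries_subgroup assms]
  by (simp only: int_functions_inv[OF coboundaries_carrier[OF assms]])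

lemma coboundaries_diff:
  "f \<in> coboundaries X \<phi> \<Longrightarrow> g \<in> coboundaries X \<phi> \<Longrightarrow> (\<lambda>x. f x - g x) \<in> coboundaries X \<phi>"
  using coboundaries_add[OF _ coboundaries_uminus, of f g] by simp

lemma coboundaries_sum:
  "(\<And>i. i \<in> I \<Longrightarrow> f i \<in> coboundaries X \<phi>) \<Longrightarrow> (\<lambda>x. \<Sum>i\<in>I. f i x) \<in> coboundaries X \<phi>"
proof (induction I rule: infinite_finite_induct)
  case (insert i I)
  then show ?case using coboundaries_add[of "f i" "\<lambda>x. \<Sum>i\<in>I. f i x"] by simp
qed (simp_all add: coboundaries_zero)

lemma coboundaries_generator:
  "clopen_in X C \<Longrightarrow> (\<lambda>x. indicator C x - indicator (\<phi> v ` C) x) \<in> coboundaries X \<phi>"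
  unfolding coboundaries_def by (rule generate.incl) blast

lemma coboundaries_induct [consumes 1, case_names zero generator minus add]:
  assumes "f \<in> coboundaries X \<phi>"
    and zero: "P (\<lambda>_. 0)"
    and gen: "\<And>C v. clopen_in X C \<Longrightarrow> P (\<lambda>x. indicator C x - indicator (\<phi> v ` C) x)"
    and minus: "\<And>f. f \<in> coboundaries X \<phi> \<Longrightarrow> P f \<Longrightarrow> P (\<lambda>x. - f x)"
    and add: "\<And>f g. f \<in> coboundaries X \<phi> \<Longrightarrow> g \<in> coboundaries X \<phi> \<Longrightarrow>
      P f \<Longrightarrow> P g \<Longrightarrow> P (\<lambda>x. f x + g x)"
  shows "P f"
  using assms(1) unfolding coboundaries_def
proof (induction rule: generate.induct)
  case one
  then show ?case using zero by simp
next
  case (incl h)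
  then show ?case using gen by auto
next
  case (inv h)
  then obtain C v where C: "clopen_in X C" and h: "h = (\<lambda>x. indicator C x - indicator (\<phi> v ` C) x)"
    by auto
  have cob: "h \<in> coboundaries X \<phi>" unfolding h by (rule coboundaries_generator[OF C])
  have "P h" unfolding h by (rule gen[OF C])
  with cob have "P (\<lambda>x. - h x)" by (rule minus)
  then show ?case by (simp only: int_functions_inv[OF coboundaries_carrier[OF cob]])
next
  case (eng f g)
  then show ?case using add by (simp add: coboundaries_def)
qed

lemma coboundaries_representation:
  assumes "f \<in> coboundaries X \<phi>"
  shows "\<exists>(k::nat) C v. (\<forall>i<k. clopen_in X (C i)) \<and>
    (\<forall>x\<in>topspace X. f x = (\<Sum>i<k. indicator (C i) x - indicator (\<phi> (v i) ` C i) x))"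
  using assms
proof (induction rule: coboundaries_induct)
  case zero
  show ?case by (intro exI[of _ 0]) simp
next
  case (generator C v)
  then show ?case
    by (intro exI[of _ 1] exI[of _ "\<lambda>_. C"] exI[of _ "\<lambda>_. v"]) simp
next
  case (minus f)
  from minus.IH obtain k :: nat and C v where C: "\<forall>i<k. clopen_in X (C i)"
    and f: "\<forall>x\<in>topspace X. f x = (\<Sum>i<k. indicator (C i) x - indicator (\<phi> (v i) ` C i) x)"
    by (elim exE conjE)
  have im: "\<phi> (- v i) ` \<phi> (v i) ` C i = C i" if "i < k" for i
  proof -
    have "\<phi> (- v i) (\<phi> (v i) x) = x" if "x \<in> C i" for x
      using that clopen_in_subset[of X "C i"] C \<open>i < k\<close> by auto
    then show ?thesis by (force simp: image_image)
  qed
  show ?case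
  proof (intro exI[of _ k] exI[of _ "\<lambda>i. \<phi> (v i) ` C i"] exI[of _ "\<lambda>i. - v i"] conjI allI impI ballI)
    show "clopen_in X (\<phi> (v i) ` C i)" if "i < k" for i
      using clopen_act_image C that by blast
    show "- f x = (\<Sum>i<k. indicator (\<phi> (v i) ` C i) x - indicator (\<phi> (- v i) ` \<phi> (v i) ` C i) x)"
      if "x \<in> topspace X" for x
      unfolding bspec[OF f that] sum_negf[symmetric] by (rule sum.cong) (simp_all add: im)
  qed
next
  case (add f g)
  from add.IH(1) obtain k :: nat and C v where C: "\<forall>i<k. clopen_in X (C i)"
    and f: "\<forall>x\<in>topspace X. f x = (\<Sum>i<k. indicator (C i) x - indicator (\<phi> (v i) ` C i) x)"
    by (elim exE conjE)
  from add.IH(2) obtain l :: nat and D w where D: "\<forall>i<l. clopen_in X (D i)"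
    and g: "\<forall>x\<in>topspace X. g x = (\<Sum>i<l. indicator (D i) x - indicator (\<phi> (w i) ` D i) x)"
    by (elim exE conjE)
  let ?E = "\<lambda>i. if i < k then C i else D (i - k)"
  let ?u = "\<lambda>i. if i < k then v i else w (i - k)"
  have split: "(\<Sum>i<k + l. h i) = (\<Sum>i<k. h i) + (\<Sum>i<l. h (k + i))" for h :: "nat \<Rightarrow> int"
    by (induction l) simp_all
  show ?case
  proof (intro exI[of _ "k + l"] exI[of _ ?E] exI[of _ ?u] conjI allI impI ballI)
    show "clopen_in X (?E i)" if "i < k + l" for i using that C D by auto
    show "f x + g x = (\<Sum>i<k + l. indicator (?E i) x - indicator (\<phi> (?u i) ` ?E i) x)"
      if "x \<in> topspace X" for x
      unfolding split bspec[OF f that] bspec[OF g that] by simp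
  qed
qed

text \<open>Cut \<open>C\<close> along the values of \<open>t\<close>. Each piece is translated by
  one vector, and injectivity keeps the images of the pieces disjoint, so both indicators are sums
  over the pieces.\<close>

lemma coboundaries_transport:
  assumes C: "clopen_in X C" and t: "loc_const X t" and inj: "inj_on (\<lambda>x. \<phi> (t x) x) C"
  shows "(\<lambda>x. indicator C x - indicator ((\<lambda>x. \<phi> (t x) x) ` C) x) \<in> coboundaries X \<phi>"
proof -
  let ?T = "t ` topspace X" and ?E = "\<lambda>w. {x \<in> C. t x = w}"
  have fin: "finite ?T" using loc_const_finite_range[OF compact t] .
  have cl: "clopen_in X (?E w)" for w
    by (rule clopen_in_restrict[OF C loc_const_compose[OF t]])
  have CX: "C \<subseteq> topspace X" using clopen_in_subset[OF C] .
  have 1: "indicator C x = (\<Sum>w\<in>?T. indicator (?E w) x :: int)" for x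
  proof -
    have "C = (\<Union>w\<in>?T. ?E w)" using CX by auto
    moreover have "disjoint_family_on ?E ?T" by (auto simp: disjoint_family_on_def)
    ultimately show ?thesis using indicator_UN_disjoint[OF fin, of ?E x] by simp
  qed
  have 2: "indicator ((\<lambda>x. \<phi> (t x) x) ` C) x = (\<Sum>w\<in>?T. indicator (\<phi> w ` ?E w) x :: int)" for x
  proof -
    have "(\<lambda>x. \<phi> (t x) x) ` C = (\<Union>w\<in>?T. \<phi> w ` ?E w)"
    proof (intro equalityI subsetI)
      fix y assume "y \<in> (\<lambda>x. \<phi> (t x) x) ` C"
      then obtain x where "x \<in> C" "y = \<phi> (t x) x" by auto
      then show "y \<in> (\<Union>w\<in>?T. \<phi> w ` ?E w)" using CX by blast
    next
      fix y assume "y \<in> (\<Union>w\<in>?T. \<phi> w ` ?E w)"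
      then obtain x where "x \<in> C" "y = \<phi> (t x) x" by auto
      then show "y \<in> (\<lambda>x. \<phi> (t x) x) ` C" by blast
    qed
    moreover have "disjoint_family_on (\<lambda>w. \<phi> w ` ?E w) ?T"
      unfolding disjoint_family_on_def
    proof (intro ballI impI)
      fix a b :: "int ^ 'd" assume "a \<noteq> b"
      have False if "x \<in> ?E a" "y \<in> ?E b" "\<phi> a x = \<phi> b y" for x y
        using inj_onD[OF inj, of x y] that \<open>a \<noteq> b\<close> by auto
      then show "\<phi> a ` ?E a \<inter> \<phi> b ` ?E b = {}" by blast
    qed
    ultimately show ?thesis using indicator_UN_disjoint[OF fin, of "\<lambda>w. \<phi> w ` ?E w" x] by simp
  qed
  show ?thesis
    unfolding 1 2 sum_subtractf[symmetric]
    by (rule coboundaries_sum) (rule coboundaries_generator[OF cl])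
qed

section \<open>Classes of integer functions modulo coboundaries\<close>

lemma G_class_mem: "h \<in> G_class X \<phi> f \<longleftrightarrow> (\<lambda>x. h x - f x) \<in> coboundaries X \<phi>"
proof -
  have "h = (\<lambda>x. g x + f x) \<longleftrightarrow> g = (\<lambda>x. h x - f x)" for g by (auto simp: fun_eq_iff algebra_simps)
  then show ?thesis by (auto simp: G_class_def r_coset_def)
qed

lemma G_class_eq_iff:
  "G_class X \<phi> f = G_class X \<phi> g \<longleftrightarrow> (\<lambda>x. f x - g x) \<in> coboundaries X \<phi>"
proof
  assume "G_class X \<phi> f = G_class X \<phi> g"
  moreover have "f \<in> G_class X \<phi> f" using coboundaries_zero by (simp add: G_class_mem)
  ultimately show "(\<lambda>x. f x - g x) \<in> coboundaries X \<phi>" by (simp add: G_class_mem)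
next
  assume fg: "(\<lambda>x. f x - g x) \<in> coboundaries X \<phi>"
  show "G_class X \<phi> f = G_class X \<phi> g"
  proof (rule Set.set_eqI)
    fix h
    show "h \<in> G_class X \<phi> f \<longleftrightarrow> h \<in> G_class X \<phi> g"
      using coboundaries_add[OF _ fg, of "\<lambda>x. h x - f x"] coboundaries_diff[OF _ fg, of "\<lambda>x. h x - g x"]
      by (auto simp: G_class_mem)
  qed
qed

lemma G_group_carrier: "carrier (G_group X \<phi>) = G_class X \<phi> ` carrier (int_functions X)"
  by (simp add: G_group_def carrier_FactGroup G_class_def)

lemma G_group_mult:
  assumes "f \<in> carrier (int_functions X)" "g \<in> carrier (int_functions X)"
  shows "G_class X \<phi> f \<otimes>\<^bsub>G_group X \<phi>\<^esub> G_class X \<phi> g = G_class X \<phi> (\<lambda>x. f x + g x)"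
  using normal.rcos_sum[OF coboundaries_normal assms] by (simp add: G_group_def G_class_def)

lemma G_group_group: "group (G_group X \<phi>)"
  unfolding G_group_def by (rule normal.factorgroup_is_group[OF coboundaries_normal])

text \<open>Classes of indicators generate the group, by \<open>int_functions_induct\<close>. This
  is the uniqueness behind the \<open>THE\<close> in \<open>induced_map\<close>.\<close>

lemma G_group_hom_eqI:
  assumes K: "group K" and h: "h \<in> hom (G_group X \<phi>) K" "h' \<in> hom (G_group X \<phi>) K"
    and eq: "\<And>A. clopen_in X A \<Longrightarrow> h (G_class X \<phi> (indicator A)) = h' (G_class X \<phi> (indicator A))"
    and f: "f \<in> carrier (int_functions X)"
  shows "h (G_class X \<phi> f) = h' (G_class X \<phi> f)"
proof -
  interpret h: group_hom "G_group X \<phi>" K h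
    using G_group_group K h by (simp add: group_hom_def group_hom_axioms_def)
  interpret h': group_hom "G_group X \<phi>" K h'
    using G_group_group K h by (simp add: group_hom_def group_hom_axioms_def)
  have car: "G_class X \<phi> g \<in> carrier (G_group X \<phi>)" if "g \<in> carrier (int_functions X)" for g
    using that by (simp add: G_group_carrier)
  have one: "\<one>\<^bsub>G_group X \<phi>\<^esub> = G_class X \<phi> (\<lambda>_. 0)"
    using G_class_mem[of _ "\<lambda>_. 0"] by (auto simp: G_group_def)
  have neg: "G_class X \<phi> (\<lambda>x. - g x) = inv\<^bsub>G_group X \<phi>\<^esub> (G_class X \<phi> g)"
    if g: "g \<in> carrier (int_functions X)" for g
    by (rule group.inv_equality[OF G_group_group, symmetric])
      (simp_all add: car g int_functions_uminus G_group_mult one)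
  show ?thesis
  proof (rule int_functions_induct[OF compact f, where P = "\<lambda>f. h (G_class X \<phi> f) = h' (G_class X \<phi> f)"])
    show "h (G_class X \<phi> (\<lambda>_. 0)) = h' (G_class X \<phi> (\<lambda>_. 0))"
      unfolding one[symmetric] by simp
  next
    fix f g assume "f \<in> carrier (int_functions X)" "g \<in> carrier (int_functions X)"
      "h (G_class X \<phi> f) = h' (G_class X \<phi> f)" "h (G_class X \<phi> g) = h' (G_class X \<phi> g)"
    then show "h (G_class X \<phi> (\<lambda>x. f x + g x)) = h' (G_class X \<phi> (\<lambda>x. f x + g x))"
      by (simp add: G_group_mult[symmetric] car)
  next
    fix f assume "f \<in> carrier (int_functions X)" "h (G_class X \<phi> f) = h' (G_class X \<phi> f)"
    then show "h (G_class X \<phi> (\<lambda>x. - f x)) = h' (G_class X \<phi> (\<lambda>x. - f x))"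
      by (simp add: neg car)
  qed (use eq in auto)
qed

end

section \<open>Bounded orbit injections\<close>

text \<open>The value type is general because cocycles, which are vector-valued, are pushed as well
  as integer functions; the default \<open>c\<close> is a parameter since \<open>'k\<close> carries
  no zero.\<close>

definition push :: "'a topology \<Rightarrow> ('a \<Rightarrow> 'b) \<Rightarrow> 'k \<Rightarrow> ('a \<Rightarrow> 'k) \<Rightarrow> 'b \<Rightarrow> 'k" where
  "push X \<theta> c f y = (if y \<in> \<theta> ` topspace X then f (inv_into (topspace X) \<theta> y) else c)"

lemma push_outside [simp]: "y \<notin> \<theta> ` topspace X \<Longrightarrow> push X \<theta> c f y = c"
  by (simp add: push_def)

lemma push_add: "push X \<theta> 0 (\<lambda>x. f x + g x) = (\<lambda>y. push X \<theta> 0 f y + push X \<theta> 0 g y :: int)"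
  and push_uminus: "push X \<theta> 0 (\<lambda>x. - f x) = (\<lambda>y. - push X \<theta> 0 f y :: int)"
  and push_diff: "push X \<theta> 0 (\<lambda>x. f x - g x) = (\<lambda>y. push X \<theta> 0 f y - push X \<theta> 0 g y :: int)"
  and push_zero: "push X \<theta> 0 (\<lambda>_. 0) = (\<lambda>_. 0 :: int)"
  by (auto simp: push_def fun_eq_iff)

locale bounded_injection =
  X: Cantor_Zd_system X \<phi> + Y: Cantor_Zd_system Y \<psi>
  for X :: "'a topology" and \<phi> :: "int ^ 'd \<Rightarrow> 'a \<Rightarrow> 'a"
    and Y :: "'b topology" and \<psi> :: "int ^ 'd \<Rightarrow> 'b \<Rightarrow> 'b" +
  fixes \<theta> :: "'a \<Rightarrow> 'b"
  assumes boi: "bounded_orbit_injection X \<phi> Y \<psi> \<theta>"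
begin

abbreviation "\<eta> \<equiv> cocycle \<phi> \<psi> \<theta>"

lemma cont: "continuous_map X Y \<theta>" and op: "open_map X Y \<theta>" and inj: "inj_on \<theta> (topspace X)"
  and orbits: "\<And>x y. x \<in> topspace X \<Longrightarrow> y \<in> topspace X \<Longrightarrow> (\<exists>w. \<phi> w x = y) \<longleftrightarrow> (\<exists>v. \<psi> v (\<theta> x) = \<theta> y)"
  and cont_cocycle: "continuous_cocycle X \<phi> \<psi> \<theta>"
  using boi unfolding bounded_orbit_injection_def orbit_injection_def by blast+

lemma in_Y [simp]: "x \<in> topspace X \<Longrightarrow> \<theta> x \<in> topspace Y"
  using cont by (auto simp: continuous_map_def)

lemma \<theta>_eq_iff: "x \<in> topspace X \<Longrightarrow> y \<in> topspace X \<Longrightarrow> \<theta> x = \<theta> y \<longleftrightarrow> x = y"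
  using inj by (auto simp: inj_on_def)

text \<open>A solution exists because \<open>\<theta>\<close> respects orbits, and it is unique
  because \<open>\<psi>\<close> is free.\<close>

lemma cocycle_eq_iff:
  assumes "x \<in> topspace X"
  shows "\<eta> x w = u \<longleftrightarrow> \<psi> u (\<theta> x) = \<theta> (\<phi> w x)"
proof -
  obtain v where v: "\<psi> v (\<theta> x) = \<theta> (\<phi> w x)"
    using orbits[of x "\<phi> w x"] assms by auto
  then have "\<eta> x w = v"
    unfolding cocycle_def
  proof (rule the_equality)
    fix u assume "\<psi> u (\<theta> x) = \<theta> (\<phi> w x)"
    with v have "\<psi> u (\<theta> x) = \<psi> v (\<theta> x)" by simp
    then show "u = v" using assms by simp
  qed
  moreover have "\<psi> u (\<theta> x) = \<theta> (\<phi> w x) \<longleftrightarrow> u = v"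
    unfolding v[symmetric] using assms by simp
  ultimately show ?thesis by auto
qed

lemma loc_const_cocycle: "loc_const X (\<lambda>x. \<eta> x w)"
proof -
  have "continuous_map X (prod_topology X (discrete_topology UNIV)) (\<lambda>x. (x, w))"
    by (auto intro: continuous_map_pairedI)
  from continuous_map_compose[OF this cont_cocycle[unfolded continuous_cocycle_def]]
  show ?thesis by (simp add: loc_const_def o_def)
qed

lemma clopen_image:
  assumes "clopen_in X A"
  shows "clopen_in Y (\<theta> ` A)"
proof -
  have "openin Y (\<theta> ` A)" using op assms by (simp add: open_map_def clopen_in_def)
  moreover have "compactin X A"
    using X.compact assms closedin_compact_space by (auto simp: clopen_in_def)
  then have "closedin Y (\<theta> ` A)"
    using image_compactin[OF _ cont] compactin_imp_closedin[OF Y.Hausdorff] by blast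
  ultimately show ?thesis by (simp add: clopen_in_def)
qed

lemma clopen_range: "clopen_in Y (\<theta> ` topspace X)"
  by (rule clopen_image[OF clopen_in_topspace])

lemma push_image [simp]: "x \<in> topspace X \<Longrightarrow> push X \<theta> c f (\<theta> x) = f x"
  by (simp add: push_def inv_into_f_f[OF inj])

lemma push_indicator:
  assumes "A \<subseteq> topspace X"
  shows "push X \<theta> 0 (indicator A) = (indicator (\<theta> ` A) :: 'b \<Rightarrow> int)"
proof
  fix y
  show "push X \<theta> 0 (indicator A) y = (indicator (\<theta> ` A) y :: int)"
  proof (cases "y \<in> \<theta> ` topspace X")
    case True
    then obtain x where "x \<in> topspace X" "y = \<theta> x" by auto
    then show ?thesis using assms \<theta>_eq_iff by (auto simp: indicator_def)
  next
    case False
    then have "y \<notin> \<theta> ` A" using assms by auto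
    then show ?thesis using False by simp
  qed
qed

lemma loc_const_push:
  assumes "loc_const X f"
  shows "loc_const Y (push X \<theta> c f)"
proof (rule loc_const_on_clopen[OF clopen_range])
  fix k
  have "{y \<in> \<theta> ` topspace X. push X \<theta> c f y = k} = \<theta> ` {x \<in> topspace X. f x = k}" by auto
  then show "openin Y {y \<in> \<theta> ` topspace X. push X \<theta> c f y = k}"
    using op assms[unfolded loc_const_iff] by (simp add: open_map_def)
qed simp

lemma push_int_functions:
  assumes "f \<in> carrier (int_functions X)"
  shows "push X \<theta> 0 f \<in> carrier (int_functions Y)"
  using assms loc_const_push by (auto simp: int_functions_carrier push_def)

text \<open>Under \<open>\<theta>\<close> the translation by \<open>v\<close> becomes the
  displacement \<open>\<eta> x v\<close>, which boundedness makes locally constant, so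
  \<open>coboundaries_transport\<close> applies in \<open>Y\<close>.\<close>

lemma push_coboundaries:
  assumes "f \<in> coboundaries X \<phi>"
  shows "push X \<theta> 0 f \<in> coboundaries Y \<psi>"
  using assms
proof (induction rule: X.coboundaries_induct)
  case (generator C v)
  have CX: "C \<subseteq> topspace X" using clopen_in_subset[OF generator] .
  define t where "t = push X \<theta> 0 (\<lambda>x. \<eta> x v)"
  have t: "\<psi> (t (\<theta> x)) (\<theta> x) = \<theta> (\<phi> v x)" if "x \<in> C" for x
    using that CX cocycle_eq_iff[of x v "\<eta> x v"] push_image[of x 0 "\<lambda>x. \<eta> x v"]
    by (auto simp: t_def)
  have "loc_const Y t" unfolding t_def by (rule loc_const_push[OF loc_const_cocycle])
  moreover have "inj_on (\<lambda>y. \<psi> (t y) y) (\<theta> ` C)"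
  proof (rule inj_onI)
    fix y y' assume "y \<in> \<theta> ` C" "y' \<in> \<theta> ` C" "\<psi> (t y) y = \<psi> (t y') y'"
    then obtain x x' where x: "x \<in> C" "x' \<in> C" "y = \<theta> x" "y' = \<theta> x'" "\<theta> (\<phi> v x) = \<theta> (\<phi> v x')"
      using t by auto
    then have "\<phi> v x = \<phi> v x'" using CX \<theta>_eq_iff by (meson X.act_in subsetD)
    then show "y = y'" using x CX X.act_inj by (metis subsetD)
  qed
  moreover have "(\<lambda>y. \<psi> (t y) y) ` \<theta> ` C = \<theta> ` \<phi> v ` C"
    unfolding image_image using t by (intro image_cong) auto
  ultimately have "(\<lambda>y. indicator (\<theta> ` C) y - indicator (\<theta> ` \<phi> v ` C) y) \<in> coboundaries Y \<psi>"
    using Y.coboundaries_transport[OF clopen_image[OF generator], of t] by simp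
  then show ?case
    using CX clopen_in_subset[OF X.clopen_act_image[OF generator]]
    by (simp add: push_diff push_indicator)
qed (simp_all add: push_zero push_uminus push_add Y.coboundaries_zero Y.coboundaries_uminus
    Y.coboundaries_add)

text \<open>Pushing is additive and respects coboundaries, so it descends to the quotients;
  \<open>G_group_hom_eqI\<close> identifies the result with the map described by
  \<open>THE\<close>.\<close>

lemma induced_map:
  shows induced_hom: "induced_map X \<phi> Y \<psi> \<theta> \<in> hom (G_group X \<phi>) (G_group Y \<psi>)"
    and induced_class: "\<And>f. f \<in> carrier (int_functions X) \<Longrightarrow>
      induced_map X \<phi> Y \<psi> \<theta> (G_class X \<phi> f) = G_class Y \<psi> (push X \<theta> 0 f)"
proof -
  let ?G = "carrier (G_group X \<phi>)"
  let ?k = "\<lambda>f. G_class Y \<psi> (push X \<theta> 0 f)"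
  have k: "?k \<in> hom (int_functions X) (G_group Y \<psi>)"
    by (rule homI) (simp_all add: Y.G_group_carrier push_int_functions push_add Y.G_group_mult)
  have wd: "?k f = ?k g" if "G_class X \<phi> f = G_class X \<phi> g" for f g
    using push_coboundaries[of "\<lambda>x. f x - g x"] that
    by (simp add: X.G_class_eq_iff Y.G_class_eq_iff push_diff)
  obtain h where h: "h \<in> hom (G_group X \<phi>) (G_group Y \<psi>)"
    "\<And>f. f \<in> carrier (int_functions X) \<Longrightarrow> h (G_class X \<phi> f) = ?k f"
    using FactGroup_universal[OF k X.coboundaries_normal] wd
    unfolding G_class_def G_group_def by metis
  define H where "H = restrict h ?G"
  have H: "H \<in> hom (G_group X \<phi>) (G_group Y \<psi>)" "H \<in> extensional ?G"
    "\<And>f. f \<in> carrier (int_functions X) \<Longrightarrow> H (G_class X \<phi> f) = ?k f"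
  proof -
    have "G_class X \<phi> f \<in> ?G" if "f \<in> carrier (int_functions X)" for f
      using that by (simp add: X.G_group_carrier)
    then show "\<And>f. f \<in> carrier (int_functions X) \<Longrightarrow> H (G_class X \<phi> f) = ?k f"
      using h(2) by (simp add: H_def)
    have "x \<otimes>\<^bsub>G_group X \<phi>\<^esub> y \<in> ?G" if "x \<in> ?G" "y \<in> ?G" for x y
      using that group.subgroup_self[OF X.G_group_group] by (simp add: subgroup.m_closed)
    then show "H \<in> hom (G_group X \<phi>) (G_group Y \<psi>)"
      using h(1) by (auto simp: hom_def H_def)
  qed (simp add: H_def)
  have Hind: "H (G_class X \<phi> (indicator A)) = G_class Y \<psi> (indicator (\<theta> ` A))" if "clopen_in X A" for A
    using H(3)[OF indicator_int_functions[OF that]] push_indicator[OF clopen_in_subset[OF that]] by simp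
  have "induced_map X \<phi> Y \<psi> \<theta> = H"
    unfolding induced_map_def
  proof (rule the_equality)
    show "H \<in> hom (G_group X \<phi>) (G_group Y \<psi>) \<and> H \<in> extensional ?G \<and>
      (\<forall>A. clopen_in X A \<longrightarrow> H (G_class X \<phi> (indicator A)) = G_class Y \<psi> (indicator (\<theta> ` A)))"
      using H Hind by blast
  next
    fix h' assume h': "h' \<in> hom (G_group X \<phi>) (G_group Y \<psi>) \<and> h' \<in> extensional ?G \<and>
      (\<forall>A. clopen_in X A \<longrightarrow> h' (G_class X \<phi> (indicator A)) = G_class Y \<psi> (indicator (\<theta> ` A)))"
    show "h' = H"
    proof (rule extensionalityI[of _ ?G])
      fix x assume "x \<in> ?G"
      then obtain f where f: "f \<in> carrier (int_functions X)" "x = G_class X \<phi> f"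
        by (auto simp: X.G_group_carrier)
      have "h' (G_class X \<phi> f) = H (G_class X \<phi> f)"
        by (rule X.G_group_hom_eqI[OF Y.G_group_group _ H(1) _ f(1)]) (use h' Hind in auto)
      then show "h' x = H x" using f(2) by simp
    qed (use h' H in auto)
  qed
  then show "induced_map X \<phi> Y \<psi> \<theta> \<in> hom (G_group X \<phi>) (G_group Y \<psi>)"
    "\<And>f. f \<in> carrier (int_functions X) \<Longrightarrow>
      induced_map X \<phi> Y \<psi> \<theta> (G_class X \<phi> f) = ?k f"
    using H by auto
qed

text \<open>A locally constant displacement \<open>m\<close> retracts \<open>Y\<close> onto the range of \<open>\<theta>\<close>. Summing over the fibres
  of this retraction gives a left inverse of \<^const>\<open>push\<close> that preserves coboundaries.\<close>

lemma push_coboundaries_iff: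
  assumes "f \<in> carrier (int_functions X)"
  shows "push X \<theta> 0 f \<in> coboundaries Y \<psi> \<longleftrightarrow> f \<in> coboundaries X \<phi>"
proof
  assume pf: "push X \<theta> 0 f \<in> coboundaries Y \<psi>"
  let ?B = "\<theta> ` topspace X"
  have neB: "?B \<noteq> {}" using X.nonempty by simp
  obtain F where F: "finite F" "\<And>y. y \<in> topspace Y \<Longrightarrow> \<exists>v\<in>F. \<psi> v y \<in> ?B"
    using Y.syndetic[of ?B] clopen_range neB unfolding clopen_in_def by blast
  \<comment> \<open>The value 0 on the range makes the retraction fix it pointwise. Elsewhere the
    choice depends only on the set of usable vectors of \<open>F\<close>.\<close>
  define m where "m y = (if y \<in> ?B then 0 else SOME v. v \<in> {v \<in> F. \<psi> v y \<in> ?B})" for y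
  have mB: "\<psi> (m y) y \<in> ?B" if "y \<in> topspace Y" for y
  proof (cases "y \<in> ?B")
    case True
    then show ?thesis using that by (auto simp: m_def)
  next
    case False
    have "\<exists>v. v \<in> {v \<in> F. \<psi> v y \<in> ?B}" using F(2)[OF that] by blast
    from someI_ex[OF this] show ?thesis using False by (simp add: m_def)
  qed
  have "loc_const Y (\<lambda>y. {v \<in> F. \<psi> v y \<in> ?B})"
    by (rule loc_const_Collect[OF F(1)]) (rule Y.loc_const_act[OF loc_const_mem[OF clopen_range]])
  from loc_const_compose[OF this, of "\<lambda>S. SOME v. v \<in> S"]
  have lm: "loc_const Y m"
    unfolding m_def[abs_def]
    by (intro loc_const_If loc_const_mem[OF clopen_range] loc_const_const) simp
  define M where "M = m ` topspace Y"
  have finM: "finite M" unfolding M_def by (rule loc_const_finite_range[OF Y.compact lm])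
  \<comment> \<open>A point \<open>y\<close> retracts to \<open>\<theta> x\<close> by the vector
    \<open>v\<close> exactly when \<open>y = \<psi> (- v) (\<theta> x)\<close> and
    \<open>m y = v\<close>; the sum therefore runs over the fibre above
    \<open>\<theta> x\<close>.\<close>
  define r :: "('b \<Rightarrow> int) \<Rightarrow> 'a \<Rightarrow> int" where
    "r g x = (if x \<in> topspace X then
       (\<Sum>v\<in>M. if m (\<psi> (- v) (\<theta> x)) = v then g (\<psi> (- v) (\<theta> x)) else 0) else 0)" for g x
  have radd: "r (\<lambda>y. g y + h y) = (\<lambda>x. r g x + r h x)" for g h
    by (auto simp: r_def fun_eq_iff sum.distrib[symmetric] intro!: sum.cong)
  have rminus: "r (\<lambda>y. - g y) = (\<lambda>x. - r g x)" for g
    by (auto simp: r_def fun_eq_iff sum_negf[symmetric] intro!: sum.cong)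
  have rzero: "r (\<lambda>_. 0) = (\<lambda>_. 0)" by (auto simp: r_def fun_eq_iff)
  have rsum: "r (\<lambda>y. \<Sum>i\<in>I. g i y) = (\<lambda>x. \<Sum>i\<in>I. r (g i) x)" if "finite I" for I :: "'i set" and g
    using that by (induction I rule: finite_induct) (simp_all add: rzero radd)
  have rdiff: "r (\<lambda>y. g y - h y) = (\<lambda>x. r g x - r h x)" for g h
    using radd[of g "\<lambda>y. - h y"] rminus[of h] by simp
  \<comment> \<open>The fibre above \<open>\<theta> x\<close> meets the range only in
    \<open>\<theta> x\<close>, and the pushed function vanishes off the range.\<close>
  have rpush: "r (push X \<theta> 0 f) = f"
  proof
    fix x
    show "r (push X \<theta> 0 f) x = f x"
    proof (cases "x \<in> topspace X")
      case True
      have 0: "0 \<in> M" using True unfolding M_def by (intro image_eqI[of _ _ "\<theta> x"]) (auto simp: m_def)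
      have "r (push X \<theta> 0 f) x = (\<Sum>v\<in>M. if v = 0 then f x else 0)"
      proof -
        have "(if m (\<psi> (- v) (\<theta> x)) = v then push X \<theta> 0 f (\<psi> (- v) (\<theta> x)) else 0) = (if v = 0 then f x else 0)"
          for v
        proof (cases "v = 0")
          case True
          then show ?thesis using \<open>x \<in> topspace X\<close> by (simp add: m_def)
        next
          case False
          then show ?thesis by (cases "\<psi> (- v) (\<theta> x) \<in> ?B") (simp_all add: m_def)
        qed
        then show ?thesis using True by (simp add: r_def)
      qed
      then show ?thesis using 0 finM by simp
    next
      case False
      then show ?thesis using assms by (simp add: r_def int_functions_carrier)
    qed
  qed
  have rind: "r (indicator E) = indicator {x \<in> topspace X. \<theta> x \<in> \<psi> a ` E}"
    if E: "E \<subseteq> topspace Y" "\<And>y. y \<in> E \<Longrightarrow> m y = a" "a \<in> M" for E a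
  proof
    fix x
    show "r (indicator E) x = indicator {x \<in> topspace X. \<theta> x \<in> \<psi> a ` E} x"
    proof (cases "x \<in> topspace X")
      case True
      have iff: "\<theta> x \<in> \<psi> a ` E \<longleftrightarrow> \<psi> (- a) (\<theta> x) \<in> E"
        by (rule Y.act_image_iff[OF E(1) in_Y[OF True]])
      have "r (indicator E) x = (\<Sum>v\<in>M. if v = a then indicator E (\<psi> (- a) (\<theta> x)) else 0)"
        using True E(2) by (auto simp: r_def indicator_def intro!: sum.cong)
      then show ?thesis using E(3) finM True iff by (simp add: indicator_def)
    qed (simp add: r_def)
  qed
  have rgen: "r (\<lambda>y. indicator E y - indicator (\<psi> v ` E) y) \<in> coboundaries X \<phi>"
    if E: "clopen_in Y E" and a: "\<And>y. y \<in> E \<Longrightarrow> m y = a" "a \<in> M"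
      and b: "\<And>y. y \<in> E \<Longrightarrow> m (\<psi> v y) = b" "b \<in> M" for E v a b
  proof -
    have EY: "E \<subseteq> topspace Y" using clopen_in_subset[OF E] .
    define u where "u = b + v - a"
    define D where "D = {x \<in> topspace X. \<theta> x \<in> \<psi> a ` E}"
    define D' where "D' = {x \<in> topspace X. \<theta> x \<in> \<psi> b ` \<psi> v ` E}"
    have clD: "clopen_in X D"
    proof -
      have cl: "clopen_in Y (\<psi> a ` E)" by (rule Y.clopen_act_image[OF E])
      show ?thesis
        unfolding D_def clopen_in_def
        using openin_continuous_map_preimage[OF cont] closedin_continuous_map_preimage[OF cont] cl
        by (simp add: clopen_in_def)
    qed
    have aB: "\<psi> a y \<in> ?B" and bB: "\<psi> (b + v) y \<in> ?B" if "y \<in> E" for y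
      using mB[of y] mB[of "\<psi> v y"] a(1)[OF that] b(1)[OF that] that EY by auto
    \<comment> \<open>The displacement in \<open>X\<close> that \<open>\<theta>\<close> turns into
      \<open>u\<close>. Its level sets on \<open>D\<close> are those of
      \<open>\<eta> x w = u\<close>, so continuity of the cocycle makes it locally constant.\<close>
    define k where "k x = (if x \<in> D then THE w. \<eta> x w = u else 0)" for x
    have ex: "\<exists>x'\<in>D'. \<theta> x' = \<psi> u (\<theta> x)" if x: "x \<in> D" for x
    proof -
      obtain y where y: "y \<in> E" "\<theta> x = \<psi> a y" using x by (auto simp: D_def)
      have "\<psi> u (\<theta> x) = \<psi> (b + v) y" using y EY by (auto simp: u_def)
      moreover obtain x' where "x' \<in> topspace X" "\<theta> x' = \<psi> (b + v) y" using bB[OF y(1)] by auto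
      moreover have "\<psi> (b + v) y = \<psi> b (\<psi> v y)" using y EY by auto
      ultimately show ?thesis using y(1) by (intro bexI[of _ x']) (auto simp: D'_def)
    qed
    have k_iff: "k x = w \<longleftrightarrow> \<eta> x w = u" if x: "x \<in> D" for x w
    proof -
      have xX: "x \<in> topspace X" using x by (simp add: D_def)
      obtain x' where x': "x' \<in> D'" "\<theta> x' = \<psi> u (\<theta> x)" using ex[OF x] by auto
      then obtain w0 where w0: "\<phi> w0 x = x'" using orbits[OF xX, of x'] by (auto simp: D'_def)
      have uniq: "\<eta> x w = u \<longleftrightarrow> w = w0" for w
        using cocycle_eq_iff[OF xX, of w u] x'(2) xX
        unfolding w0[symmetric] by (auto simp: \<theta>_eq_iff)
      then have "k x = w0" using x by (simp add: k_def)
      then show ?thesis using uniq by auto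
    qed
    have \<theta>k: "\<theta> (\<phi> (k x) x) = \<psi> u (\<theta> x)" if "x \<in> D" for x
      using k_iff[OF that, of "k x"] cocycle_eq_iff[of x "k x" u] that by (simp add: D_def)
    have lk: "loc_const X k"
    proof (rule loc_const_on_clopen[OF clD])
      fix w
      have "{x \<in> D. k x = w} = {x \<in> D. \<eta> x w = u}" using k_iff by auto
      then show "openin X {x \<in> D. k x = w}"
        using clopen_in_restrict[OF clD loc_const_compose[OF loc_const_cocycle[of w], of "\<lambda>z. z = u"]]
        by (simp add: clopen_in_def)
    qed (simp add: k_def)
    have DX: "D \<subseteq> topspace X" "D' \<subseteq> topspace X" by (auto simp: D_def D'_def)
    have injk: "inj_on (\<lambda>x. \<phi> (k x) x) D"
    proof (rule inj_onI)
      fix x x' assume x: "x \<in> D" "x' \<in> D" "\<phi> (k x) x = \<phi> (k x') x'"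
      then have "\<psi> u (\<theta> x) = \<psi> u (\<theta> x')" using \<theta>k by metis
      then have "\<theta> x = \<theta> x'" using x DX Y.act_inj in_Y by (meson subsetD)
      then show "x = x'" using x DX \<theta>_eq_iff by (meson subsetD)
    qed
    have im: "(\<lambda>x. \<phi> (k x) x) ` D = D'"
    proof (intro equalityI subsetI)
      fix x' assume "x' \<in> (\<lambda>x. \<phi> (k x) x) ` D"
      then obtain x where x: "x \<in> D" "x' = \<phi> (k x) x" by auto
      obtain x'' where "x'' \<in> D'" "\<theta> x'' = \<theta> x'" using ex[OF x(1)] \<theta>k[OF x(1)] x(2) by auto
      moreover have "x' \<in> topspace X" using x DX by auto
      ultimately show "x' \<in> D'" using DX \<theta>_eq_iff by (metis subsetD)
    next
      fix x' assume x': "x' \<in> D'"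
      then obtain y where y: "y \<in> E" "\<theta> x' = \<psi> b (\<psi> v y)" by (auto simp: D'_def)
      obtain x where x: "x \<in> topspace X" "\<theta> x = \<psi> a y" using aB[OF y(1)] by auto
      have xD: "x \<in> D" using x y by (auto simp: D_def)
      have "\<theta> (\<phi> (k x) x) = \<theta> x'" unfolding \<theta>k[OF xD] x(2) y(2) u_def using y(1) EY by auto
      then have "x' = \<phi> (k x) x" using x(1) x' DX \<theta>_eq_iff by (metis X.act_in subsetD)
      then show "x' \<in> (\<lambda>x. \<phi> (k x) x) ` D" using xD by blast
    qed
    have "r (indicator (\<psi> v ` E)) = indicator D'"
      unfolding D'_def by (rule rind) (use b clopen_in_subset[OF Y.clopen_act_image[OF E]] in auto)
    then have "r (\<lambda>y. indicator E y - indicator (\<psi> v ` E) y) = (\<lambda>x. indicator D x - indicator D' x)"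
      unfolding rdiff D_def using rind[OF EY a] by simp
    then show ?thesis using X.coboundaries_transport[OF clD lk injk] im by simp
  qed
  have rcob: "r g \<in> coboundaries X \<phi>" if "g \<in> coboundaries Y \<psi>" for g
    using that
  proof (induction rule: Y.coboundaries_induct)
    case (generator C v)
    have CY: "C \<subseteq> topspace Y" using clopen_in_subset[OF generator] .
    \<comment> \<open>A general generator is cut by the retraction vectors of source and target, so
      that \<open>rgen\<close> applies to each piece.\<close>
    let ?E = "\<lambda>p. {y \<in> C. (m y, m (\<psi> v y)) = p}"
    have E: "clopen_in Y (?E p)" for p
      by (rule clopen_in_restrict[OF generator
            loc_const_compose[OF loc_const_Pair[OF lm Y.loc_const_act[OF lm]]]])
    have fin: "finite (M \<times> M)" using finM by simp
    have CE: "C = (\<Union>p\<in>M \<times> M. ?E p)" using CY by (auto simp: M_def)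
    have 1: "indicator C y = (\<Sum>p\<in>M \<times> M. indicator (?E p) y :: int)" for y
    proof -
      have "disjoint_family_on ?E (M \<times> M)" by (auto simp: disjoint_family_on_def)
      then show ?thesis by (subst CE) (rule indicator_UN_disjoint[OF fin])
    qed
    have 2: "indicator (\<psi> v ` C) y = (\<Sum>p\<in>M \<times> M. indicator (\<psi> v ` ?E p) y :: int)" for y
    proof -
      have "disjoint_family_on (\<lambda>p. \<psi> v ` ?E p) (M \<times> M)"
        unfolding disjoint_family_on_def
      proof (intro ballI impI)
        fix p q :: "(int ^ 'd) \<times> (int ^ 'd)" assume "p \<noteq> q"
        have False if "y \<in> ?E p" "z \<in> ?E q" "\<psi> v y = \<psi> v z" for y z
          using Y.act_inj[of y z v] that CY \<open>p \<noteq> q\<close> by auto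
        then show "\<psi> v ` ?E p \<inter> \<psi> v ` ?E q = {}" by blast
      qed
      moreover have "\<psi> v ` C = (\<Union>p\<in>M \<times> M. \<psi> v ` ?E p)" by (subst CE) blast
      ultimately show ?thesis using indicator_UN_disjoint[OF fin, of "\<lambda>p. \<psi> v ` ?E p" y] by simp
    qed
    have "(\<lambda>y. indicator C y - indicator (\<psi> v ` C) y :: int) =
        (\<lambda>y. \<Sum>p\<in>M \<times> M. indicator (?E p) y - indicator (\<psi> v ` ?E p) y)"
      unfolding 1 2 sum_subtractf ..
    then have "r (\<lambda>y. indicator C y - indicator (\<psi> v ` C) y) =
        (\<lambda>x. \<Sum>p\<in>M \<times> M. r (\<lambda>y. indicator (?E p) y - indicator (\<psi> v ` ?E p) y) x)"
      using rsum[OF fin] by simp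
    moreover have "(\<lambda>x. \<Sum>p\<in>M \<times> M. r (\<lambda>y. indicator (?E p) y - indicator (\<psi> v ` ?E p) y) x)
        \<in> coboundaries X \<phi>"
    proof (rule X.coboundaries_sum)
      fix p assume p: "p \<in> M \<times> M"
      show "r (\<lambda>y. indicator (?E p) y - indicator (\<psi> v ` ?E p) y) \<in> coboundaries X \<phi>"
        by (rule rgen[OF E, of _ "fst p" _ "snd p"]) (use p in auto)
    qed
    ultimately show ?case by simp
  qed (simp_all add: rzero rminus radd X.coboundaries_zero X.coboundaries_uminus X.coboundaries_add)
  show "f \<in> coboundaries X \<phi>" using rcob[OF pf] rpush by simp
qed (rule push_coboundaries)

text \<open>Makes \<open>inv_into\<close> a genuine left inverse in the formula for
  \<open>h_\<theta>\<close>.\<close>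

lemma induced_inj: "inj_on (induced_map X \<phi> Y \<psi> \<theta>) (carrier (G_group X \<phi>))"
proof (rule inj_onI)
  fix a b assume ab: "a \<in> carrier (G_group X \<phi>)" "b \<in> carrier (G_group X \<phi>)"
    "induced_map X \<phi> Y \<psi> \<theta> a = induced_map X \<phi> Y \<psi> \<theta> b"
  then obtain f g where fg: "f \<in> carrier (int_functions X)" "g \<in> carrier (int_functions X)"
    "a = G_class X \<phi> f" "b = G_class X \<phi> g"
    by (auto simp: X.G_group_carrier)
  then have "push X \<theta> 0 (\<lambda>x. f x - g x) \<in> coboundaries Y \<psi>"
    using ab(3) by (simp add: induced_class Y.G_class_eq_iff push_diff)
  then show "a = b"
    using fg by (simp add: push_coboundaries_iff int_functions_diff X.G_class_eq_iff)
qed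

end

section \<open>Bounded orbit equivalences\<close>

lemma (in Cantor_Zd_system) openin_move:
  assumes "loc_const X n" "openin X V"
  shows "openin X {x \<in> topspace X. \<phi> (n x) x \<in> V}"
proof -
  have "{x \<in> topspace X. \<phi> (n x) x \<in> V} =
      (\<Union>v. {x \<in> topspace X. n x = v} \<inter> {x \<in> topspace X. \<phi> v x \<in> V})" by auto
  moreover have "openin X ({x \<in> topspace X. n x = v} \<inter> {x \<in> topspace X. \<phi> v x \<in> V})" for v
    using assms act_continuous[of v] unfolding loc_const_iff
    by (intro openin_Int openin_continuous_map_preimage) auto
  ultimately show ?thesis by auto
qed

lemma (in bounded_injection) loc_const_preimage: "loc_const Y f \<Longrightarrow> loc_const X (\<lambda>x. f (\<theta> x))"
  using continuous_map_compose[OF cont, of "discrete_topology UNIV" f]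
  by (simp add: loc_const_def o_def)

lemma bounded_orbit_equivalence_imp_injection:
  fixes X :: "'a topology" and \<phi> :: "int ^ 'd \<Rightarrow> 'a \<Rightarrow> 'a"
    and Y :: "'b topology" and \<psi> :: "int ^ 'd \<Rightarrow> 'b \<Rightarrow> 'b"
  assumes X: "Cantor_Zd_system X \<phi>" and boe: "bounded_orbit_equivalence X \<phi> Y \<psi> \<theta>"
  shows "bounded_orbit_injection X \<phi> Y \<psi> \<theta>"
proof -
  interpret X: Cantor_Zd_system X \<phi> by (rule X)
  have hom: "homeomorphic_map X Y \<theta>"
    and orb: "\<And>x. x \<in> topspace X \<Longrightarrow> \<theta> ` orbit \<phi> x = orbit \<psi> (\<theta> x)"
    and cc: "continuous_cocycle X \<phi> \<psi> \<theta>"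
    using boe by (auto simp: bounded_orbit_equivalence_def)
  have inj: "inj_on \<theta> (topspace X)" using hom by (simp add: homeomorphic_imp_injective_map)
  have "(\<exists>w. \<phi> w x = y) \<longleftrightarrow> (\<exists>v. \<psi> v (\<theta> x) = \<theta> y)"
    if xy: "x \<in> topspace X" "y \<in> topspace X" for x y
  proof
    assume "\<exists>w. \<phi> w x = y"
    then have "\<theta> y \<in> \<theta> ` orbit \<phi> x" by (auto simp: orbit_def)
    then have "\<theta> y \<in> orbit \<psi> (\<theta> x)" using orb[OF xy(1)] by simp
    then show "\<exists>v. \<psi> v (\<theta> x) = \<theta> y" by (auto simp: orbit_def)
  next
    assume "\<exists>v. \<psi> v (\<theta> x) = \<theta> y"
    then have "\<theta> y \<in> orbit \<psi> (\<theta> x)" unfolding orbit_def by (metis rangeI)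
    then have "\<theta> y \<in> \<theta> ` orbit \<phi> x" using orb[OF xy(1)] by simp
    then obtain w where "\<theta> y = \<theta> (\<phi> w x)" by (auto simp: orbit_def)
    then have "y = \<phi> w x" using inj xy by (auto simp: inj_on_def)
    then show "\<exists>w. \<phi> w x = y" by blast
  qed
  then show ?thesis
    using hom cc inj
    by (simp add: bounded_orbit_injection_def orbit_injection_def
        homeomorphic_imp_continuous_map homeomorphic_imp_open_map)
qed

text \<open>For a homeomorphism, composition with \<open>\<theta>\<close> inverts
  \<open>push\<close>, and both operations preserve nonnegative functions.\<close>

lemma (in bounded_injection) induced_ordered_group_iso:
  assumes hom: "homeomorphic_map X Y \<theta>"
  shows "ordered_group_iso X \<phi> Y \<psi> (induced_map X \<phi> Y \<psi> \<theta>)"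
proof -
  let ?h = "induced_map X \<phi> Y \<psi> \<theta>"
  have surj: "\<theta> ` topspace X = topspace Y" using hom by (simp add: homeomorphic_imp_surjective_map)
  have lift: "\<exists>f\<in>carrier (int_functions X). push X \<theta> 0 f = g \<and> (\<forall>x\<in>topspace X. f x = g (\<theta> x))"
    if g: "g \<in> carrier (int_functions Y)" for g
  proof -
    define f where "f x = (if x \<in> topspace X then g (\<theta> x) else 0)" for x
    have "loc_const X f"
      using loc_const_cong[of X f "\<lambda>x. g (\<theta> x)"] loc_const_preimage[of g] g
      by (simp add: f_def int_functions_carrier)
    then have "f \<in> carrier (int_functions X)" by (simp add: int_functions_carrier f_def)
    moreover have "push X \<theta> 0 f = g"
    proof
      fix y
      show "push X \<theta> 0 f y = g y"
      proof (cases "y \<in> \<theta> ` topspace X")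
        case True
        then show ?thesis by (auto simp: f_def)
      next
        case False
        then show ?thesis using g surj by (simp add: int_functions_carrier)
      qed
    qed
    ultimately show ?thesis by (intro bexI[of _ f]) (simp_all add: f_def)
  qed
  have "?h ` carrier (G_group X \<phi>) = carrier (G_group Y \<psi>)"
  proof (intro equalityI subsetI)
    fix b assume "b \<in> ?h ` carrier (G_group X \<phi>)"
    then show "b \<in> carrier (G_group Y \<psi>)" using induced_hom by (auto simp: hom_def)
  next
    fix b assume "b \<in> carrier (G_group Y \<psi>)"
    then obtain g where g: "g \<in> carrier (int_functions Y)" "b = G_class Y \<psi> g"
      by (auto simp: Y.G_group_carrier)
    then obtain f where "f \<in> carrier (int_functions X)" "push X \<theta> 0 f = g" using lift by blast
    then show "b \<in> ?h ` carrier (G_group X \<phi>)"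
      using g(2) by (auto simp: X.G_group_carrier induced_class image_image intro!: image_eqI)
  qed
  moreover have "?h ` G_pos X \<phi> = G_pos Y \<psi>"
  proof (intro equalityI subsetI)
    fix b assume "b \<in> ?h ` G_pos X \<phi>"
    then obtain f where f: "f \<in> carrier (int_functions X)" "\<forall>x\<in>topspace X. 0 \<le> f x"
      "b = ?h (G_class X \<phi> f)" by (auto simp: G_pos_def)
    moreover have "\<forall>y\<in>topspace Y. 0 \<le> push X \<theta> 0 f y"
      unfolding surj[symmetric] using f(2) by auto
    ultimately show "b \<in> G_pos Y \<psi>"
      using push_int_functions[OF f(1)] by (auto simp: G_pos_def induced_class)
  next
    fix b assume "b \<in> G_pos Y \<psi>"
    then obtain g where g: "g \<in> carrier (int_functions Y)" "\<forall>y\<in>topspace Y. 0 \<le> g y"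
      "b = G_class Y \<psi> g" by (auto simp: G_pos_def)
    obtain f where f: "f \<in> carrier (int_functions X)" "push X \<theta> 0 f = g"
      "\<forall>x\<in>topspace X. f x = g (\<theta> x)" using lift[OF g(1)] by blast
    have "\<forall>x\<in>topspace X. 0 \<le> f x" using f(3) g(2) by simp
    then have "G_class X \<phi> f \<in> G_pos X \<phi>" using f(1) unfolding G_pos_def by blast
    moreover have "b = ?h (G_class X \<phi> f)" using f g(3) by (simp add: induced_class)
    ultimately show "b \<in> ?h ` G_pos X \<phi>" by blast
  qed
  ultimately show ?thesis
    using induced_hom induced_inj by (simp add: ordered_group_iso_def iso_def bij_betw_def)
qed

section \<open>From a locally constant displacement to an orbit equivalence\<close>

locale common_extension =
  \<theta>1: bounded_injection X \<phi> Z \<alpha> \<theta>\<^sub>1 + \<theta>2: bounded_injection Y \<psi> Z \<alpha> \<theta>\<^sub>2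
  for X :: "'a topology" and \<phi> :: "int ^ 'd \<Rightarrow> 'a \<Rightarrow> 'a"
    and Y :: "'b topology" and \<psi> :: "int ^ 'd \<Rightarrow> 'b \<Rightarrow> 'b"
    and Z :: "'c topology" and \<alpha> :: "int ^ 'd \<Rightarrow> 'c \<Rightarrow> 'c"
    and \<theta>\<^sub>1 :: "'a \<Rightarrow> 'c" and \<theta>\<^sub>2 :: "'b \<Rightarrow> 'c" +
  fixes D :: "'c \<Rightarrow> int ^ 'd"
  assumes D: "loc_const Z D"
    and bij: "bij_betw (\<lambda>z. \<alpha> (D z) z) (\<theta>\<^sub>1 ` topspace X) (\<theta>\<^sub>2 ` topspace Y)"
begin

definition eqv :: "'a \<Rightarrow> 'b" where
  "eqv x = inv_into (topspace Y) \<theta>\<^sub>2 (\<alpha> (D (\<theta>\<^sub>1 x)) (\<theta>\<^sub>1 x))"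

lemma eqv:
  assumes "x \<in> topspace X"
  shows "eqv x \<in> topspace Y" "\<theta>\<^sub>2 (eqv x) = \<alpha> (D (\<theta>\<^sub>1 x)) (\<theta>\<^sub>1 x)"
proof -
  have "\<alpha> (D (\<theta>\<^sub>1 x)) (\<theta>\<^sub>1 x) \<in> \<theta>\<^sub>2 ` topspace Y"
    using bij_betw_apply[OF bij] assms by blast
  then show "eqv x \<in> topspace Y" "\<theta>\<^sub>2 (eqv x) = \<alpha> (D (\<theta>\<^sub>1 x)) (\<theta>\<^sub>1 x)"
    unfolding eqv_def by (rule inv_into_into, rule f_inv_into_f)
qed

lemma eqv_inj: "inj_on eqv (topspace X)"
proof (rule inj_onI)
  fix x y assume xy: "x \<in> topspace X" "y \<in> topspace X" "eqv x = eqv y"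
  then have "\<alpha> (D (\<theta>\<^sub>1 x)) (\<theta>\<^sub>1 x) = \<alpha> (D (\<theta>\<^sub>1 y)) (\<theta>\<^sub>1 y)" using eqv(2) by metis
  then have "\<theta>\<^sub>1 x = \<theta>\<^sub>1 y"
    using bij xy unfolding bij_betw_def by (auto dest: inj_onD)
  then show "x = y" using \<theta>1.\<theta>_eq_iff xy by blast
qed

lemma eqv_surj: "eqv ` topspace X = topspace Y"
proof (intro equalityI subsetI)
  fix y assume y: "y \<in> topspace Y"
  then have "\<theta>\<^sub>2 y \<in> (\<lambda>z. \<alpha> (D z) z) ` \<theta>\<^sub>1 ` topspace X"
    using bij by (simp add: bij_betw_def)
  then obtain x where x: "x \<in> topspace X" "\<theta>\<^sub>2 y = \<alpha> (D (\<theta>\<^sub>1 x)) (\<theta>\<^sub>1 x)" by auto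
  then have "\<theta>\<^sub>2 (eqv x) = \<theta>\<^sub>2 y" using eqv(2) by simp
  then have "eqv x = y" using \<theta>2.\<theta>_eq_iff eqv(1)[OF x(1)] y by blast
  then show "y \<in> eqv ` topspace X" using x(1) by blast
qed (use eqv in auto)

text \<open>A continuous bijection from a compact space to a Hausdorff space; openness of
  \<open>\<theta>\<^sub>2\<close> reduces preimages under \<open>eqv\<close> to preimages under the
  displacement on \<open>Z\<close>.\<close>

lemma eqv_homeomorphic: "homeomorphic_map X Y eqv"
proof -
  have "openin X {x \<in> topspace X. eqv x \<in> V}" if V: "openin Y V" for V
  proof -
    have VY: "V \<subseteq> topspace Y" using V openin_subset by blast
    have mem: "eqv x \<in> V \<longleftrightarrow> \<theta>\<^sub>2 (eqv x) \<in> \<theta>\<^sub>2 ` V" if "x \<in> topspace X" for x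
      using inj_on_image_mem_iff[OF \<theta>2.inj eqv(1)[OF that] VY] by simp
    have "openin Z {z \<in> topspace Z. \<alpha> (D z) z \<in> \<theta>\<^sub>2 ` V}"
      using \<theta>2.op V by (intro \<theta>1.Y.openin_move[OF D]) (simp add: open_map_def)
    from openin_continuous_map_preimage[OF \<theta>1.cont this]
    have "openin X {x \<in> topspace X. \<alpha> (D (\<theta>\<^sub>1 x)) (\<theta>\<^sub>1 x) \<in> \<theta>\<^sub>2 ` V}"
      by (rule back_subst[of "openin X"]) auto
    moreover have "{x \<in> topspace X. eqv x \<in> V} =
        {x \<in> topspace X. \<alpha> (D (\<theta>\<^sub>1 x)) (\<theta>\<^sub>1 x) \<in> \<theta>\<^sub>2 ` V}"
      using mem eqv(2) by auto
    ultimately show ?thesis by simp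
  qed
  then have "continuous_map X Y eqv"
    using eqv(1) by (auto simp: continuous_map_def)
  then show ?thesis
    using continuous_imp_homeomorphic_map[OF _ \<theta>1.X.compact \<theta>2.X.Hausdorff eqv_surj eqv_inj] by blast
qed

text \<open>The displacement keeps each point on its \<open>\<alpha>\<close>-orbit, so the orbit
  conditions of the two injections can be joined.\<close>

lemma eqv_orbits:
  assumes "x \<in> topspace X" "y \<in> topspace X"
  shows "(\<exists>w. \<phi> w x = y) \<longleftrightarrow> (\<exists>v. \<psi> v (eqv x) = eqv y)"
proof -
  have Z: "\<theta>\<^sub>1 x \<in> topspace Z" "\<theta>\<^sub>1 y \<in> topspace Z" using assms by auto
  have "(\<exists>w. \<phi> w x = y) \<longleftrightarrow> (\<exists>v. \<alpha> v (\<theta>\<^sub>1 x) = \<theta>\<^sub>1 y)"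
    by (rule \<theta>1.orbits[OF assms])
  also have "\<dots> \<longleftrightarrow> (\<exists>v. \<alpha> v (\<theta>\<^sub>2 (eqv x)) = \<theta>\<^sub>2 (eqv y))"
  proof
    assume "\<exists>v. \<alpha> v (\<theta>\<^sub>1 x) = \<theta>\<^sub>1 y"
    then obtain v where v: "\<alpha> v (\<theta>\<^sub>1 x) = \<theta>\<^sub>1 y" by blast
    have "\<alpha> (d + v - e) (\<alpha> e (\<theta>\<^sub>1 x)) = \<alpha> d (\<alpha> v (\<theta>\<^sub>1 x))" for d e
      using Z by simp
    then have "\<alpha> (D (\<theta>\<^sub>1 y) + v - D (\<theta>\<^sub>1 x)) (\<theta>\<^sub>2 (eqv x)) = \<theta>\<^sub>2 (eqv y)"
      unfolding eqv(2)[OF assms(1)] eqv(2)[OF assms(2)] v by blast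
    then show "\<exists>v. \<alpha> v (\<theta>\<^sub>2 (eqv x)) = \<theta>\<^sub>2 (eqv y)" by blast
  next
    assume "\<exists>v. \<alpha> v (\<theta>\<^sub>2 (eqv x)) = \<theta>\<^sub>2 (eqv y)"
    then obtain v where "\<alpha> v (\<alpha> (D (\<theta>\<^sub>1 x)) (\<theta>\<^sub>1 x)) = \<alpha> (D (\<theta>\<^sub>1 y)) (\<theta>\<^sub>1 y)"
      unfolding eqv(2)[OF assms(1)] eqv(2)[OF assms(2)] by blast
    then have "\<alpha> (- D (\<theta>\<^sub>1 y)) (\<alpha> (v + D (\<theta>\<^sub>1 x)) (\<theta>\<^sub>1 x)) = \<theta>\<^sub>1 y" using Z by simp
    then show "\<exists>v. \<alpha> v (\<theta>\<^sub>1 x) = \<theta>\<^sub>1 y" using Z by auto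
  qed
  also have "\<dots> \<longleftrightarrow> (\<exists>v. \<psi> v (eqv x) = eqv y)"
    by (rule \<theta>2.orbits[symmetric]) (use assms eqv in auto)
  finally show ?thesis .
qed

text \<open>The right-hand side is the \<open>\<alpha>\<close>-displacement from
  \<open>\<theta>\<^sub>2 (eqv x)\<close> back to \<open>\<theta>\<^sub>1 x\<close>, along the first
  cocycle, and forward again. It describes the new cocycle implicitly: each level set is where two
  locally constant functions agree.\<close>

lemma eqv_cocycle_iff:
  assumes "x \<in> topspace X"
  shows "\<psi> u (eqv x) = eqv (\<phi> w x) \<longleftrightarrow>
    cocycle \<psi> \<alpha> \<theta>\<^sub>2 (eqv x) u = D (\<theta>\<^sub>1 (\<phi> w x)) + cocycle \<phi> \<alpha> \<theta>\<^sub>1 x w - D (\<theta>\<^sub>1 x)"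
    (is "_ \<longleftrightarrow> _ = ?u")
proof -
  have w: "\<phi> w x \<in> topspace X" using assms by simp
  have e: "eqv x \<in> topspace Y" "eqv (\<phi> w x) \<in> topspace Y" using eqv(1) assms w by blast+
  have "\<theta>\<^sub>1 (\<phi> w x) = \<alpha> (cocycle \<phi> \<alpha> \<theta>\<^sub>1 x w) (\<theta>\<^sub>1 x)"
    using \<theta>1.cocycle_eq_iff[OF assms] by metis
  then have "\<alpha> ?u (\<theta>\<^sub>2 (eqv x)) = \<theta>\<^sub>2 (eqv (\<phi> w x))"
    unfolding eqv(2)[OF assms] eqv(2)[OF w] using assms by simp
  moreover have "\<psi> u (eqv x) = eqv (\<phi> w x) \<longleftrightarrow> \<theta>\<^sub>2 (\<psi> u (eqv x)) = \<theta>\<^sub>2 (eqv (\<phi> w x))"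
    using \<theta>2.\<theta>_eq_iff e by simp
  ultimately show ?thesis
    using \<theta>2.cocycle_eq_iff[OF e(1), of u ?u] by auto
qed

lemma eqv_continuous_cocycle: "continuous_cocycle X \<phi> \<psi> eqv"
proof -
  have cocycle_iff: "cocycle \<phi> \<psi> eqv x w = u \<longleftrightarrow> \<psi> u (eqv x) = eqv (\<phi> w x)"
    if x: "x \<in> topspace X" for x w u
  proof -
    obtain v where v: "\<psi> v (eqv x) = eqv (\<phi> w x)"
      using eqv_orbits[of x "\<phi> w x"] x by auto
    have uniq: "\<psi> u (eqv x) = eqv (\<phi> w x) \<longleftrightarrow> u = v" for u
      unfolding v[symmetric] using eqv(1)[OF x] by simp
    then have "cocycle \<phi> \<psi> eqv x w = v" by (simp add: cocycle_def)
    then show ?thesis using uniq by auto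
  qed
  have lc: "loc_const X (\<lambda>x. cocycle \<phi> \<psi> eqv x w)" for w
    unfolding loc_const_iff
  proof
    fix u
    have cont: "continuous_map X Y eqv"
      using eqv_homeomorphic by (rule homeomorphic_imp_continuous_map)
    have l2: "loc_const X (\<lambda>x. cocycle \<psi> \<alpha> \<theta>\<^sub>2 (eqv x) u)"
      using continuous_map_compose[OF cont] \<theta>2.loc_const_cocycle[of u]
      unfolding loc_const_def o_def by blast
    have lD: "loc_const X (\<lambda>x. D (\<theta>\<^sub>1 x))" by (rule \<theta>1.loc_const_preimage[OF D])
    have "loc_const X (\<lambda>x. D (\<theta>\<^sub>1 (\<phi> w x)) + cocycle \<phi> \<alpha> \<theta>\<^sub>1 x w - D (\<theta>\<^sub>1 x))"
      using loc_const_combine[OF loc_const_combine[OF \<theta>1.X.loc_const_act[OF lD, of w]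
            \<theta>1.loc_const_cocycle[of w], of "(+)"] lD, of "(-)"] .
    from loc_const_openin[OF loc_const_Pair[OF l2 this], of "\<lambda>p. fst p = snd p"]
    have "openin X {x \<in> topspace X. cocycle \<psi> \<alpha> \<theta>\<^sub>2 (eqv x) u =
        D (\<theta>\<^sub>1 (\<phi> w x)) + cocycle \<phi> \<alpha> \<theta>\<^sub>1 x w - D (\<theta>\<^sub>1 x)}" by simp
    then show "openin X {x \<in> topspace X. cocycle \<phi> \<psi> eqv x w = u}"
      using cocycle_iff eqv_cocycle_iff
      by (elim back_subst[of "openin X"]) auto
  qed
  have "openin (prod_topology X (discrete_topology UNIV))
      {p \<in> topspace X \<times> UNIV. (case p of (x, w) \<Rightarrow> cocycle \<phi> \<psi> eqv x w) \<in> V}" for V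
  proof -
    have "{p \<in> topspace X \<times> UNIV. (case p of (x, w) \<Rightarrow> cocycle \<phi> \<psi> eqv x w) \<in> V} =
        (\<Union>w. {x \<in> topspace X. cocycle \<phi> \<psi> eqv x w \<in> V} \<times> {w})" by auto
    moreover have "openin (prod_topology X (discrete_topology UNIV))
        ({x \<in> topspace X. cocycle \<phi> \<psi> eqv x w \<in> V} \<times> {w})" for w
      using loc_const_openin[OF lc[of w], of "\<lambda>u. u \<in> V"] by (simp add: openin_prod_Times_iff)
    ultimately show ?thesis by auto
  qed
  then show ?thesis
    by (simp add: continuous_cocycle_def continuous_map_def)
qed

lemma eqv_bounded: "bounded_orbit_equivalence X \<phi> Y \<psi> eqv"
proof -
  have "eqv ` orbit \<phi> x = orbit \<psi> (eqv x)" if x: "x \<in> topspace X" for x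
  proof (intro equalityI subsetI)
    fix y assume "y \<in> eqv ` orbit \<phi> x"
    then obtain w where "y = eqv (\<phi> w x)" by (auto simp: orbit_def)
    moreover obtain v where "\<psi> v (eqv x) = eqv (\<phi> w x)"
      using eqv_orbits[of x "\<phi> w x"] x by auto
    ultimately show "y \<in> orbit \<psi> (eqv x)" unfolding orbit_def by (metis rangeI)
  next
    fix y assume "y \<in> orbit \<psi> (eqv x)"
    then obtain v where v: "y = \<psi> v (eqv x)" by (auto simp: orbit_def)
    then have "y \<in> topspace Y" using eqv(1)[OF x] by simp
    then obtain x' where x': "x' \<in> topspace X" "y = eqv x'" using eqv_surj by blast
    then obtain w where "\<phi> w x = x'" using eqv_orbits[OF x x'(1)] v by metis
    then show "y \<in> eqv ` orbit \<phi> x" using x'(2) by (auto simp: orbit_def)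
  qed
  then show ?thesis
    using eqv_homeomorphic eqv_continuous_cocycle by (simp add: bounded_orbit_equivalence_def)
qed

sublocale eqv: bounded_injection X \<phi> Y \<psi> eqv
  by unfold_locales
    (rule bounded_orbit_equivalence_imp_injection[OF \<theta>1.X.Cantor_Zd_system_axioms eqv_bounded])

text \<open>\<open>\<theta>\<^sub>2\<close> after \<open>eqv\<close> differs from
  \<open>\<theta>\<^sub>1\<close> by the displacement \<open>D\<close>, so
  \<open>coboundaries_transport\<close> settles indicators and additivity extends this to all
  integer functions.\<close>

lemma push_eqv_coboundary:
  assumes "f \<in> carrier (int_functions X)"
  shows "(\<lambda>z. push Y \<theta>\<^sub>2 0 (push X eqv 0 f) z - push X \<theta>\<^sub>1 0 f z) \<in> coboundaries Z \<alpha>"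
proof (rule int_functions_induct[OF \<theta>1.X.compact assms, where
      P = "\<lambda>f. (\<lambda>z. push Y \<theta>\<^sub>2 0 (push X eqv 0 f) z - push X \<theta>\<^sub>1 0 f z) \<in> coboundaries Z \<alpha>"])
  show "(\<lambda>z. push Y \<theta>\<^sub>2 0 (push X eqv 0 (\<lambda>_. 0)) z - push X \<theta>\<^sub>1 0 (\<lambda>_. 0) z) \<in> coboundaries Z \<alpha>"
    by (simp add: push_zero \<theta>1.Y.coboundaries_zero)
next
  fix f g
  assume "(\<lambda>z. push Y \<theta>\<^sub>2 0 (push X eqv 0 f) z - push X \<theta>\<^sub>1 0 f z) \<in> coboundaries Z \<alpha>"
    "(\<lambda>z. push Y \<theta>\<^sub>2 0 (push X eqv 0 g) z - push X \<theta>\<^sub>1 0 g z) \<in> coboundaries Z \<alpha>"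
  from \<theta>1.Y.coboundaries_add[OF this]
  show "(\<lambda>z. push Y \<theta>\<^sub>2 0 (push X eqv 0 (\<lambda>x. f x + g x)) z - push X \<theta>\<^sub>1 0 (\<lambda>x. f x + g x) z)
      \<in> coboundaries Z \<alpha>"
    by (simp add: push_add algebra_simps)
next
  fix f
  assume "(\<lambda>z. push Y \<theta>\<^sub>2 0 (push X eqv 0 f) z - push X \<theta>\<^sub>1 0 f z) \<in> coboundaries Z \<alpha>"
  from \<theta>1.Y.coboundaries_uminus[OF this]
  show "(\<lambda>z. push Y \<theta>\<^sub>2 0 (push X eqv 0 (\<lambda>x. - f x)) z - push X \<theta>\<^sub>1 0 (\<lambda>x. - f x) z)
      \<in> coboundaries Z \<alpha>"
    by (simp add: push_uminus algebra_simps)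
next
  fix A assume A: "clopen_in X A"
  have AX: "A \<subseteq> topspace X" using clopen_in_subset[OF A] .
  have AY: "eqv ` A \<subseteq> topspace Y" using AX eqv(1) by auto
  have "inj_on (\<lambda>z. \<alpha> (D z) z) (\<theta>\<^sub>1 ` A)"
    using bij AX unfolding bij_betw_def by (meson image_mono inj_on_subset)
  from \<theta>1.Y.coboundaries_transport[OF \<theta>1.clopen_image[OF A] D this]
  have "(\<lambda>z. indicator (\<theta>\<^sub>1 ` A) z - indicator ((\<lambda>z. \<alpha> (D z) z) ` \<theta>\<^sub>1 ` A) z) \<in> coboundaries Z \<alpha>" .
  moreover have "(\<lambda>z. \<alpha> (D z) z) ` \<theta>\<^sub>1 ` A = \<theta>\<^sub>2 ` eqv ` A"
    unfolding image_image using AX eqv(2) by (intro image_cong) auto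
  ultimately have "(\<lambda>z. indicator (\<theta>\<^sub>1 ` A) z - indicator (\<theta>\<^sub>2 ` eqv ` A) z) \<in> coboundaries Z \<alpha>" by simp
  from \<theta>1.Y.coboundaries_uminus[OF this]
  show "(\<lambda>z. push Y \<theta>\<^sub>2 0 (push X eqv 0 (indicator A)) z - push X \<theta>\<^sub>1 0 (indicator A) z)
      \<in> coboundaries Z \<alpha>"
    by (simp add: eqv.push_indicator[OF AX] \<theta>2.push_indicator[OF AY] \<theta>1.push_indicator[OF AX])
qed

text \<open>Both routes from \<open>X\<close> to \<open>Z\<close> induce the same map on classes, so
  the class given by \<open>eqv\<close> is a preimage under \<open>h_{\<theta>2}\<close>, and
  injectivity makes it the one that \<open>inv_into\<close> returns.\<close>

lemma induced_eqv:
  assumes "g \<in> carrier (G_group X \<phi>)"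
  shows "induced_map X \<phi> Y \<psi> eqv g =
    inv_into (carrier (G_group Y \<psi>)) (induced_map Y \<psi> Z \<alpha> \<theta>\<^sub>2) (induced_map X \<phi> Z \<alpha> \<theta>\<^sub>1 g)"
proof -
  obtain f where f: "f \<in> carrier (int_functions X)" "g = G_class X \<phi> f"
    using assms by (auto simp: \<theta>1.X.G_group_carrier)
  have "induced_map X \<phi> Y \<psi> eqv g \<in> carrier (G_group Y \<psi>)"
    using eqv.induced_hom assms by (auto simp: hom_def)
  moreover have "induced_map Y \<psi> Z \<alpha> \<theta>\<^sub>2 (induced_map X \<phi> Y \<psi> eqv g) = induced_map X \<phi> Z \<alpha> \<theta>\<^sub>1 g"
    using f push_eqv_coboundary[OF f(1)]
    by (simp add: eqv.induced_class \<theta>1.induced_class \<theta>2.induced_class eqv.push_int_functions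
        \<theta>1.Y.G_class_eq_iff)
  ultimately show ?thesis
    using inv_into_f_f[OF \<theta>2.induced_inj] by metis
qed

end

theorem theorem3p16:
  fixes X :: "'a topology" and \<phi> :: "int ^ 'd \<Rightarrow> 'a \<Rightarrow> 'a"
    and Y :: "'b topology" and \<psi> :: "int ^ 'd \<Rightarrow> 'b \<Rightarrow> 'b"
    and Z :: "'c topology" and \<alpha> :: "int ^ 'd \<Rightarrow> 'c \<Rightarrow> 'c"
    and \<theta>\<^sub>1 :: "'a \<Rightarrow> 'c" and \<theta>\<^sub>2 :: "'b \<Rightarrow> 'c"
  assumes "free_minimal_Cantor_system X \<phi>"
    and "free_minimal_Cantor_system Y \<psi>"
    and "free_minimal_Cantor_system Z \<alpha>"
    and "bounded_orbit_injection X \<phi> Z \<alpha> \<theta>\<^sub>1"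
    and "bounded_orbit_injection Y \<psi> Z \<alpha> \<theta>\<^sub>2"
    and "induced_map X \<phi> Z \<alpha> \<theta>\<^sub>1 (G_class X \<phi> (indicator (topspace X))) =
         induced_map Y \<psi> Z \<alpha> \<theta>\<^sub>2 (G_class Y \<psi> (indicator (topspace Y)))"
  shows "\<exists>\<theta>. bounded_orbit_equivalence X \<phi> Y \<psi> \<theta> \<and>
           (\<forall>g\<in>carrier (G_group X \<phi>).
              induced_map X \<phi> Y \<psi> \<theta> g =
              inv_into (carrier (G_group Y \<psi>)) (induced_map Y \<psi> Z \<alpha> \<theta>\<^sub>2)
                (induced_map X \<phi> Z \<alpha> \<theta>\<^sub>1 g)) \<and>
           ordered_group_iso X \<phi> Y \<psi> (induced_map X \<phi> Y \<psi> \<theta>)"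
proof -
  interpret \<theta>1: bounded_injection X \<phi> Z \<alpha> \<theta>\<^sub>1 by unfold_locales fact+
  interpret \<theta>2: bounded_injection Y \<psi> Z \<alpha> \<theta>\<^sub>2 by unfold_locales fact+
  let ?A = "\<theta>\<^sub>1 ` topspace X" and ?B = "\<theta>\<^sub>2 ` topspace Y"
  have "G_class Z \<alpha> (indicator ?A) = G_class Z \<alpha> (indicator ?B)"
    using assms(6)
    by (simp add: \<theta>1.induced_class \<theta>2.induced_class indicator_int_functions clopen_in_topspace
        \<theta>1.push_indicator \<theta>2.push_indicator)
  then have "(\<lambda>z. indicator ?A z - indicator ?B z :: int) \<in> coboundaries Z \<alpha>"
    by (simp add: \<theta>1.Y.G_class_eq_iff)
  from \<theta>1.Y.coboundaries_representation[OF this]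
  obtain k :: nat and C v where C: "\<forall>i<k. clopen_in Z (C i)"
    and AB: "\<forall>z\<in>topspace Z. indicator ?A z - indicator ?B z =
      (\<Sum>i<k. indicator (C i) z - indicator (\<alpha> (v i) ` C i) z :: int)"
    by (elim exE conjE)
  have ne: "?A \<noteq> {}" "?B \<noteq> {}" using \<theta>1.X.nonempty \<theta>2.X.nonempty by simp_all
  obtain D where D: "loc_const Z D" "bij_betw (\<lambda>z. \<alpha> (D z) z) ?A ?B"
    using \<theta>1.Y.equidecomposable[OF \<theta>1.clopen_range ne(1) \<theta>2.clopen_range ne(2), of k C v] C AB
    by blast
  interpret common_extension X \<phi> Y \<psi> Z \<alpha> \<theta>\<^sub>1 \<theta>\<^sub>2 D by unfold_locales fact+
  show ?thesis
    using eqv_bounded induced_eqv eqv.induced_ordered_group_iso[OF eqv_homeomorphic] by blast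
qed

end
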